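(* Let $0<r<R<\infty$, $\mathbb A=A(r,R)$, $r_\ast>0$, and let $\mathcal A^\ast\subset\mathbb C$ be a doubly connected domain whose inner boundary is the circle $\{|w|=r_\ast\}$ (i.e. the bounded component of $\mathbb C\setminus\mathcal A^\ast$ is the closed disk $\{|w|\le r_\ast\}$; the outer boundary is arbitrary). Let $h:\mathbb A\to\mathcal A^\ast$ be a sense-preserving harmonic homeomorphism onto $\mathcal A^\ast$ preserving the order of the boundary components, so in particular $|h(z)|\to r_\ast$ as $|z|\searrow r$. Then for every $r<\sigma<R$, $$\left[\frac{1}{2\pi\sigma}\int_{|z|=\sigma}|h(z)|^2\,|dz|\right]^{1/2}\geqslant\frac12\left(\frac\sigma r+\frac r\sigma\right)r_\ast .$$ If equality occurs for some $\sigma\in(r,R)$, then it occurs for every $\sigma\in(r,R)$ and $h(z)=\frac12\left(\frac zr+\frac r{\bar z}\right)r_\ast e^{i\alpha}$ for some $0\leqslant\alpha<2\pi$. *)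

theory Defs
  imports "HOL-Analysis.Analysis"
begin

definition annulus :: "real \<Rightarrow> real \<Rightarrow> complex set" where
  "annulus r R = {z. r < cmod z \<and> cmod z < R}"

definition dx :: "(complex \<Rightarrow> complex) \<Rightarrow> complex \<Rightarrow> complex" where
  "dx f z = vector_derivative (\<lambda>t::real. f (z + of_real t)) (at 0)"

definition dy :: "(complex \<Rightarrow> complex) \<Rightarrow> complex \<Rightarrow> complex" where
  "dy f z = vector_derivative (\<lambda>t::real. f (z + \<i> * of_real t)) (at 0)"

definition harmonic_on :: "complex set \<Rightarrow> (complex \<Rightarrow> complex) \<Rightarrow> bool" where
  "harmonic_on S f \<longleftrightarrow> open S \<and>
     (\<forall>z\<in>S. f differentiable (at z)) \<and>
     (\<forall>z\<in>S. dx f differentiable (at z) \<and> dy f differentiable (at z)) \<and>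
     continuous_on S (dx (dx f)) \<and> continuous_on S (dx (dy f)) \<and>
     continuous_on S (dy (dx f)) \<and> continuous_on S (dy (dy f)) \<and>
     (\<forall>z\<in>S. dx (dx f) z + dy (dy f) z = 0)"

definition jacobian_det :: "(complex \<Rightarrow> complex) \<Rightarrow> complex \<Rightarrow> real" where
  "jacobian_det f z = Re (dx f z) * Im (dy f z) - Im (dx f z) * Re (dy f z)"

definition sense_preserving_on :: "complex set \<Rightarrow> (complex \<Rightarrow> complex) \<Rightarrow> bool" where
  "sense_preserving_on S f \<longleftrightarrow> (\<forall>z\<in>S. jacobian_det f z > 0)"

text \<open>Doubly connected domain (in the extended plane) whose bounded complementary
  component is the closed disk of radius rs: every other component of the complement
  in C is unbounded (together with infinity they form the outer complementary component).\<close>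
definition dc_domain_inner_circle :: "complex set \<Rightarrow> real \<Rightarrow> bool" where
  "dc_domain_inner_circle D rs \<longleftrightarrow> open D \<and> connected D \<and>
     cball 0 rs \<in> components (- D) \<and>
     (\<forall>C\<in>components (- D). C \<noteq> cball 0 rs \<longrightarrow> \<not> bounded C)"

definition circ_mean2 :: "(complex \<Rightarrow> complex) \<Rightarrow> real \<Rightarrow> real" where
  "circ_mean2 h \<sigma> = sqrt ((1 / (2 * pi * \<sigma>)) *
      integral {0..2*pi} (\<lambda>t. (cmod (h (of_real \<sigma> * cis t)))\<^sup>2 * \<sigma>))"

end

theory Submission
  imports Defs "HOL-Complex_Analysis.Complex_Analysis"
begin

text \<open>Rescale and pass to logarithmic polar coordinates, H(t, x) = h(r exp(t + i x)) / rs for 0 < t < ln(R / r),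
  so that the claim becomes U(T) \<ge> cosh(T)^2 for the mean U of |H|^2 over a period in x. The Fourier coefficients
  satisfy f_n'' = n^2 f_n, hence for s < T and L = T - s
    U(T) = \<Sum>n. |f_n(s) cosh(|n| L) + f_n'(s) sinh(|n| L) / |n||^2.
  For suitable coefficients this sum of squares dominates a U + \<beta> A + c U' + 2 d X, taken at s, where
  a + \<beta> + 2 d = cosh(L)^2, A = \<Sum>n. n |f_n|^2 is the area enclosed by H(s, -) divided by \<pi>, and
  X = \<Sum>n. n Re((f_n' + |n| f_n) cnj(f_n)). As s tends to 0, U tends to 1 and U' \<ge> 0 because U is convex and \<ge> 1;
  it remains to see that A and X are asymptotically at least 1.

  Both follow from Green's formula with a cutoff \<psi>(|H|^2), \<omega> = -\<psi>', on s < t < t0. With the Jacobian J > 0 of H,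
  the integral of \<omega>(|H|^2) J is a positive multiple of the winding number of H, which is therefore 1, while the
  integrals of \<omega>(|H|^2) J / H^k vanish for k \<ge> 1. For X one has to bound from below the difference of H and the Poisson
  integral of H(s, -), multiplied by cnj(H); the inequality y \<ge> 1 + ln y, applied to the quotient of |H - H(s, y)|^2 and the
  Poisson denominator, reduces this to the mean of ln |1 - H(s, y) / H|, whose expansion in powers of 1 / H is
  annihilated by the cutoff integrals. In the case of equality every mode except n = 1 vanishes.\<close>

section \<open>The inequality for a single Fourier mode\<close>

text \<open>The only boundary information is |H| -> 1: H(0, -) and the derivatives of H at t = 0
  need not exist, so every quantity is taken at s > 0. Two facts replace regularity. The Dirichlet
  energy near t = 0 is small, because U' is nondecreasing and bounded below; and g_n = f_n' + |n|
  f_n satisfies g_n' = |n| g_n, so that it decays exponentially in |n|, uniformly as s tends to 0.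
  This is why X is built from g_n and not from f_n' alone. Two certificates are needed. The mode n =
  1 with f_1' = 0 at the boundary, that is the extremal map, must give equality; this fixes a +
  \<beta> + 2 d and c + d. With d = 0, hence c = k := cosh L sinh L, the mode n = 0 asks for a L^2 <
  2 k L - k^2 and the modes n -> +infinity ask for \<beta> \<le> 2 k. As a + \<beta> = cosh(L)^2,
  both cannot hold for large L: the area alone works only for bounded L, and is used for L \<le> 1.
  For L \<ge> 1 the quantity X takes over with c = 1 and d = k - 1; near L = 0 this d would be
  negative, while X is only bounded from below.\<close>

text \<open>hs m t is the solution of y'' = m^2 y with y(0) = 0 and y'(0) = 1.\<close>

definition hs :: "real \<Rightarrow> real \<Rightarrow> real" where
  "hs m t = (if m = 0 then t else sinh (m * t) / m)"

text \<open>The condition on the discriminant that makes the quadratic form mode_form below positive definite.\<close>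

definition mode_ineq :: "real \<Rightarrow> real \<Rightarrow> real \<Rightarrow> real \<Rightarrow> real \<Rightarrow> int \<Rightarrow> bool" where
  "mode_ineq L a b c d n \<longleftrightarrow> (let m = real_of_int \<bar>n\<bar>; x = real_of_int n in
     (a + b * x + 2 * d * x * m) * (hs m L)\<^sup>2
       < 2 * (c + d * x) * cosh (m * L) * hs m L - (c + d * x)\<^sup>2)"

lemma mode_ineq_nonzero:
  assumes "n \<noteq> 0" and "m = real_of_int \<bar>n\<bar>" and "x = real_of_int n"
    and "(a + b * x + 2 * d * x * m) * (sinh (m * L))\<^sup>2
       < 2 * m * (c + d * x) * cosh (m * L) * sinh (m * L) - m\<^sup>2 * (c + d * x)\<^sup>2"
  shows "mode_ineq L a b c d n"
proof -
  have m: "m > 0" using assms by simp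
  have "(a + b * x + 2 * d * x * m) * (sinh (m * L) / m)\<^sup>2 = (a + b * x + 2 * d * x * m) * (sinh (m * L))\<^sup>2 / m\<^sup>2"
    by (simp add: power_divide)
  also have "\<dots> < (2 * m * (c + d * x) * cosh (m * L) * sinh (m * L) - m\<^sup>2 * (c + d * x)\<^sup>2) / m\<^sup>2"
    using m assms(4) by (intro divide_strict_right_mono) auto
  also have "\<dots> = 2 * (c + d * x) * cosh (m * L) * (sinh (m * L) / m) - (c + d * x)\<^sup>2"
    using m by (simp add: field_simps power2_eq_square)
  finally show ?thesis using m assms(2,3) unfolding mode_ineq_def hs_def Let_def by simp
qed

section \<open>Hyperbolic estimates and the certificate for L \<le> 1\<close>

lemma cosh_pos_real: "cosh (x::real) > 0"
  using cosh_real_pos by blast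

text \<open>Equality at \<open>m = 2\<close> is the double-angle formula, and each further step
  gains at least \<open>cosh L * sinh L\<close> because \<open>cosh (m * L)\<close> is at least
  \<open>cosh L\<close>. With k = cosh L sinh L this bounds the negative term m^2 k^2 in the mode
  inequality by sinh(m L)^2.\<close>

lemma sinh_multiple_ge:
  fixes L :: real and m :: nat
  assumes "L > 0" "m \<ge> 2"
  shows "sinh (m * L) \<ge> m * (cosh L * sinh L)"
  using assms(2)
proof (induction m rule: dec_induct)
  case base
  then show ?case using sinh_double[of L] by (simp add: mult_ac)
next
  case (step m)
  have C: "cosh L \<ge> 1" by (simp add: cosh_real_ge_1)
  have S: "sinh L > 0" using assms by simp
  have sm: "sinh (m * L) \<ge> 0" using assms by simp
  have "cosh (m * L) \<ge> cosh L"
    using step assms by (intro cosh_real_nonneg_le_iff[THEN iffD2]) auto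
  then have "cosh (m * L) * sinh L \<ge> cosh L * sinh L" using S by simp
  moreover have "sinh (m * L) * cosh L \<ge> sinh (m * L)" using C sm
    by (simp add: mult_le_cancel_left1)
  moreover have "sinh (Suc m * L) = sinh (m * L) * cosh L + cosh (m * L) * sinh L"
    by (simp add: distrib_right sinh_add add.commute)
  moreover have "real (Suc m) * (cosh L * sinh L) = real m * (cosh L * sinh L) + cosh L * sinh L"
    by (simp add: algebra_simps)
  ultimately show ?case using step.IH by linarith
qed

text \<open>An induction on m: the increments of m coth(m L) are at least tanh L.\<close>

lemma coth_multiple_ge:
  fixes L :: real and m :: nat
  assumes L: "L > 0" and m2: "m \<ge> 2"
  shows "2 * (cosh L * sinh L) * m * cosh (m * L)
    \<ge> (4 * (cosh L)\<^sup>2 - 2 + 2 * (real m - 2) * (sinh L)\<^sup>2) * sinh (m * L)"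
proof -
  define C S where "C = cosh L" and "S = sinh L"
  have S: "S > 0" and C: "C > 0" and CS: "C\<^sup>2 = S\<^sup>2 + 1"
    using L cosh_square_eq[of L] by (auto simp: C_def S_def cosh_pos_real)
  have "m * cosh (m * L) / sinh (m * L) \<ge> (2 * C\<^sup>2 - 1) / (C * S) + (real m - 2) * (S / C)"
    using m2
  proof (induction m rule: dec_induct)
    case base
    have "cosh (2 * L) = 2 * C\<^sup>2 - 1" by (simp add: C_def cosh_double_cosh)
    moreover have "sinh (2 * L) = 2 * (C * S)" by (simp add: C_def S_def sinh_double)
    ultimately have "real 2 * cosh (real 2 * L) / sinh (real 2 * L) = (2 * C\<^sup>2 - 1) / (C * S)"
      using C S by (simp add: divide_simps)
    then show ?case by simp
  next
    case (step m)
    define c s where "c = cosh (m * L)" and "s = sinh (m * L)"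
    have s: "s > 0" using L step by (simp add: s_def)
    have c1: "c \<ge> 1" by (simp add: c_def cosh_real_ge_1)
    have cs: "c\<^sup>2 = s\<^sup>2 + 1" using cosh_square_eq[of "m * L"] by (auto simp: c_def s_def)
    have sS: "sinh (Suc m * L) = s * C + c * S"
      by (simp add: distrib_right sinh_add add.commute c_def s_def C_def S_def)
    have cS: "cosh (Suc m * L) = c * C + s * S"
      by (simp add: distrib_right cosh_add add.commute c_def s_def C_def S_def)
    have "m * (C * S) \<le> s" using sinh_multiple_ge[OF L step(1)] by (simp add: s_def C_def S_def)
    moreover have "s \<le> c * s" using c1 s by simp
    ultimately have ms: "m * (C * S) \<le> c * s" by linarith
    have pos: "s * C + c * S > 0" using s C c1 S by (simp add: add_pos_pos)
    \<comment> \<open>Since C^2 - S^2 and c^2 - s^2 both equal 1, the cross-multiplied increment is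
      c s - m C S, which is nonnegative by \<open>ms\<close>.\<close>
    have "(Suc m) * (c * C + s * S) * (s * C) - (m * c * C + S * s) * (s * C + c * S)
        = c * s * (C\<^sup>2 - S\<^sup>2) - m * (C * S) * (c\<^sup>2 - s\<^sup>2)"
      by (simp add: algebra_simps power2_eq_square)
    also have "\<dots> \<ge> 0" using ms by (simp add: CS cs)
    finally have "(m * c * C + S * s) * (s * C + c * S) \<le> (Suc m) * (c * C + s * S) * (s * C)"
      by simp
    then have "(m * c * C + S * s) / (s * C) \<le> (Suc m) * (c * C + s * S) / (s * C + c * S)"
      using pos s C by (simp add: divide_simps)
    moreover have "(m * c * C + S * s) / (s * C) = m * c / s + S / C"
      using s C by (simp add: field_simps)
    ultimately have "m * c / s + S / C \<le> (Suc m) * cosh (Suc m * L) / sinh (Suc m * L)"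
      unfolding sS cS by simp
    moreover have "(real (Suc m) - 2) * (S / C) = (real m - 2) * (S / C) + S / C"
      by (simp add: algebra_simps)
    ultimately show ?case using step.IH unfolding c_def[symmetric] s_def[symmetric] by linarith
  qed
  moreover have "sinh (m * L) > 0" using L m2 by simp
  ultimately have "((2 * C\<^sup>2 - 1) / (C * S) + (real m - 2) * (S / C)) * sinh (m * L) * (2 * (C * S))
      \<le> m * cosh (m * L) * (2 * (C * S))"
    using C S by (intro mult_right_mono) (auto simp: pos_le_divide_eq)
  moreover have "((2 * C\<^sup>2 - 1) / (C * S) + (real m - 2) * (S / C)) * sinh (m * L) * (2 * (C * S))
     = (4 * C\<^sup>2 - 2 + 2 * (real m - 2) * S\<^sup>2) * sinh (m * L)"
    using C S by (simp add: field_simps power2_eq_square)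
  ultimately have "(4 * C\<^sup>2 - 2 + 2 * (real m - 2) * S\<^sup>2) * sinh (m * L) \<le> 2 * (C * S) * m * cosh (m * L)"
    by (simp only: mult_ac)
  then show ?thesis by (simp only: C_def S_def)
qed

text \<open>The numerical input of the case L \<ge> 1. The eighth power of the quadratic Taylor
  bound at 1/8 gives e \<ge> 2.7; then 7.29 = 2.7^2, and 0.1372 is just above 1 / 7.29.\<close>

lemma exp_2_bounds: "exp (2::real) \<ge> 7.29" "exp (- (2::real)) \<le> 0.1372"
proof -
  have "exp (1::real) \<ge> 27/10"
  proof -
    have "exp (1/8::real) \<ge> 1 + 1/8 + (1/8)\<^sup>2 / 2" by (rule exp_lower_Taylor_quadratic) simp
    then have "(1 + 1/8 + (1/8)\<^sup>2 / 2) ^ 8 \<le> exp (1/8::real) ^ 8" by (intro power_mono) auto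
    also have "\<dots> = exp 1" by (simp add: exp_of_nat_mult[symmetric])
    finally show ?thesis by (simp add: power2_eq_square eval_nat_numeral)
  qed
  then have "(27/10) * (27/10) \<le> exp (1::real) * exp 1" by (intro mult_mono) auto
  then show *: "exp (2::real) \<ge> 7.29" by (simp add: exp_add[symmetric])
  show "exp (- (2::real)) \<le> 0.1372"
    using * by (simp add: exp_minus field_simps)
qed

lemma sinh_le_x_cosh:
  assumes "0 \<le> (x::real)"
  shows "sinh x \<le> x * cosh x"
proof -
  have "(\<lambda>x. x * cosh x - sinh x) 0 \<le> (\<lambda>x::real. x * cosh x - sinh x) x"
  proof (rule DERIV_nonneg_imp_nondecreasing[OF assms])
    fix y :: real assume "0 \<le> y" "y \<le> x"
    then have "((\<lambda>x. x * cosh x - sinh x) has_real_derivative y * sinh y) (at y)" "y * sinh y \<ge> 0"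
      by (auto intro!: derivative_eq_intros)
    then show "\<exists>D. ((\<lambda>x. x * cosh x - sinh x) has_real_derivative D) (at y) \<and> D \<ge> 0" by blast
  qed
  then show ?thesis by simp
qed

lemma x_le_sinh:
  assumes "0 \<le> (x::real)"
  shows "x \<le> sinh x"
proof -
  have "(\<lambda>x. sinh x - x) 0 \<le> (\<lambda>x::real. sinh x - x) x"
  proof (rule DERIV_nonneg_imp_nondecreasing[OF assms])
    fix y :: real
    have "((\<lambda>x. sinh x - x) has_real_derivative cosh y - 1) (at y)" "cosh y - 1 \<ge> 0"
      by (auto intro!: derivative_eq_intros simp: cosh_real_ge_1)
    then show "\<exists>D. ((\<lambda>x. sinh x - x) has_real_derivative D) (at y) \<and> D \<ge> 0" by blast
  qed
  then show ?thesis by simp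
qed

text \<open>This is the mode n = 0 of the certificate for L \<le> 1: with k = C S, the condition (1
  - S^2) L^2 < 2 k L - k^2 is the same as (k - L)^2 < (L S)^2. At the half argument, tanh(L/2) \<le>
  L/2 gives cosh(L/2)^2 \<le> 1 / (1 - L^2/4) \<le> 1 + L^2/3, where the second inequality uses L
  \<le> 1.\<close>

lemma cosh_sinh_bounds_small:
  assumes L: "0 < L" "L \<le> (1::real)"
  shows "cosh L * sinh L - L < L * sinh L"
proof -
  define c s where "c = cosh (L/2)" and "s = sinh (L/2)"
  have cs: "c\<^sup>2 = s\<^sup>2 + 1" using cosh_square_eq[of "L/2"] by (auto simp: c_def s_def)
  have S: "sinh L = 2 * s * c" and C: "cosh L = 2 * c\<^sup>2 - 1"
    using sinh_double[of "L/2"] cosh_double_cosh[of "L/2"] by (auto simp: c_def s_def)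
  have c: "c \<ge> 1" and s: "s > 0" using L by (auto simp: c_def s_def cosh_real_ge_1)
  have sc: "s \<le> L/2 * c" using sinh_le_x_cosh[of "L/2"] L by (simp add: c_def s_def)
  have "s\<^sup>2 \<le> (L/2 * c)\<^sup>2" using sc s by (intro power_mono) auto
  then have "c\<^sup>2 - 1 \<le> L\<^sup>2/4 * c\<^sup>2" using cs by (simp add: power_mult_distrib power_divide)
  then have "c\<^sup>2 * (1 - L\<^sup>2/4) \<le> 1" by (simp add: algebra_simps)
  moreover have "1 \<le> (1 + L\<^sup>2/3) * (1 - L\<^sup>2/4)"
  proof -
    have "(1 + L\<^sup>2/3) * (1 - L\<^sup>2/4) - 1 = L\<^sup>2 * (1 - L\<^sup>2) / 12" by (simp add: field_simps)
    moreover have "L\<^sup>2 * (1 - L\<^sup>2) / 12 \<ge> 0" using power_le_one[of L 2] L by simp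
    ultimately show ?thesis by linarith
  qed
  moreover have "1 - L\<^sup>2/4 > 0" using power_le_one[of L 2] L by simp
  ultimately have c2: "c\<^sup>2 \<le> 1 + L\<^sup>2/3"
    using mult_right_le_imp_le order_trans by blast
  have "s * c \<le> L/2 * c * c" using sc c by (intro mult_right_mono) auto
  then have "sinh L \<le> L * c\<^sup>2" by (simp add: S power2_eq_square)
  also have "\<dots> \<le> L * (1 + L\<^sup>2/3)" using c2 L by (intro mult_left_mono) auto
  finally have S1: "sinh L \<le> L * (1 + L\<^sup>2/3)" .
  have C1: "cosh L - L \<le> 1 - L + 2*L\<^sup>2/3" using C c2 by simp
  have Lp: "1 - L + 2*L\<^sup>2/3 > 0"
  proof -
    have "1 - L + 2*L\<^sup>2/3 = 2/3 * (L - 3/4)\<^sup>2 + 5/8" by (simp add: power2_eq_square field_simps)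
    moreover have "2/3 * (L - 3/4)\<^sup>2 \<ge> 0" by simp
    ultimately show ?thesis by linarith
  qed
  have "sinh L * (cosh L - L) \<le> sinh L * (1 - L + 2*L\<^sup>2/3)"
    using C1 L by (intro mult_left_mono) auto
  also have "\<dots> \<le> L * (1 + L\<^sup>2/3) * (1 - L + 2*L\<^sup>2/3)"
    using S1 Lp by (intro mult_right_mono) auto
  also have "\<dots> = L - L\<^sup>2 * (1 - L) - L^4 / 3 * (1 - 2/3 * L)"
    by (simp add: field_simps power2_eq_square eval_nat_numeral)
  also have "\<dots> < L"
  proof -
    have "L^4 / 3 * (1 - 2/3 * L) > 0" "L\<^sup>2 * (1 - L) \<ge> 0" using L by auto
    then show ?thesis by linarith
  qed
  finally show ?thesis by (simp add: algebra_simps)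
qed

lemma abs_int_natE:
  fixes n :: int
  obtains m :: nat where "real_of_int \<bar>n\<bar> = real m" "n \<ge> 0 \<Longrightarrow> real_of_int n = real m" "n < 0 \<Longrightarrow> real_of_int n = - real m"
  by (rule that[of "nat \<bar>n\<bar>"]) auto

text \<open>With d = 0 the degenerate mode 1 forces c = cosh L sinh L; the value 2 S^2 of the area
  coefficient is the slope in m of the lower bound in \<open>coth_multiple_ge\<close>. As that
  coefficient is nonnegative, -m follows from m for m \<ge> 2; the modes 0 and -1, outside the range
  of that bound, are done by hand.\<close>

lemma mode_ineq_small:
  assumes L: "0 < L" "L \<le> 1" and n: "n \<noteq> 1"
  shows "mode_ineq L (1 - (sinh L)\<^sup>2) (2 * (sinh L)\<^sup>2) (cosh L * sinh L) 0 n"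
proof -
  define C S k where "C = cosh L" and "S = sinh L" and "k = C * S"
  have S: "S > 0" and C: "C > 0" and CS: "C\<^sup>2 = S\<^sup>2 + 1"
    using L cosh_square_eq[of L] by (auto simp: C_def S_def cosh_pos_real)
  obtain m :: nat where m: "real_of_int \<bar>n\<bar> = real m" "n \<ge> 0 \<Longrightarrow> real_of_int n = real m" "n < 0 \<Longrightarrow> real_of_int n = - real m"
    by (rule abs_int_natE[of n]) (rule that)
  have "mode_ineq L (1 - S\<^sup>2) (2 * S\<^sup>2) k 0 n"
  proof (cases "n = 0")
    case True
    have 1: "k - L < L * S" using cosh_sinh_bounds_small[OF L] by (simp add: k_def C_def S_def)
    have "L \<le> k"
    proof -
      have "L \<le> sinh L" using x_le_sinh L by simp
      moreover have "sinh L \<le> cosh L * sinh L" using S cosh_real_ge_1[of L] by (simp add: S_def)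
      ultimately show ?thesis by (simp add: k_def C_def S_def)
    qed
    then have "(k - L)\<^sup>2 < (L * S)\<^sup>2" using 1 by (intro power_strict_mono) auto
    then show ?thesis using True
      by (simp add: mode_ineq_def hs_def Let_def power2_eq_square algebra_simps)
  next
    case False
    define s c where "s = sinh (m * L)" and "c = cosh (m * L)"
    have m1: "m \<ge> 1" using False m by (metis abs_eq_0 less_one linorder_not_le of_int_eq_0_iff of_nat_0)
    have s: "s > 0" using m1 L by (simp add: s_def)
    have "(1 - S\<^sup>2 + 2 * S\<^sup>2 * n) * s\<^sup>2 < 2 * m * k * c * s - m\<^sup>2 * k\<^sup>2"
    proof (cases "m = 1")
      case True
      then have "real_of_int n = -1" using n False m
        by (smt (verit) of_int_eq_1_iff of_nat_1)
      moreover have "s = S" "c = C" using True by (auto simp: s_def c_def S_def C_def)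
      moreover have "(1 - S\<^sup>2 + 2 * S\<^sup>2 * (-1)) * S\<^sup>2 < 2 * k * C * S - k\<^sup>2"
      proof -
        have "2 * k * C * S - k\<^sup>2 = C\<^sup>2 * S\<^sup>2" by (simp add: k_def power2_eq_square)
        then have "2 * k * C * S - k\<^sup>2 = (S\<^sup>2 + 1) * S\<^sup>2" by (simp only: CS)
        moreover have "(S\<^sup>2 + 1) * S\<^sup>2 - (1 - S\<^sup>2 + 2 * S\<^sup>2 * (-1)) * S\<^sup>2 = 4 * (S\<^sup>2 * S\<^sup>2)" by (simp add: algebra_simps)
        moreover have "S\<^sup>2 * S\<^sup>2 > 0" using S by simp
        ultimately show ?thesis by linarith
      qed
      ultimately show ?thesis using True by simp
    next
      case False
      then have m2: "m \<ge> 2" using m1 by simp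
      have sk: "m * k \<le> s" using sinh_multiple_ge[OF L(1) m2] by (simp add: s_def k_def C_def S_def)
      have mk: "(m * k)\<^sup>2 \<le> s\<^sup>2" using sk S C by (intro power_mono) (auto simp: k_def)
      have "(4 * C\<^sup>2 - 2 + 2 * (real m - 2) * S\<^sup>2) * s \<le> 2 * k * m * c"
        using coth_multiple_ge[OF L(1) m2] by (simp add: s_def c_def k_def C_def S_def)
      then have "(4 * C\<^sup>2 - 2 + 2 * (real m - 2) * S\<^sup>2) * s * s \<le> 2 * k * m * c * s"
        using s by (intro mult_right_mono) auto
      \<comment> \<open>Divided by s^2, the left-hand side is 4 C^2 - 3 + 2 (m - 2) S^2 = 1 + 2 m
        S^2, which exceeds the required 1 - S^2 + 2 m S^2 by S^2.\<close>
      then have "(4 * C\<^sup>2 - 2 + 2 * (real m - 2) * S\<^sup>2) * s\<^sup>2 - s\<^sup>2 \<le> 2 * m * k * c * s - m\<^sup>2 * k\<^sup>2"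
        using mk by (simp add: power2_eq_square algebra_simps)
      moreover have "(4 * C\<^sup>2 - 2 + 2 * (real m - 2) * S\<^sup>2) * s\<^sup>2 - s\<^sup>2 = (1 - S\<^sup>2 + 2 * S\<^sup>2 * m) * s\<^sup>2 + S\<^sup>2 * s\<^sup>2"
        unfolding CS by (simp add: algebra_simps)
      moreover have "S\<^sup>2 * s\<^sup>2 > 0" using S s by simp
      moreover have nm: "real_of_int n \<le> real m" using m(1) by linarith
      have "(1 - S\<^sup>2 + 2 * S\<^sup>2 * n) * s\<^sup>2 \<le> (1 - S\<^sup>2 + 2 * S\<^sup>2 * m) * s\<^sup>2"
        using nm by (intro mult_right_mono add_left_mono mult_left_mono) auto
      ultimately show ?thesis by linarith
    qed
    then show ?thesis
      by (intro mode_ineq_nonzero[OF False m(1)[symmetric] refl]) (simp add: s_def c_def)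
  qed
  then show ?thesis by (simp add: C_def S_def k_def)
qed

section \<open>The certificate for L \<ge> 1\<close>

lemma cosh_sinh_large:
  assumes "L \<ge> (1::real)"
  defines "k \<equiv> cosh L * sinh L"
  shows "k \<ge> 1.78" "k \<ge> 1.78 * L" "(cosh L)\<^sup>2 \<le> k + 0.57"
proof -
  have k: "k = sinh (2 * L) / 2" using sinh_double[of L] by (simp add: k_def mult_ac)
  \<comment> \<open>The second factor is at least 2 L - 1, which makes the bound for k grow linearly
    in L; the constant 1.78 is just below (7.29 - 0.1372) / 4, the value obtained at L = 1.\<close>
  have "exp (2 * L) = exp 2 * exp (2 * (L - 1))" by (simp add: exp_add[symmetric])
  also have "\<dots> \<ge> 7.29 * (1 + 2 * (L - 1))"
    using exp_2_bounds(1) exp_ge_add_one_self[of "2 * (L - 1)"] assms by (intro mult_mono) auto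
  finally have e: "exp (2 * L) \<ge> 7.29 * (2 * L - 1)" by simp
  have e': "exp (- (2 * L)) \<le> 0.1372" using exp_2_bounds(2) assms(1)
    by (smt (verit) exp_le_cancel_iff)
  show "k \<ge> 1.78 * L" using e e' assms(1) unfolding k sinh_field_def by (simp add: field_simps)
  then show "k \<ge> 1.78" using assms by simp
  have "(cosh L)\<^sup>2 = (1 + cosh (2 * L)) / 2" by (simp add: cosh_double_cosh)
  also have "\<dots> = k + (1 + exp (- (2 * L))) / 2" unfolding k sinh_field_def cosh_field_def by (simp add: field_simps)
  finally show "(cosh L)\<^sup>2 \<le> k + 0.57" using e' by simp
qed

text \<open>From m to m + 1 the left-hand side grows at least by the factor exp L \<ge> 9/4, whereas
  (m + 1)^2 \<le> (3/2 m)^2 for m \<ge> 2.\<close>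

lemma sinh_multiple_ge_large:
  fixes L :: real and m :: nat
  assumes "L \<ge> 1" "m \<ge> 2"
  shows "2 * sinh (m * L) \<ge> m\<^sup>2 * (cosh L * sinh L)"
  using assms(2)
proof (induction m rule: dec_induct)
  case base
  then show ?case using sinh_double[of L] by (simp add: mult_ac)
next
  case (step m)
  have S: "sinh L > 0" and C: "cosh L > 0" using assms by (simp_all add: cosh_pos_real)
  have sm: "sinh (m * L) \<ge> 0" using assms by simp
  have e: "exp L \<ge> 9/4"
  proof -
    have "exp 1 \<le> exp L" using assms by (simp only: exp_le_cancel_iff)
    moreover have "exp (1::real) \<ge> 1 + 1 + 1\<^sup>2/2" by (rule exp_lower_Taylor_quadratic) simp
    ultimately show ?thesis unfolding power_one by linarith
  qed
  have "sinh (Suc m * L) = sinh (m * L) * cosh L + cosh (m * L) * sinh L"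
    by (simp add: distrib_right sinh_add add.commute)
  also have "\<dots> \<ge> sinh (m * L) * cosh L + sinh (m * L) * sinh L"
    using S by (intro add_left_mono mult_right_mono sinh_le_cosh_real) auto
  also have "sinh (m * L) * cosh L + sinh (m * L) * sinh L = sinh (m * L) * exp L"
    by (simp add: sinh_plus_cosh[symmetric] algebra_simps)
  also have "\<dots> \<ge> sinh (m * L) * (9/4)" using e sm by (intro mult_left_mono) auto
  finally have 1: "sinh (Suc m * L) \<ge> 9/4 * sinh (m * L)" by simp
  have "(real (Suc m))\<^sup>2 \<le> (3/2 * real m)\<^sup>2" using step by (intro power_mono) auto
  then have "(real (Suc m))\<^sup>2 * (cosh L * sinh L) \<le> 9/4 * (real m)\<^sup>2 * (cosh L * sinh L)"
    using S C by (intro mult_right_mono) (auto simp: power_mult_distrib power_divide)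
  with 1 step.IH show ?case unfolding of_nat_power by linarith
qed

text \<open>The terms with 2 d n |n| on the two sides nearly cancel because coth(m L) is close to 1.
  What decides for m \<ge> 2 is (2 m - a) sinh(m L)^2 against m^2 (1 + d n)^2, and 2 m - a \<ge>
  1.43 + k by the bounds of \<open>cosh_sinh_large\<close>. The remaining inequalities are
  polynomial in k \<ge> 1.78.\<close>

lemma mode_ineq_large:
  assumes L: "1 \<le> L" and n: "n \<noteq> 1"
  defines "k \<equiv> cosh L * sinh L"
  shows "mode_ineq L ((cosh L)\<^sup>2 - 2 * (k - 1)) 0 1 (k - 1) n"
proof -
  define C S where "C = cosh L" and "S = sinh L"
  have S: "S > 0" and C: "C > 0" and CS: "C\<^sup>2 = S\<^sup>2 + 1"
    using L cosh_square_eq[of L] by (auto simp: C_def S_def cosh_pos_real)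
  have kCS: "k = C * S" by (simp add: k_def C_def S_def)
  have k1: "k \<ge> 1.78" "k \<ge> 1.78 * L" "C\<^sup>2 \<le> k + 0.57"
    using cosh_sinh_large[OF L] by (auto simp: k_def C_def)
  define a d where "a = C\<^sup>2 - 2 * (k - 1)" and "d = k - 1"
  have a: "a \<le> 2.57 - k" using k1 by (simp add: a_def)
  obtain m :: nat where m: "real_of_int \<bar>n\<bar> = real m" "n \<ge> 0 \<Longrightarrow> real_of_int n = real m" "n < 0 \<Longrightarrow> real_of_int n = - real m"
    by (rule abs_int_natE[of n]) (rule that)
  have "mode_ineq L a 0 1 d n"
  proof (cases "n = 0")
    case True
    have "a * L\<^sup>2 \<le> (2.57 - 1.78 * L) * L\<^sup>2" using a k1 by (intro mult_right_mono) auto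
    also have "\<dots> < 2 * L - 1"
    proof -
      define u where "u = L - 1"
      have u: "u \<ge> 0" using L by (simp add: u_def)
      have "2 * L - 1 - (2.57 - 1.78 * L) * L\<^sup>2 = 0.21 + 2.2 * u + 2.77 * u\<^sup>2 + 1.78 * u^3"
        by (simp add: u_def field_simps power2_eq_square power3_eq_cube)
      also have "\<dots> > 0" using u by (intro add_pos_nonneg) auto
      finally show ?thesis by simp
    qed
    finally show ?thesis using True
      by (simp add: mode_ineq_def hs_def Let_def)
  next
    case False
    define s c where "s = sinh (m * L)" and "c = cosh (m * L)"
    have m1: "m \<ge> 1" using False m by (metis abs_eq_0 less_one linorder_not_le of_int_eq_0_iff of_nat_0)
    have s: "s > 0" using m1 L by (simp add: s_def)
    have d: "d > 0" using k1 by (simp add: d_def)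
    have "(a + 2 * d * n * m) * s\<^sup>2 < 2 * m * (1 + d * n) * c * s - m\<^sup>2 * (1 + d * n)\<^sup>2"
    proof (cases "m = 1")
      case True
      then have "real_of_int n = -1" using n False m
        by (smt (verit) of_int_eq_1_iff of_nat_1)
      moreover have "s = S" "c = C" using True by (auto simp: s_def c_def S_def C_def)
      moreover have "(a + 2 * d * (-1)) * S\<^sup>2 < 2 * (1 + d * (-1)) * C * S - (1 + d * (-1))\<^sup>2"
      proof -
        have kk: "k\<^sup>2 = C\<^sup>2 * S\<^sup>2" by (simp add: kCS power_mult_distrib)
        have "2 * (1 + d * (-1)) * C * S - (1 + d * (-1))\<^sup>2 - (a + 2 * d * (-1)) * S\<^sup>2
          = 2 * (2 - k) * k - (2 - k)\<^sup>2 - k\<^sup>2 + 4 * (k - 1) * S\<^sup>2"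
          unfolding a_def d_def kk by (simp add: kCS algebra_simps)
        also have "\<dots> = 4 * (k - 1) * (C\<^sup>2 - k)" unfolding CS by (simp add: algebra_simps power2_eq_square)
        also have "C\<^sup>2 - k = C * exp (- L)" by (simp add: kCS power2_eq_square C_def S_def cosh_minus_sinh[symmetric] algebra_simps)
        also have "4 * (k - 1) * (C * exp (- L)) > 0" using C k1 by simp
        finally show ?thesis by simp
      qed
      ultimately show ?thesis using True by simp
    next
      case m_ne: False
      then have m2: "m \<ge> 2" using m1 by simp
      have sk: "m\<^sup>2 * k \<le> 2 * s" using sinh_multiple_ge_large[OF L m2] by (simp add: s_def k_def)
      have c: "c = s + exp (- (m * L))" unfolding c_def s_def by (simp add: cosh_minus_sinh[symmetric])
      have exps: "exp (- (m * L)) \<le> 0.1372"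
      proof -
        have "2 * 1 \<le> m * L" using m2 L by (intro mult_mono) auto
        then have "exp (- (m * L)) \<le> exp (-2)" by simp
        then show ?thesis using exp_2_bounds(2) by linarith
      qed
      \<comment> \<open>y measures s in units of m k / 2. By \<open>sk\<close> it is at least m
        \<ge> 2, so that m and constants can be absorbed into multiples of y, which then
        cancels.\<close>
      define y where "y = 2 * s / (m * k)"
      have mk: "m * k > 0" using m2 k1 by simp
      have my: "real m \<le> y" using sk mk by (simp add: y_def pos_le_divide_eq power2_eq_square mult_ac)
      have sy: "s = y * (m * k) / 2" using m2 k1 by (simp add: y_def)
      have y: "y > 0" using my m2 by linarith
      show ?thesis
      proof (cases "n \<ge> 0")
        case True
        have "1 + d * m \<le> y * (k - 1/2)"
        proof -
          have "1 \<le> y / 2" using my m2 by simp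
          moreover have "d * m \<le> d * y" using my d by simp
          ultimately show ?thesis by (simp add: d_def algebra_simps)
        qed
        then have "(1 + d * m)\<^sup>2 \<le> (y * (k - 1/2))\<^sup>2" using d by (intro power_mono) auto
        also have "\<dots> < (2 * m - a) * (y * k / 2)\<^sup>2"
        proof -
          have "4 * (k - 1/2)\<^sup>2 < (1.43 + k) * k\<^sup>2"
          proof -
            have "(1.43 + k) * k\<^sup>2 - 4 * (k - 1/2)\<^sup>2 = k * ((k - 1.285)\<^sup>2 + 2.348775) - 1"
              by (simp add: field_simps power2_eq_square)
            moreover have "k * ((k - 1.285)\<^sup>2 + 2.348775) \<ge> 1.78 * 2.348775"
              using k1 by (intro mult_mono) auto
            ultimately show ?thesis by simp
          qed
          also have "\<dots> \<le> (2 * m - a) * k\<^sup>2" using a m2 by (intro mult_right_mono) auto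
          finally have "4 * (k - 1/2)\<^sup>2 * y\<^sup>2 < (2 * m - a) * k\<^sup>2 * y\<^sup>2" using y by simp
          then show ?thesis by (simp add: power_mult_distrib power_divide mult_ac)
        qed
        finally have "m\<^sup>2 * (1 + d * m)\<^sup>2 < m\<^sup>2 * ((2 * m - a) * (y * k / 2)\<^sup>2)"
          using m2 by simp
        also have "\<dots> = (2 * m - a) * s\<^sup>2" by (simp add: sy power_mult_distrib power_divide)
        finally have 1: "m\<^sup>2 * (1 + d * m)\<^sup>2 < (2 * m - a) * s\<^sup>2" .
        have "2 * m * (1 + d * m) * s * s \<le> 2 * m * (1 + d * m) * c * s"
          using c s d by (intro mult_right_mono mult_left_mono) auto
        then show ?thesis using 1 m True
          by (simp add: algebra_simps power2_eq_square)
      next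
        case False
        \<comment> \<open>Now 1 + d n = 1 - d m is negative, so the estimate c \<ge> s used for
          positive n points the wrong way; instead c is written as s + exp(-m L) with exp(-m L)
          \<le> 0.1372.\<close>
        have dm: "d * m \<ge> 1"
        proof -
          have "0.78 * 2 \<le> d * m" using k1 m2 by (intro mult_mono) (auto simp: d_def)
          then show ?thesis by simp
        qed
        define z where "z = y * k / 2"
        have sz: "s = m * z" by (simp add: sy z_def)
        have z: "z > 0" using y k1 by (simp add: z_def)
        define w where "w = 2 * (1 - 1 / k) * z"
        have dw: "d * m - 1 \<le> w"
        proof -
          have "w = y * d" using k1 by (simp add: w_def z_def d_def field_simps)
          moreover have "d * m \<le> d * y" using my d by simp
          ultimately show ?thesis by (simp add: mult_ac)
        qed
        have "(d * m - 1)\<^sup>2 \<le> w\<^sup>2" using dw dm by (intro power_mono) auto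
        moreover have "2 * (d * m - 1) * exp (- (m * L)) * z \<le> 2 * w * 0.1372 * z"
          using dw dm exps z by (intro mult_right_mono mult_mono mult_left_mono) auto
        moreover have "2 * w * 0.1372 * z + w\<^sup>2 < (2 * m - a) * z\<^sup>2"
        proof -
          have "2 * (2 * u * z) * 0.1372 * z + (2 * u * z)\<^sup>2 = (0.5488 * u + 4 * u\<^sup>2) * z\<^sup>2" for u
            by (simp add: power2_eq_square algebra_simps)
          then have "2 * w * 0.1372 * z + w\<^sup>2 = (0.5488 * (1 - 1 / k) + 4 * (1 - 1 / k)\<^sup>2) * z\<^sup>2"
            unfolding w_def .
          also have "\<dots> < (1.43 + k) * z\<^sup>2"
          proof (intro mult_strict_right_mono)
            have "(1.43 + k - (0.5488 * (1 - 1 / k) + 4 * (1 - 1 / k)\<^sup>2)) * k\<^sup>2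
              = k * ((k - 1.5594)\<^sup>2 + 6.11707164) - 4"
              using k1 by (simp add: field_simps power2_eq_square)
            moreover have "k * ((k - 1.5594)\<^sup>2 + 6.11707164) \<ge> 1.78 * 6.11707164"
              using k1 by (intro mult_mono) auto
            ultimately have "(1.43 + k - (0.5488 * (1 - 1 / k) + 4 * (1 - 1 / k)\<^sup>2)) * k\<^sup>2 > 0" by simp
            then show "0.5488 * (1 - 1 / k) + 4 * (1 - 1 / k)\<^sup>2 < 1.43 + k"
              using k1 by (simp add: zero_less_mult_iff)
          qed (use z in simp)
          also have "\<dots> \<le> (2 * m - a) * z\<^sup>2" using a m2 by (intro mult_right_mono) auto
          finally show ?thesis .
        qed
        ultimately have "2 * (d * m - 1) * exp (- (m * L)) * z + (d * m - 1)\<^sup>2 < (2 * m - a) * z\<^sup>2" by linarith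
        then have "m\<^sup>2 * (2 * (d * m - 1) * exp (- (m * L)) * z + (d * m - 1)\<^sup>2) < m\<^sup>2 * ((2 * m - a) * z\<^sup>2)" using m2 by simp
        then show ?thesis using m False unfolding c sz
          by (simp add: algebra_simps power2_eq_square)
      qed
    qed
    then show ?thesis
      by (intro mode_ineq_nonzero[OF False m(1)[symmetric] refl]) (simp add: s_def c_def)
  qed
  then show ?thesis by (simp add: C_def S_def k_def a_def d_def)
qed

section \<open>Fourier series of continuous periodic functions\<close>

definition cmean :: "(real \<Rightarrow> 'a::euclidean_space) \<Rightarrow> 'a" where
  "cmean f = integral {0..2*pi} f /\<^sub>R (2 * pi)"

definition fcoef :: "(real \<Rightarrow> complex) \<Rightarrow> int \<Rightarrow> complex" where
  "fcoef u n = cmean (\<lambda>\<theta>. u \<theta> * cnj (cis (of_int n * \<theta>)))"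

lemma cont_int: "continuous_on UNIV f \<Longrightarrow> f integrable_on {a..b::real}"
  for f :: "real \<Rightarrow> 'a::euclidean_space"
  by (meson continuous_on_subset integrable_continuous_real subset_UNIV)

lemma cmean_add:
  "continuous_on UNIV f \<Longrightarrow> continuous_on UNIV g \<Longrightarrow> cmean (\<lambda>\<theta>. f \<theta> + g \<theta>) = cmean f + cmean g"
  by (simp add: cmean_def integral_add cont_int scaleR_right_distrib)

lemma cmean_diff:
  "continuous_on UNIV f \<Longrightarrow> continuous_on UNIV g \<Longrightarrow> cmean (\<lambda>\<theta>. f \<theta> - g \<theta>) = cmean f - cmean g"
  by (simp add: cmean_def integral_diff cont_int scaleR_right_diff_distrib)

lemma cmean_sum:
  assumes "finite I" "\<And>i. i \<in> I \<Longrightarrow> continuous_on UNIV (f i)"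
  shows "cmean (\<lambda>\<theta>. \<Sum>i\<in>I. f i \<theta>) = (\<Sum>i\<in>I. cmean (f i))"
  using assms by (simp add: cmean_def integral_sum cont_int scaleR_right.sum)

lemma cmean_cmult: "cmean (\<lambda>\<theta>. c * f \<theta>) = c * cmean f" for c :: complex
  by (simp add: cmean_def integral_mult_right)

lemma cmean_cmult_right: "cmean (\<lambda>\<theta>. f \<theta> * c) = cmean f * c" for c :: complex
  by (simp add: cmean_def integral_mult_left)

lemma cmean_rmult: "cmean (\<lambda>\<theta>. c * f \<theta>) = c * cmean f" for c :: real
  by (simp add: cmean_def integral_mult_right)

lemma cmean_const [simp]: "cmean (\<lambda>\<theta>. c) = c"
  by (simp add: cmean_def)

lemma cmean_linear:
  assumes "bounded_linear L" "continuous_on UNIV f"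
  shows "cmean (\<lambda>\<theta>. L (f \<theta>)) = L (cmean f)"
  using integral_linear[OF cont_int[OF assms(2)] assms(1), of 0 "2*pi"]
    linear_scale[OF bounded_linear.linear[OF assms(1)]]
  by (simp add: cmean_def o_def)

lemmas cmean_Re = cmean_linear[OF bounded_linear_Re]
  and cmean_cnj = cmean_linear[OF bounded_linear_cnj]
  and cmean_of_real = cmean_linear[OF bounded_linear_of_real]

lemma cmean_mono:
  fixes f g :: "real \<Rightarrow> real"
  assumes "continuous_on UNIV f" "continuous_on UNIV g" "\<And>\<theta>. f \<theta> \<le> g \<theta>"
  shows "cmean f \<le> cmean g"
  unfolding cmean_def real_scaleR_def
  by (intro mult_left_mono integral_le cont_int assms) auto

lemma cmean_nonneg:
  fixes f :: "real \<Rightarrow> real"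
  assumes "continuous_on UNIV f" "\<And>\<theta>. 0 \<le> f \<theta>"
  shows "0 \<le> cmean f"
  using cmean_mono[OF _ assms(1), of "\<lambda>_. 0"] assms by simp

lemma norm_cmean_le:
  assumes "continuous_on UNIV f" "\<And>\<theta>. norm (f \<theta>) \<le> B"
  shows "norm (cmean f) \<le> B"
proof -
  have "norm (integral {0..2*pi} f) \<le> B * (2*pi - 0)"
    by (rule integral_bound) (use assms in \<open>auto intro: continuous_on_subset\<close>)
  then show ?thesis by (simp add: cmean_def field_simps)
qed

lemma cmean_uniform_limit:
  assumes "uniform_limit UNIV f g sequentially" "\<And>n. continuous_on UNIV (f n)"
  shows "(\<lambda>n. cmean (f n)) \<longlonglongrightarrow> cmean g"
proof -
  have g: "continuous_on UNIV g"
    by (rule uniform_limit_theorem[OF _ assms(1)]) (use assms in auto)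
  show ?thesis
  proof (rule LIMSEQ_I)
    fix e :: real assume "e > 0"
    then have "\<forall>\<^sub>F n in sequentially. \<forall>x\<in>UNIV. dist (f n x) (g x) < e/2"
      using assms(1) unfolding uniform_limit_iff by (meson half_gt_zero)
    then obtain N where N: "\<And>n x. n \<ge> N \<Longrightarrow> norm (f n x - g x) < e/2"
      unfolding eventually_sequentially dist_norm by blast
    show "\<exists>no. \<forall>n\<ge>no. norm (cmean (f n) - cmean g) < e"
    proof (intro exI allI impI)
      fix n assume "n \<ge> N"
      then have "norm (cmean (\<lambda>\<theta>. f n \<theta> - g \<theta>)) \<le> e/2"
        using N less_imp_le by (intro norm_cmean_le continuous_intros assms g) blast
      then show "norm (cmean (f n) - cmean g) < e"
        using \<open>e > 0\<close> by (simp add: cmean_diff assms g)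
    qed
  qed
qed

lemma cmean_eq_0D:
  fixes f :: "real \<Rightarrow> real"
  assumes "continuous_on UNIV f" "\<And>\<theta>. 0 \<le> f \<theta>" "cmean f = 0" "\<theta> \<in> {0..2*pi}"
  shows "f \<theta> = 0"
proof -
  have "integral {0..2*pi} f = 0" using assms(3) by (simp add: cmean_def)
  then show ?thesis
    using integral_eq_0_iff[of 0 "2*pi" f] assms continuous_on_subset[OF assms(1)] by auto
qed

lemma cis_of_int_2pi: "cis (of_int n * (2 * pi)) = 1"
  by (metis cis_multiple_2pi mult.commute Ints_of_int)

lemma has_vector_derivative_cis:
  "((\<lambda>x. cis (c * x)) has_vector_derivative \<i> * of_real c * cis (c * x)) (at x within S)"
proof -
  have "((\<lambda>x. exp (\<i> * complex_of_real (c * x))) has_vector_derivative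
       \<i> * of_real c * exp (\<i> * complex_of_real (c * x))) (at x within S)"
    by (auto intro!: derivative_eq_intros has_vector_derivative_real_field simp: mult_ac)
  then show ?thesis by (simp add: cis_conv_exp)
qed

lemma cmean_cis: "cmean (\<lambda>\<theta>. cis (of_int n * \<theta>)) = (if n = 0 then 1 else 0)"
proof (cases "n = 0")
  case False
  have "((\<lambda>\<theta>. cis (of_int n * \<theta>)) has_integral
      (cis (of_int n * (2*pi)) / (\<i> * of_int n) - cis (of_int n * 0) / (\<i> * of_int n))) {0..2*pi}"
  proof (rule fundamental_theorem_of_calculus)
    fix x :: real
    show "((\<lambda>\<theta>. cis (of_int n * \<theta>) / (\<i> * of_int n)) has_vector_derivative cis (of_int n * x)) (at x within {0..2*pi})"
      using bounded_linear.has_vector_derivative[OF bounded_linear_divide[of "\<i> * of_int n"] has_vector_derivative_cis[of "of_int n"]] False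
      by simp
  qed simp
  then show ?thesis using False cis_of_int_2pi[of n] by (simp add: cmean_def integral_unique)
qed simp

lemma cont_cis [continuous_intros]: "continuous_on S f \<Longrightarrow> continuous_on S (\<lambda>x. cis (f x))"
  unfolding cis_conv_exp by (intro continuous_intros)

lemma fcoef_cis: "fcoef (\<lambda>\<theta>. c * cis (of_int k * \<theta>)) n = (if n = k then c else 0)"
proof -
  have "c * cis (of_int k * \<theta>) * cnj (cis (of_int n * \<theta>)) = c * cis (of_int (k - n) * \<theta>)" for \<theta>
    by (simp only: cis_cnj mult.assoc cis_mult) (simp add: algebra_simps)
  then have "fcoef (\<lambda>\<theta>. c * cis (of_int k * \<theta>)) n = cmean (\<lambda>\<theta>. c * cis (of_int (k - n) * \<theta>))"
    unfolding fcoef_def by (simp only:)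
  then show ?thesis unfolding cmean_cmult cmean_cis by simp
qed

lemma fcoef_add:
  "continuous_on UNIV f \<Longrightarrow> continuous_on UNIV g \<Longrightarrow> fcoef (\<lambda>\<theta>. f \<theta> + g \<theta>) n = fcoef f n + fcoef g n"
  unfolding fcoef_def distrib_right by (intro cmean_add continuous_intros)

lemma fcoef_diff:
  "continuous_on UNIV f \<Longrightarrow> continuous_on UNIV g \<Longrightarrow> fcoef (\<lambda>\<theta>. f \<theta> - g \<theta>) n = fcoef f n - fcoef g n"
  unfolding fcoef_def left_diff_distrib by (intro cmean_diff continuous_intros)

lemma fcoef_cmult: "fcoef (\<lambda>\<theta>. c * f \<theta>) n = c * fcoef f n"
  unfolding fcoef_def mult.assoc by (rule cmean_cmult)

lemma cmean_trig_cnj: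
  assumes "continuous_on UNIV v"
  shows "cmean (\<lambda>\<theta>. (c * cis (of_int k * \<theta>)) * cnj (v \<theta>)) = c * cnj (fcoef v k)"
proof -
  have "cmean (\<lambda>\<theta>. (c * cis (of_int k * \<theta>)) * cnj (v \<theta>))
     = c * cmean (\<lambda>\<theta>. cnj (v \<theta> * cnj (cis (of_int k * \<theta>))))"
    unfolding cmean_cmult[symmetric] by (simp add: mult_ac)
  also have "\<dots> = c * cnj (fcoef v k)"
    unfolding fcoef_def by (subst cmean_cnj) (auto intro!: continuous_intros assms)
  finally show ?thesis .
qed

lemma bessel:
  assumes u: "continuous_on UNIV u" and F: "finite F"
  shows "(\<Sum>n\<in>F. (cmod (fcoef u n))\<^sup>2) \<le> cmean (\<lambda>\<theta>. (cmod (u \<theta>))\<^sup>2)"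
proof -
  define S where "S = (\<lambda>\<theta>. \<Sum>n\<in>F. fcoef u n * cis (of_int n * \<theta>))"
  have S: "continuous_on UNIV S" unfolding S_def by (intro continuous_intros)
  have Sv: "cmean (\<lambda>\<theta>. S \<theta> * cnj (v \<theta>)) = (\<Sum>n\<in>F. fcoef u n * cnj (fcoef v n))"
    if "continuous_on UNIV v" for v
    unfolding S_def sum_distrib_right
    by (subst cmean_sum[OF F]) (auto intro!: continuous_intros that sum.cong simp: cmean_trig_cnj[OF that])
  have fS: "fcoef S n = fcoef u n" if "n \<in> F" for n
  proof -
    have "fcoef S n = (\<Sum>k\<in>F. fcoef (\<lambda>\<theta>. fcoef u k * cis (of_int k * \<theta>)) n)"
      unfolding S_def fcoef_def[of _ n] sum_distrib_right by (rule cmean_sum[OF F]) (intro continuous_intros)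
    also have "\<dots> = (\<Sum>k\<in>F. if n = k then fcoef u k else 0)" by (intro sum.cong fcoef_cis refl)
    finally show ?thesis using that F by simp
  qed
  have "0 \<le> cmean (\<lambda>\<theta>. (cmod (u \<theta> - S \<theta>))\<^sup>2)"
    by (intro cmean_nonneg continuous_intros u S) auto
  also have "(\<lambda>\<theta>. (cmod (u \<theta> - S \<theta>))\<^sup>2)
     = (\<lambda>\<theta>. (cmod (u \<theta>))\<^sup>2 - 2 * Re (S \<theta> * cnj (u \<theta>)) + Re (S \<theta> * cnj (S \<theta>)))"
    by (rule ext) (simp add: cmod_power2, simp add: power2_eq_square algebra_simps)
  also have "cmean \<dots> = cmean (\<lambda>\<theta>. (cmod (u \<theta>))\<^sup>2) - 2 * Re (cmean (\<lambda>\<theta>. S \<theta> * cnj (u \<theta>))) + Re (cmean (\<lambda>\<theta>. S \<theta> * cnj (S \<theta>)))"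
    by (subst cmean_add cmean_diff cmean_rmult cmean_Re; (intro continuous_intros u S)?)+ simp
  also have "\<dots> = cmean (\<lambda>\<theta>. (cmod (u \<theta>))\<^sup>2) - (\<Sum>n\<in>F. (cmod (fcoef u n))\<^sup>2)"
  proof -
    have "(\<Sum>n\<in>F. fcoef u n * cnj (fcoef S n)) = (\<Sum>n\<in>F. fcoef u n * cnj (fcoef u n))"
      by (intro sum.cong) (auto simp: fS)
    then show ?thesis unfolding Sv[OF u] Sv[OF S]
      by (simp only: complex_norm_square[symmetric] of_real_sum[symmetric] Re_complex_of_real)
  qed
  finally show ?thesis by simp
qed

section \<open>Density of trigonometric polynomials and Parseval's identity\<close>

inductive trigp :: "(real \<Rightarrow> complex) \<Rightarrow> bool" where
  trigp_monom: "trigp (\<lambda>\<theta>. c * cis (of_int n * \<theta>))"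
| trigp_add: "trigp f \<Longrightarrow> trigp g \<Longrightarrow> trigp (\<lambda>\<theta>. f \<theta> + g \<theta>)"

lemma trigp_const: "trigp (\<lambda>\<theta>. c)"
  using trigp_monom[of c 0] by simp

lemma trigp_mult:
  assumes "trigp f" "trigp g" shows "trigp (\<lambda>\<theta>. f \<theta> * g \<theta>)"
  using assms
proof (induction rule: trigp.induct)
  case (trigp_monom c n)
  then show ?case
  proof (induction rule: trigp.induct)
    case (trigp_monom d k)
    have "(\<lambda>\<theta>. c * cis (of_int n * \<theta>) * (d * cis (of_int k * \<theta>))) = (\<lambda>\<theta>. (c * d) * cis (of_int (n + k) * \<theta>))"
      by (rule ext) (simp add: distrib_right cis_mult[symmetric])
    then show ?case by (simp only: trigp.trigp_monom)
  next
    case (trigp_add f g)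
    then show ?case by (simp add: distrib_left trigp.trigp_add)
  qed
next
  case (trigp_add f g)
  then show ?case by (simp add: distrib_right trigp.trigp_add)
qed

lemma trigp_cont: "trigp p \<Longrightarrow> continuous_on UNIV p"
  by (induction rule: trigp.induct) (auto intro!: continuous_intros)

lemma trigp_parseval:
  assumes "trigp p" and v: "continuous_on UNIV v"
  shows "\<exists>N0. \<forall>N\<ge>N0. (\<Sum>n\<in>{-int N..int N}. fcoef p n * cnj (fcoef v n)) = cmean (\<lambda>\<theta>. p \<theta> * cnj (v \<theta>))"
  using assms(1)
proof (induction rule: trigp.induct)
  case (trigp_monom c k)
  show ?case
  proof (intro exI allI impI)
    fix N assume "nat \<bar>k\<bar> \<le> N"
    then have "k \<in> {-int N..int N}" by auto
    moreover have "(\<Sum>n\<in>{-int N..int N}. fcoef (\<lambda>\<theta>. c * cis (of_int k * \<theta>)) n * cnj (fcoef v n))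
      = (\<Sum>n\<in>{-int N..int N}. if n = k then c * cnj (fcoef v n) else 0)"
      by (intro sum.cong) (auto simp: fcoef_cis)
    ultimately show "(\<Sum>n\<in>{-int N..int N}. fcoef (\<lambda>\<theta>. c * cis (of_int k * \<theta>)) n * cnj (fcoef v n))
       = cmean (\<lambda>\<theta>. c * cis (of_int k * \<theta>) * cnj (v \<theta>))"
      by (simp add: cmean_trig_cnj[OF v])
  qed
next
  case (trigp_add f g)
  then obtain N1 N2 where
    "\<And>N. N \<ge> N1 \<Longrightarrow> (\<Sum>n\<in>{-int N..int N}. fcoef f n * cnj (fcoef v n)) = cmean (\<lambda>\<theta>. f \<theta> * cnj (v \<theta>))"
    "\<And>N. N \<ge> N2 \<Longrightarrow> (\<Sum>n\<in>{-int N..int N}. fcoef g n * cnj (fcoef v n)) = cmean (\<lambda>\<theta>. g \<theta> * cnj (v \<theta>))"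
    by blast
  moreover have "cmean (\<lambda>\<theta>. (f \<theta> + g \<theta>) * cnj (v \<theta>)) = cmean (\<lambda>\<theta>. f \<theta> * cnj (v \<theta>)) + cmean (\<lambda>\<theta>. g \<theta> * cnj (v \<theta>))"
    unfolding distrib_right by (intro cmean_add continuous_intros v trigp_cont trigp_add)
  ultimately have "\<forall>N\<ge>max N1 N2. (\<Sum>n\<in>{-int N..int N}. fcoef (\<lambda>\<theta>. f \<theta> + g \<theta>) n * cnj (fcoef v n)) = cmean (\<lambda>\<theta>. (f \<theta> + g \<theta>) * cnj (v \<theta>))"
    using fcoef_add[OF trigp_cont trigp_cont, OF trigp_add(1,2)]
    by (simp add: distrib_right sum.distrib)
  then show ?case by blast
qed

text \<open>Makes the Stone-Weierstrass theorem on the circle an approximation by trigonometric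
  polynomials: on the circle a real linear form f equals f(1) cos + f(\<i>) sin.\<close>

lemma trigp_polynomial:
  assumes "real_polynomial_function (g :: complex \<Rightarrow> real)"
  shows "trigp (\<lambda>\<theta>. of_real (g (cis \<theta>)))"
  using assms
proof (induction rule: real_polynomial_function.induct)
  case (linear f)
  have "f (cis \<theta>) = cos \<theta> * f 1 + sin \<theta> * f \<i>" for \<theta>
  proof -
    have "cis \<theta> = cos \<theta> *\<^sub>R 1 + sin \<theta> *\<^sub>R \<i>" by (simp add: complex_eq_iff)
    then show ?thesis using linear by (simp add: linear_add linear_scale bounded_linear.linear)
  qed
  moreover have "complex_of_real (cos \<theta>) = (cis (of_int 1 * \<theta>) + cis (of_int (-1) * \<theta>)) / 2"
    "complex_of_real (sin \<theta>) = (cis (of_int 1 * \<theta>) - cis (of_int (-1) * \<theta>)) / (2 * \<i>)" for \<theta>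
    by (auto simp: complex_eq_iff)
  ultimately have "(\<lambda>\<theta>. complex_of_real (f (cis \<theta>))) =
     (\<lambda>\<theta>. (of_real (f 1) / 2 + of_real (f \<i>) / (2 * \<i>)) * cis (of_int 1 * \<theta>)
        + (of_real (f 1) / 2 - of_real (f \<i>) / (2 * \<i>)) * cis (of_int (-1) * \<theta>))"
    by (intro ext) (simp add: add_divide_distrib diff_divide_distrib left_diff_distrib right_diff_distrib distrib_left distrib_right mult_ac)
  then show ?case by (simp only: trigp.intros)
next
  case (const c)
  then show ?case by (rule trigp_const)
qed (auto intro: trigp_mult trigp_add)

lemma periodic_int:
  assumes "\<And>x. u (x + 2 * pi) = u x"
  shows "u (x + 2 * pi * of_int k) = u x"
proof (induction k rule: int_induct[of _ 0])
  case (step1 i)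
  then show ?case using assms[of "x + 2 * pi * of_int i"] by (simp add: algebra_simps)
next
  case (step2 i)
  then show ?case using assms[of "x + 2 * pi * of_int (i - 1)"] by (simp add: algebra_simps)
qed auto

lemma periodic_cis_eq:
  assumes "\<And>x. u (x + 2 * pi) = u x" "cis x = cis y"
  shows "u x = u y"
proof -
  have "cos x = cos y" "sin x = sin y" using assms(2) by (auto simp: complex_eq_iff)
  then obtain k :: int where "x = y + 2 * pi * of_int k"
    by (metis sin_cos_eq_iff mult.commute)
  then show ?thesis using periodic_int[of u y k] assms(1) by simp
qed

lemma periodic_Arg2pi:
  assumes "\<And>x. u (x + 2 * pi) = u x"
  shows "u (Arg2pi (cis x)) = u x"
proof (rule periodic_cis_eq[of u, OF assms])
  have "cis x = of_real (norm (cis x)) * cis (Arg2pi (cis x))" by (rule Arg2pi_eq[folded cis_conv_exp])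
  then show "cis (Arg2pi (cis x)) = cis x" unfolding norm_cis of_real_1 mult_1 by (rule sym)
qed

text \<open>The candidate is u composed with \<open>Arg\<close>, which jumps on the negative axis;
  by periodicity it agrees off 0 with u composed with \<open>Arg2pi\<close>, whose jump is on the
  positive axis.\<close>

lemma circle_function:
  fixes u :: "real \<Rightarrow> complex"
  assumes u: "continuous_on UNIV u" and per: "\<And>x. u (x + 2 * pi) = u x"
  obtains w where "continuous_on (sphere 0 1) w" "\<And>x. w (cis x) = u x"
proof
  define w where "w = (\<lambda>z. u (Arg z))"
  have cisArg: "cis (Arg z) = z" if "cmod z = 1" for z
    using that cis_Arg[of z] by (cases "z = 0") (auto simp: sgn_div_norm)
  show *: "w (cis x) = u x" for x
    unfolding w_def by (rule periodic_cis_eq[of u, OF per]) (simp add: cisArg)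
  have uc: "isCont u x" for x using u by (simp add: continuous_on_eq_continuous_at)
  show "continuous_on (sphere 0 1) w"
  proof (rule continuous_at_imp_continuous_on, rule ballI)
    fix z :: complex assume z: "z \<in> sphere 0 1"
    show "isCont w z"
    proof (cases "z \<in> \<real>\<^sub>\<le>\<^sub>0")
      case False
      then show ?thesis unfolding w_def
        by (intro isCont_o2[OF continuous_at_Arg uc])
    next
      case True
      have nz: "z \<noteq> 0" using z by auto
      then have nz2: "z \<notin> \<real>\<^sub>\<ge>\<^sub>0" using True by (auto simp: complex_nonneg_Reals_iff complex_nonpos_Reals_iff complex_eq_iff)
      have 1: "isCont (\<lambda>z. u (Arg2pi z)) z"
        by (intro isCont_o2[OF continuous_at_Arg2pi uc] nz2)
      have eq: "w y = u (Arg2pi y)" if "y \<noteq> 0" for y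
      proof -
        have "y = of_real (norm y) * cis (Arg2pi y)" by (rule Arg2pi_eq[folded cis_conv_exp])
        moreover have "of_real (norm y) \<noteq> (0::complex)" using that by simp
        ultimately have "cis (Arg2pi y) = y / of_real (norm y)" by (metis nonzero_mult_div_cancel_left)
        also have "\<dots> = cis (Arg y)" using that by (simp add: cis_Arg sgn_eq)
        finally have "cis (Arg y) = cis (Arg2pi y)" by simp
        then show ?thesis unfolding w_def by (rule periodic_cis_eq[of u, OF per])
      qed
      have "\<forall>\<^sub>F y in nhds z. u (Arg2pi y) = w y"
        using t1_space_nhds[OF nz] by eventually_elim (simp add: eq)
      then show ?thesis using 1 isCont_cong by fastforce
    qed
  qed
qed

lemma trigp_dense:
  assumes u: "continuous_on UNIV u" and per: "\<And>x. u (x + 2 * pi) = u x" and e: "e > 0"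
  obtains p where "trigp p" "\<And>x. cmod (u x - p x) < e"
proof -
  obtain w where w: "continuous_on (sphere 0 1) w" "\<And>x. w (cis x) = u x"
    using circle_function[OF u per] by blast
  obtain g1 where g1: "real_polynomial_function g1" "\<And>x. x \<in> sphere 0 1 \<Longrightarrow> \<bar>Re (w x) - g1 x\<bar> < e / 2"
    by (rule Stone_Weierstrass_real_polynomial_function[of "sphere 0 1" "\<lambda>z. Re (w z)" "e/2"])
      (use w e in \<open>auto intro!: continuous_intros\<close>)
  obtain g2 where g2: "real_polynomial_function g2" "\<And>x. x \<in> sphere 0 1 \<Longrightarrow> \<bar>Im (w x) - g2 x\<bar> < e / 2"
    by (rule Stone_Weierstrass_real_polynomial_function[of "sphere 0 1" "\<lambda>z. Im (w z)" "e/2"])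
      (use w e in \<open>auto intro!: continuous_intros\<close>)
  show thesis
  proof
    show "trigp (\<lambda>\<theta>. of_real (g1 (cis \<theta>)) + \<i> * of_real (g2 (cis \<theta>)))"
      by (intro trigp_add trigp_mult trigp_const trigp_polynomial g1 g2)
    fix x
    have "cmod (u x - (of_real (g1 (cis x)) + \<i> * of_real (g2 (cis x)))) \<le> \<bar>Re (w (cis x)) - g1 (cis x)\<bar> + \<bar>Im (w (cis x)) - g2 (cis x)\<bar>"
      using cmod_le[of "u x - (of_real (g1 (cis x)) + \<i> * of_real (g2 (cis x)))"] by (simp add: w)
    also have "\<dots> < e / 2 + e / 2" by (intro add_strict_mono g1 g2) auto
    finally show "cmod (u x - (of_real (g1 (cis x)) + \<i> * of_real (g2 (cis x)))) < e" by simp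
  qed
qed

text \<open>Splits u = w + p with a trigonometric polynomial p and |w| \<le> d. The inequality |x y|
  \<le> (x^2 / d + d y^2) / 2 makes the contribution of w of order d, in the mean directly and in
  the partial sums through Bessel's inequality, uniformly in N.\<close>

theorem parseval:
  assumes u: "continuous_on UNIV u" and per: "\<And>x. u (x + 2 * pi) = u x" and v: "continuous_on UNIV v"
  shows "(\<lambda>N. \<Sum>n\<in>{-int N..int N}. fcoef u n * cnj (fcoef v n)) \<longlonglongrightarrow> cmean (\<lambda>\<theta>. u \<theta> * cnj (v \<theta>))"
proof (rule LIMSEQ_I)
  define V where "V = cmean (\<lambda>\<theta>. (cmod (v \<theta>))\<^sup>2)"
  have V: "V \<ge> 0" unfolding V_def by (intro cmean_nonneg continuous_intros v) auto
  fix e :: real assume e: "e > 0"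
  \<comment> \<open>The two errors add up to d (1 + V); the 2 in place of 1 makes the final
    inequality strict.\<close>
  define d where "d = e / (2 + V)"
  have d: "d > 0" using e V by (simp add: d_def)
  obtain p where p: "trigp p" "\<And>x. cmod (u x - p x) < d" using trigp_dense[OF u per d] by blast
  note pc = trigp_cont[OF p(1)]
  define w where "w = (\<lambda>x. u x - p x)"
  have w: "continuous_on UNIV w" unfolding w_def by (intro continuous_intros u pc)
  have wd: "cmod (w x) \<le> d" for x using p(2)[of x] by (simp add: w_def)
  have ab: "cmod (x * cnj y) \<le> ((cmod x)\<^sup>2 / d + d * (cmod y)\<^sup>2) / 2" for x y
  proof -
    have "0 \<le> (cmod x - d * cmod y)\<^sup>2 / d" using d by simp
    also have "\<dots> = (cmod x)\<^sup>2 / d + d * (cmod y)\<^sup>2 - 2 * (cmod x * cmod y)" using d by (simp add: field_simps power2_eq_square)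
    finally show ?thesis by (simp add: norm_mult)
  qed
  have "(cmod (w \<theta>))\<^sup>2 \<le> d\<^sup>2" for \<theta> by (intro power_mono wd) auto
  then have wint: "cmean (\<lambda>\<theta>. (cmod (w \<theta>))\<^sup>2) \<le> d\<^sup>2"
    using cmean_mono[of "\<lambda>\<theta>. (cmod (w \<theta>))\<^sup>2" "\<lambda>_. d\<^sup>2"] continuous_on_power[OF continuous_on_norm[OF w], of 2] by simp
  have m1: "cmod (cmean (\<lambda>\<theta>. w \<theta> * cnj (v \<theta>))) \<le> (d + d * V) / 2"
  proof -
    have "cmod (cmean (\<lambda>\<theta>. w \<theta> * cnj (v \<theta>))) \<le> cmean (\<lambda>\<theta>. cmod (w \<theta> * cnj (v \<theta>)))"
      unfolding cmean_def by (simp, intro integral_norm_bound_integral cont_int continuous_intros w v) (auto simp: norm_mult)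
    also have "\<dots> \<le> cmean (\<lambda>\<theta>. (d + d * (cmod (v \<theta>))\<^sup>2) / 2)"
    proof (intro cmean_mono continuous_intros w v)
      fix \<theta>
      have "(cmod (w \<theta>))\<^sup>2 / d \<le> d\<^sup>2 / d" using wd[of \<theta>] d by (intro divide_right_mono power_mono) auto
      then show "cmod (w \<theta> * cnj (v \<theta>)) \<le> (d + d * (cmod (v \<theta>))\<^sup>2) / 2"
        using ab[of "w \<theta>" "v \<theta>"] d by (simp add: power2_eq_square)
    qed auto
    also have "(\<lambda>\<theta>. (d + d * (cmod (v \<theta>))\<^sup>2) / 2) = (\<lambda>\<theta>. d/2 + d/2 * (cmod (v \<theta>))\<^sup>2)" by (auto simp: field_simps)
    also have "cmean \<dots> = cmean (\<lambda>_. d/2) + cmean (\<lambda>\<theta>. d/2 * (cmod (v \<theta>))\<^sup>2)"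
      by (intro cmean_add continuous_intros v)
    also have "\<dots> = (d + d * V) / 2" unfolding cmean_rmult cmean_const V_def by (simp add: field_simps)
    finally show ?thesis .
  qed
  have m2: "cmod (\<Sum>n\<in>{-int N..int N}. fcoef w n * cnj (fcoef v n)) \<le> (d + d * V) / 2" for N
  proof -
    have "cmod (\<Sum>n\<in>{-int N..int N}. fcoef w n * cnj (fcoef v n)) \<le> (\<Sum>n\<in>{-int N..int N}. ((cmod (fcoef w n))\<^sup>2 / d + d * (cmod (fcoef v n))\<^sup>2) / 2)"
      by (rule sum_norm_le) (rule ab)
    also have "\<dots> = ((\<Sum>n\<in>{-int N..int N}. (cmod (fcoef w n))\<^sup>2) / d + d * (\<Sum>n\<in>{-int N..int N}. (cmod (fcoef v n))\<^sup>2)) / 2"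
      by (simp add: sum_divide_distrib[symmetric] sum.distrib sum_distrib_left)
    also have "\<dots> \<le> (d\<^sup>2 / d + d * V) / 2"
      unfolding V_def using d
      by (intro divide_right_mono add_mono mult_left_mono bessel v order_trans[OF bessel wint] w) auto
    finally show ?thesis using d by (simp add: power2_eq_square)
  qed
  obtain N0 where N0: "\<And>N. N \<ge> N0 \<Longrightarrow> (\<Sum>n\<in>{-int N..int N}. fcoef p n * cnj (fcoef v n)) = cmean (\<lambda>\<theta>. p \<theta> * cnj (v \<theta>))"
    using trigp_parseval[OF p(1) v] by blast
  show "\<exists>no. \<forall>N\<ge>no. cmod ((\<Sum>n\<in>{-int N..int N}. fcoef u n * cnj (fcoef v n)) - cmean (\<lambda>\<theta>. u \<theta> * cnj (v \<theta>))) < e"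
  proof (intro exI allI impI)
    fix N assume "N \<ge> N0"
    have uw: "u = (\<lambda>x. w x + p x)" by (auto simp: w_def)
    have "(\<Sum>n\<in>{-int N..int N}. fcoef u n * cnj (fcoef v n)) - cmean (\<lambda>\<theta>. u \<theta> * cnj (v \<theta>))
      = (\<Sum>n\<in>{-int N..int N}. fcoef w n * cnj (fcoef v n)) - cmean (\<lambda>\<theta>. w \<theta> * cnj (v \<theta>))"
      unfolding uw distrib_right
      by (subst cmean_add) (auto intro!: continuous_intros w pc v simp: fcoef_add w pc distrib_right sum.distrib N0 \<open>N \<ge> N0\<close>)
    also have "cmod \<dots> \<le> (d + d * V) / 2 + (d + d * V) / 2"
      by (intro order_trans[OF norm_triangle_ineq4] add_mono m1 m2)
    also have "\<dots> = d * (1 + V)" by (simp add: algebra_simps)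
    also have "\<dots> < d * (2 + V)" using d by (intro mult_strict_left_mono) auto
    also have "\<dots> = e" using V by (simp add: d_def)
    finally show "cmod ((\<Sum>n\<in>{-int N..int N}. fcoef u n * cnj (fcoef v n)) - cmean (\<lambda>\<theta>. u \<theta> * cnj (v \<theta>))) < e" .
  qed
qed

lemma fcoef_zero_imp:
  assumes u: "continuous_on UNIV u" and per: "\<And>x. u (x + 2 * pi) = u x" and 0: "\<And>n. fcoef u n = 0"
  shows "u x = 0"
proof -
  have "(\<lambda>N::nat. 0) \<longlonglongrightarrow> cmean (\<lambda>\<theta>. u \<theta> * cnj (u \<theta>))" using parseval[OF u per u] by (simp add: 0)
  then have "cmean (\<lambda>\<theta>. u \<theta> * cnj (u \<theta>)) = 0" using LIMSEQ_unique tendsto_const by blast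
  moreover have "(\<lambda>\<theta>. u \<theta> * cnj (u \<theta>)) = (\<lambda>\<theta>. of_real ((cmod (u \<theta>))\<^sup>2))"
    by (rule ext) (rule complex_norm_square[symmetric])
  moreover have "cmean (\<lambda>\<theta>. complex_of_real ((cmod (u \<theta>))\<^sup>2)) = of_real (cmean (\<lambda>\<theta>. (cmod (u \<theta>))\<^sup>2))"
    by (intro cmean_of_real continuous_intros u)
  ultimately have "cmean (\<lambda>\<theta>. (cmod (u \<theta>))\<^sup>2) = 0"
    by (metis of_real_eq_0_iff)
  then have "(cmod (u \<theta>))\<^sup>2 = 0" if "\<theta> \<in> {0..2*pi}" for \<theta>
    using that by (intro cmean_eq_0D[where f = "\<lambda>\<theta>. (cmod (u \<theta>))\<^sup>2"] continuous_intros u) auto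
  then have z: "u \<theta> = 0" if "\<theta> \<in> {0..2*pi}" for \<theta> using that by simp
  have "u x = u (Arg2pi (cis x))" by (rule periodic_Arg2pi[of u, OF per, symmetric])
  also have "\<dots> = 0" using Arg2pi_ge_0[of "cis x"] Arg2pi_lt_2pi[of "cis x"] by (intro z) simp
  finally show ?thesis .
qed

lemma sum_int_symmetric:
  fixes f :: "int \<Rightarrow> 'a::comm_monoid_add"
  shows "(\<Sum>n\<in>{-int N..int N}. f n) = (\<Sum>k<Suc N. if k = 0 then f 0 else f (int k) + f (- int k))"
proof (induction N)
  case (Suc N)
  have "{-int (Suc N)..int (Suc N)} = insert (int (Suc N)) (insert (- int (Suc N)) {-int N..int N})" by auto
  then show ?case using Suc by (simp add: add_ac)
qed simp

text \<open>By the M-test the series defines a continuous v with the same coefficients as u, and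
  \<open>fcoef_zero_imp\<close> gives u = v. The majorant is indexed by |n| because n and -n are
  added together in symmetric partial sums.\<close>

lemma fourier_pointwise:
  assumes u: "continuous_on UNIV u" and per: "\<And>x. u (x + 2 * pi) = u x"
    and B: "\<And>n. cmod (fcoef u n) \<le> B (nat \<bar>n\<bar>)" "summable B"
  shows "(\<lambda>N. \<Sum>n\<in>{-int N..int N}. fcoef u n * cis (of_int n * x)) \<longlonglongrightarrow> u x"
proof -
  define F where "F = (\<lambda>k \<theta>. if k = 0 then fcoef u 0 else fcoef u (int k) * cis (of_int (int k) * \<theta>) + fcoef u (- int k) * cis (of_int (- int k) * \<theta>))"
  define v where "v = (\<lambda>\<theta>. \<Sum>k. F k \<theta>)"
  have Fb: "cmod (F k \<theta>) \<le> 2 * B k" for k \<theta>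
  proof (cases "k = 0")
    case True
    have "cmod (fcoef u 0) \<le> B 0" using B(1)[of 0] by simp
    moreover have "0 \<le> cmod (fcoef u 0)" by simp
    ultimately have "cmod (fcoef u 0) \<le> 2 * B 0" by linarith
    then show ?thesis using True by (simp add: F_def)
  next
    case False
    have "cmod (F k \<theta>) \<le> cmod (fcoef u (int k)) + cmod (fcoef u (- int k))"
      using False by (simp add: F_def) (rule order_trans[OF norm_triangle_ineq], simp add: norm_mult)
    then show ?thesis using B(1)[of "int k"] B(1)[of "- int k"] by simp
  qed
  have ul: "uniform_limit UNIV (\<lambda>N \<theta>. \<Sum>k<N. F k \<theta>) v sequentially"
    unfolding v_def by (rule Weierstrass_m_test[of _ _ "\<lambda>k. 2 * B k"]) (auto intro: Fb summable_mult B)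
  have Fc: "continuous_on UNIV (F k)" for k unfolding F_def by (cases "k = 0") (auto intro!: continuous_intros)
  have v: "continuous_on UNIV v"
    by (rule uniform_limit_theorem[OF _ ul]) (auto intro!: continuous_intros Fc always_eventually)
  have Fper: "F k (x + 2 * pi) = F k x" for k x
  proof -
    have "cis (of_int n * (x + 2 * pi)) = cis (of_int n * x)" for n :: int
      using cis_of_int_2pi[of n] by (simp add: distrib_left cis_mult[symmetric])
    from this[of "int k"] this[of "- int k"] show ?thesis unfolding F_def by auto
  qed
  have sumF: "(\<Sum>n\<in>{-int N..int N}. fcoef u n * cis (of_int n * x)) = (\<Sum>k<Suc N. F k x)" for N x
    unfolding sum_int_symmetric by (intro sum.cong) (auto simp: F_def)
  have fv: "fcoef v n = fcoef u n" for n
  proof -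
    have "uniform_limit UNIV (\<lambda>N \<theta>. (\<Sum>k<N. F k \<theta>) * cnj (cis (of_int n * \<theta>))) (\<lambda>\<theta>. v \<theta> * cnj (cis (of_int n * \<theta>))) sequentially"
      unfolding uniform_limit_iff
    proof (intro allI impI)
      fix e :: real assume "e > 0"
      then have "\<forall>\<^sub>F N in sequentially. \<forall>x\<in>UNIV. dist (\<Sum>k<N. F k x) (v x) < e" using ul unfolding uniform_limit_iff by blast
      then show "\<forall>\<^sub>F N in sequentially. \<forall>x\<in>UNIV. dist ((\<Sum>k<N. F k x) * cnj (cis (of_int n * x))) (v x * cnj (cis (of_int n * x))) < e"
        by eventually_elim (simp add: dist_norm left_diff_distrib[symmetric] norm_mult)
    qed
    then have "(\<lambda>N. fcoef (\<lambda>\<theta>. \<Sum>k<N. F k \<theta>) n) \<longlonglongrightarrow> fcoef v n"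
      unfolding fcoef_def by (rule cmean_uniform_limit) (intro continuous_intros Fc)
    then have 1: "(\<lambda>N. fcoef (\<lambda>\<theta>. \<Sum>k<Suc N. F k \<theta>) n) \<longlonglongrightarrow> fcoef v n" by (rule LIMSEQ_Suc)
    have "fcoef (\<lambda>\<theta>. \<Sum>k<Suc N. F k \<theta>) n = fcoef u n" if "N \<ge> nat \<bar>n\<bar>" for N
    proof -
      have "fcoef (\<lambda>\<theta>. \<Sum>k<Suc N. F k \<theta>) n = (\<Sum>j\<in>{-int N..int N}. fcoef (\<lambda>\<theta>. fcoef u j * cis (of_int j * \<theta>)) n)"
        unfolding sumF[symmetric] fcoef_def[of _ n] sum_distrib_right by (rule cmean_sum) (auto intro!: continuous_intros)
      also have "\<dots> = (\<Sum>j\<in>{-int N..int N}. if n = j then fcoef u j else 0)" by (intro sum.cong fcoef_cis refl)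
      also have "\<dots> = fcoef u n" using that by auto
      finally show ?thesis .
    qed
    then have "\<forall>\<^sub>F N in sequentially. fcoef (\<lambda>\<theta>. \<Sum>k<Suc N. F k \<theta>) n = fcoef u n"
      unfolding eventually_sequentially by blast
    then have "(\<lambda>N. fcoef (\<lambda>\<theta>. \<Sum>k<Suc N. F k \<theta>) n) \<longlonglongrightarrow> fcoef u n" by (rule tendsto_eventually)
    then show ?thesis using 1 LIMSEQ_unique by blast
  qed
  have "u x - v x = 0"
  proof (rule fcoef_zero_imp[of "\<lambda>x. u x - v x"])
    show "u (x + 2 * pi) - v (x + 2 * pi) = u x - v x" for x by (simp only: per v_def Fper)
  qed (auto intro!: continuous_intros u v simp: fcoef_diff u v fv)
  moreover have "(\<lambda>N. \<Sum>k<Suc N. F k x) \<longlonglongrightarrow> v x"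
    by (rule LIMSEQ_Suc[OF tendsto_uniform_limitI[OF ul]]) simp
  ultimately show ?thesis by (simp add: sumF)
qed

section \<open>The Poisson kernel of the strip\<close>

text \<open>The number of terms depends only on q and e. A finite sum, uniform in the point, lets
  each power be integrated separately later, without exchanging an infinite series with an
  integral.\<close>

lemma ln_one_minus_series_uniform:
  assumes q: "0 \<le> q" "q < 1" and e: "e > 0"
  obtains n where "\<And>x. cmod x \<le> q \<Longrightarrow> \<bar>ln (cmod (1 - x)) + Re (\<Sum>k\<in>{1..n}. x ^ k / of_nat k)\<bar> \<le> e"
proof -
  define f where "f = (\<lambda>(k::nat) (x::complex). - (x ^ k / of_nat k))"
  have ul: "uniform_limit (cball 0 q) (\<lambda>n x. \<Sum>k<n. f k x) (\<lambda>x. \<Sum>k. f k x) sequentially"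
  proof (rule Weierstrass_m_test)
    fix n x assume x: "x \<in> cball (0::complex) q"
    show "cmod (f n x) \<le> q ^ n"
    proof (cases "n = 0")
      case False
      then have "cmod x ^ n / real n \<le> q ^ n / 1"
        using x q by (intro frac_le power_mono) auto
      then show ?thesis by (simp add: f_def norm_divide norm_power)
    qed (simp add: f_def)
  qed (use q in \<open>auto intro!: summable_geometric\<close>)
  have lim: "(\<Sum>k. f k x) = Ln (1 - x)" if "cmod x \<le> q" for x
  proof -
    have "(\<lambda>n. (- 1) ^ Suc n / of_nat n * (- x) ^ n) sums ln (1 + (- x))"
      using that q by (intro Ln_series) auto
    moreover have "(- 1) ^ Suc n / of_nat n * (- x) ^ n = f n x" for n
    proof -
      have "(- 1) ^ n * (- x) ^ n = ((- 1) * (- x)) ^ n" by (rule power_mult_distrib[symmetric])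
      then show ?thesis by (simp add: f_def)
    qed
    ultimately show ?thesis by (simp add: sums_iff)
  qed
  obtain N where N: "\<And>n x. n \<ge> N \<Longrightarrow> x \<in> cball 0 q \<Longrightarrow> dist (\<Sum>k<n. f k x) (\<Sum>k. f k x) < e"
    using ul e unfolding uniform_limit_iff eventually_sequentially by blast
  show thesis
  proof (rule that[of N])
    fix x assume x: "cmod x \<le> q"
    have "(\<Sum>k<Suc N. f k x) = (\<Sum>k\<in>{1..N}. f k x)"
    proof -
      have "{..<Suc N} = insert 0 {1..N}" by auto
      then show ?thesis by (simp add: f_def)
    qed
    then have s: "(\<Sum>k<Suc N. f k x) = - (\<Sum>k\<in>{1..N}. x ^ k / of_nat k)" by (simp add: f_def sum_negf)
    have "x \<noteq> 1" using x q by auto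
    then have "Re (Ln (1 - x)) = ln (cmod (1 - x))" by simp
    moreover have "cmod ((\<Sum>k<Suc N. f k x) - Ln (1 - x)) < e"
      using N[of "Suc N" x] x by (simp add: lim dist_norm)
    ultimately show "\<bar>ln (cmod (1 - x)) + Re (\<Sum>k\<in>{1..N}. x ^ k / of_nat k)\<bar> \<le> e"
      using abs_Re_le_cmod[of "(\<Sum>k<Suc N. f k x) - Ln (1 - x)"] unfolding s by simp
  qed
qed

definition poisson :: "real \<Rightarrow> real \<Rightarrow> real" where
  "poisson s y = sinh s / (cosh s - cos y)"

lemma cosh_minus_cos_pos: "s > 0 \<Longrightarrow> cosh s - cos y > (0::real)"
  using cosh_real_strict_mono[of 0 s] cos_le_one[of y] by (simp, linarith)

lemma sum_squares_scaled: "(1 - q * c)\<^sup>2 + (q * d)\<^sup>2 = 1 - 2 * q * c + q\<^sup>2 * (c\<^sup>2 + d\<^sup>2)" for q c d :: real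
  by (simp add: power2_eq_square algebra_simps)

lemma norm_one_minus_q_cis:
  "2 * (cosh s - cos y) = exp s * (cmod (1 - of_real (exp (- s)) * cis y))\<^sup>2"
proof -
  define E where "E = exp (- s)"
  have ee: "exp s * E = 1" by (simp add: E_def exp_minus)
  have "(cmod (1 - of_real E * cis y))\<^sup>2 = (1 - E * cos y)\<^sup>2 + (E * sin y)\<^sup>2"
    by (simp add: cmod_power2)
  also have "\<dots> = 1 - 2 * E * cos y + E\<^sup>2"
    unfolding sum_squares_scaled by simp
  finally have h: "(cmod (1 - of_real E * cis y))\<^sup>2 = 1 - 2 * E * cos y + E\<^sup>2" .
  have "exp s * (cmod (1 - of_real E * cis y))\<^sup>2 = exp s - 2 * (exp s * E) * cos y + (exp s * E) * E"
    unfolding h by (simp add: power2_eq_square algebra_simps)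
  also have "\<dots> = 2 * (cosh s - cos y)" unfolding ee by (simp add: cosh_field_def E_def)
  finally show ?thesis by (simp add: E_def)
qed

lemma norm_cmean_le_cmean:
  fixes f :: "real \<Rightarrow> 'a::euclidean_space"
  assumes "continuous_on UNIV f" "continuous_on UNIV g" "\<And>\<theta>. norm (f \<theta>) \<le> g \<theta>"
  shows "norm (cmean f) \<le> cmean g"
proof -
  have "norm (integral {0..2*pi} f) \<le> integral {0..2*pi} g"
    by (intro integral_norm_bound_integral cont_int assms)
  then show ?thesis by (simp add: cmean_def divide_right_mono field_simps)
qed

lemma cont_poisson: "s > 0 \<Longrightarrow> continuous_on UNIV (\<lambda>x. poisson s (\<theta> - x))"
  unfolding poisson_def using cosh_minus_cos_pos[of s]
  by (intro continuous_intros) (auto simp: less_imp_neq[symmetric] order.strict_implies_not_eq)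

text \<open>By \<open>norm_one_minus_q_cis\<close> the integrand is s + 2 ln |1 - z| with |z| =
  exp(-s) < 1, and ln |1 - z| has mean 0 because every power z^k with k \<ge> 1 has mean 0.\<close>

lemma cmean_ln_kernel:
  assumes s: "s > 0"
  shows "cmean (\<lambda>x. ln (2 * (cosh s - cos (\<theta> - x)))) = s"
proof -
  define q where "q = exp (- s)"
  have q: "0 < q" "q < 1" using s by (auto simp: q_def)
  define z where "z = (\<lambda>x. of_real q * cis (\<theta> - x))"
  have zq: "cmod (z x) = q" for x using q by (simp add: z_def norm_mult)
  have zn: "1 - z x \<noteq> 0" for x using zq[of x] q by auto
  have zc: "continuous_on UNIV z" unfolding z_def by (intro continuous_intros)
  have lc: "continuous_on UNIV (\<lambda>x. ln (cmod (1 - z x)))"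
    by (intro continuous_intros zc) (use zn in auto)
  have "\<bar>cmean (\<lambda>x. ln (cmod (1 - z x)))\<bar> \<le> e" if epos: "e > 0" for e
  proof -
    obtain n where n: "\<And>x. cmod x \<le> q \<Longrightarrow> \<bar>ln (cmod (1 - x)) + Re (\<Sum>k\<in>{1..n}. x ^ k / of_nat k)\<bar> \<le> e"
      using ln_one_minus_series_uniform[OF less_imp_le[OF q(1)] q(2) epos] by blast
    have pc: "continuous_on UNIV (\<lambda>x. (\<Sum>k\<in>{1..n}. z x ^ k / of_nat k))"
      by (intro continuous_intros zc) auto
    have "cmean (\<lambda>x. (\<Sum>k\<in>{1..n}. z x ^ k / of_nat k)) = (\<Sum>k\<in>{1..n}. cmean (\<lambda>x. z x ^ k / of_nat k))"
      by (rule cmean_sum) (auto intro!: continuous_intros zc)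
    also have "\<dots> = 0"
    proof (rule sum.neutral, rule ballI)
      fix k assume k: "k \<in> {1..n}"
      have "z x ^ k / of_nat k = (of_real q ^ k * cis (k * \<theta>) / of_nat k) * cis (of_int (- int k) * x)" for x
        by (simp add: z_def power_mult_distrib Complex.DeMoivre right_diff_distrib cis_mult)
      then show "cmean (\<lambda>x. z x ^ k / of_nat k) = 0"
        using k by (simp only: cmean_cmult cmean_cis) simp
    qed
    finally have "cmean (\<lambda>x. Re (\<Sum>k\<in>{1..n}. z x ^ k / of_nat k)) = 0"
      using cmean_Re[OF pc] by simp
    moreover have "norm (cmean (\<lambda>x. ln (cmod (1 - z x)) + Re (\<Sum>k\<in>{1..n}. z x ^ k / of_nat k))) \<le> e"
      by (intro norm_cmean_le continuous_intros lc zc) (use n zq zn in auto)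
    ultimately show ?thesis
      by (subst (asm) cmean_add) (auto intro!: continuous_intros lc zc simp del: Re_sum)
  qed
  then have 0: "cmean (\<lambda>x. ln (cmod (1 - z x))) = 0"
    by (meson abs_ge_zero abs_le_zero_iff dense_ge order.trans)
  have "ln (2 * (cosh s - cos (\<theta> - x))) = s + 2 * ln (cmod (1 - z x))" for x
  proof -
    have "2 * (cosh s - cos (\<theta> - x)) = exp s * (cmod (1 - z x))\<^sup>2"
      unfolding norm_one_minus_q_cis z_def q_def ..
    then show ?thesis using zn[of x] by (simp add: ln_mult ln_realpow)
  qed
  then show ?thesis
    using 0 by (simp add: cmean_add lc continuous_intros cmean_rmult)
qed

text \<open>With z = exp(-s) cis y the kernel is 2 Re (1 / (1 - z)) - 1 and the Fourier sum is
  geometric, so that the error is exactly 2 |Re (z^(N+1) / (1 - z))|.\<close>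

lemma poisson_partial:
  assumes s: "s > 0"
  shows "cmod (of_real (poisson s y) - (\<Sum>n\<in>{-int N..int N}. of_real (exp (- real_of_int \<bar>n\<bar> * s)) * cis (of_int n * y)))
    \<le> 2 * exp (- s) ^ Suc N / (1 - exp (- s))"
proof -
  define q where "q = exp (- s)"
  have q: "0 < q" "q < 1" using s by (auto simp: q_def)
  define z where "z = of_real q * cis y"
  have zq: "cmod z = q" using q by (simp add: z_def norm_mult)
  have zn: "1 - z \<noteq> 0" using zq q by auto
  have zk: "z ^ k = of_real (exp (- real k * s)) * cis (k * y)" for k
    unfolding z_def power_mult_distrib Complex.DeMoivre q_def of_real_power[symmetric] exp_of_nat_mult[symmetric] by simp
  have zk': "cnj z ^ k = of_real (exp (- real k * s)) * cis (- (k * y))" for k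
    by (metis zk complex_cnj_power complex_cnj_mult complex_cnj_complex_of_real cis_cnj)
  have "(\<Sum>n\<in>{-int N..int N}. of_real (exp (- real_of_int \<bar>n\<bar> * s)) * cis (of_int n * y))
    = (\<Sum>k<Suc N. z ^ k + cnj z ^ k) - 1"
  proof -
    have "(\<Sum>n\<in>{-int N..int N}. of_real (exp (- real_of_int \<bar>n\<bar> * s)) * cis (of_int n * y))
      = (\<Sum>k<Suc N. z ^ k + cnj z ^ k - (if k = 0 then 1 else 0))"
      unfolding sum_int_symmetric by (intro sum.cong) (auto simp: zk zk')
    then show ?thesis by (simp only: sum_subtractf) simp
  qed
  also have "(\<Sum>k<Suc N. z ^ k + cnj z ^ k) = of_real (2 * Re ((1 - z ^ Suc N) / (1 - z)))"
  proof -
    have "(\<Sum>k<Suc N. z ^ k) = (1 - z ^ Suc N) / (1 - z)"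
      using geometric_sum[of z "Suc N"] zn by (simp add: field_simps)
    moreover have "(\<Sum>k<Suc N. cnj z ^ k) = cnj (\<Sum>k<Suc N. z ^ k)" by simp
    ultimately show ?thesis
      unfolding sum.distrib by (simp only: complex_add_cnj)
  qed
  finally have S: "(\<Sum>n\<in>{-int N..int N}. of_real (exp (- real_of_int \<bar>n\<bar> * s)) * cis (of_int n * y))
      = of_real (2 * Re ((1 - z ^ Suc N) / (1 - z)) - 1)" by simp
  have P: "poisson s y = 2 * Re (1 / (1 - z)) - 1"
  proof -
    have D: "(cmod (1 - z))\<^sup>2 > 0" using zn by simp
    have "2 * (cosh s - cos y) * q = (cmod (1 - z))\<^sup>2"
      unfolding norm_one_minus_q_cis z_def q_def by (simp add: exp_minus)
    moreover have "2 * sinh s * q = 1 - q\<^sup>2"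
    proof -
      have "exp s * q = 1" by (simp add: q_def exp_minus)
      then show ?thesis by (simp add: sinh_field_def q_def[symmetric] power2_eq_square left_diff_distrib)
    qed
    moreover have "poisson s y = (2 * sinh s * q) / (2 * (cosh s - cos y) * q)"
      unfolding poisson_def mult.assoc using q by (subst mult_divide_mult_cancel_left, simp, subst mult_divide_mult_cancel_right) auto
    ultimately have "poisson s y = (1 - q\<^sup>2) / (cmod (1 - z))\<^sup>2" by (simp only:)
    moreover have "Re (1 / (1 - z)) = (1 - q * cos y) / (cmod (1 - z))\<^sup>2"
      by (simp add: Re_divide cmod_power2 z_def)
    moreover have "(cmod (1 - z))\<^sup>2 = 1 - 2 * q * cos y + q\<^sup>2"
    proof -
      have "(cmod (1 - z))\<^sup>2 = (1 - q * cos y)\<^sup>2 + (q * sin y)\<^sup>2" by (simp add: cmod_power2 z_def)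
      also have "\<dots> = 1 - 2 * q * cos y + q\<^sup>2 * ((cos y)\<^sup>2 + (sin y)\<^sup>2)"
        by (rule sum_squares_scaled)
      finally show ?thesis by simp
    qed
    moreover have "2 * (a / N2) - 1 = (2 * a - N2) / N2" if "N2 > 0" for a N2 :: real
      using that by (simp add: field_simps)
    from this[OF D] have "2 * ((1 - q * cos y) / (cmod (1 - z))\<^sup>2) - 1
      = (2 * (1 - q * cos y) - (cmod (1 - z))\<^sup>2) / (cmod (1 - z))\<^sup>2" .
    ultimately show ?thesis by simp
  qed
  have "of_real (poisson s y) - of_real (2 * Re ((1 - z ^ Suc N) / (1 - z)) - 1)
     = complex_of_real (2 * Re (z ^ Suc N / (1 - z)))"
    unfolding P by (simp add: diff_divide_distrib)
  then have "cmod (of_real (poisson s y) - (\<Sum>n\<in>{-int N..int N}. of_real (exp (- real_of_int \<bar>n\<bar> * s)) * cis (of_int n * y)))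
     = 2 * \<bar>Re (z ^ Suc N / (1 - z))\<bar>" unfolding S by (simp only: norm_of_real abs_mult abs_numeral)
  also have "\<dots> \<le> 2 * cmod (z ^ Suc N / (1 - z))" using abs_Re_le_cmod by (intro mult_left_mono) auto
  also have "\<dots> \<le> 2 * (q ^ Suc N / (1 - q))"
  proof -
    have "1 - q \<le> cmod (1 - z)" using norm_triangle_ineq2[of 1 z] zq by simp
    then have "q ^ Suc N / cmod (1 - z) \<le> q ^ Suc N / (1 - q)"
      using q by (intro divide_left_mono mult_pos_pos) auto
    then show ?thesis by (simp only: norm_divide norm_power zq)
  qed
  finally show ?thesis unfolding q_def times_divide_eq_right .
qed

lemma poisson_conv:
  assumes s: "s > 0" and u: "continuous_on UNIV u"
  shows "(\<lambda>N. \<Sum>n\<in>{-int N..int N}. of_real (exp (- real_of_int \<bar>n\<bar> * s)) * fcoef u n * cis (of_int n * \<theta>))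
     \<longlonglongrightarrow> cmean (\<lambda>x. of_real (poisson s (\<theta> - x)) * u x)"
proof -
  define K where "K = (\<lambda>N y. \<Sum>n\<in>{-int N..int N}. of_real (exp (- real_of_int \<bar>n\<bar> * s)) * cis (of_int n * y))"
  define q where "q = exp (- s)"
  have q: "0 < q" "q < 1" using s by (auto simp: q_def)
  have uc: "continuous_on UNIV (\<lambda>x. cmod (u x))" by (intro continuous_intros u)
  have bnd: "cmod (cmean (\<lambda>x. of_real (poisson s (\<theta> - x)) * u x) - cmean (\<lambda>x. K N (\<theta> - x) * u x))
     \<le> 2 * q ^ Suc N / (1 - q) * cmean (\<lambda>x. cmod (u x))" for N
  proof -
    have c: "continuous_on UNIV (\<lambda>x. (of_real (poisson s (\<theta> - x)) - K N (\<theta> - x)) * u x)"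
      unfolding K_def by (intro continuous_intros u cont_poisson s) 
    have "cmean (\<lambda>x. of_real (poisson s (\<theta> - x)) * u x) - cmean (\<lambda>x. K N (\<theta> - x) * u x)
       = cmean (\<lambda>x. (of_real (poisson s (\<theta> - x)) - K N (\<theta> - x)) * u x)"
      unfolding left_diff_distrib K_def
      by (intro cmean_diff[symmetric] continuous_intros u cont_poisson s)
    also have "cmod \<dots> \<le> cmean (\<lambda>x. 2 * q ^ Suc N / (1 - q) * cmod (u x))"
    proof (intro norm_cmean_le_cmean c continuous_intros u)
      fix x
      show "norm ((of_real (poisson s (\<theta> - x)) - K N (\<theta> - x)) * u x) \<le> 2 * q ^ Suc N / (1 - q) * cmod (u x)"
        unfolding norm_mult K_def q_def by (intro mult_right_mono poisson_partial s) auto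
    qed
    finally show ?thesis unfolding cmean_rmult .
  qed
  have "(\<lambda>N. 2 * q ^ Suc N / (1 - q) * cmean (\<lambda>x. cmod (u x))) \<longlonglongrightarrow> 2 * 0 / (1 - q) * cmean (\<lambda>x. cmod (u x))"
    using q by (intro tendsto_intros LIMSEQ_Suc[OF LIMSEQ_realpow_zero]) auto
  then have "(\<lambda>N. 2 * q ^ Suc N / (1 - q) * cmean (\<lambda>x. cmod (u x))) \<longlonglongrightarrow> 0" by simp
  then have "(\<lambda>N. cmean (\<lambda>x. of_real (poisson s (\<theta> - x)) * u x) - cmean (\<lambda>x. K N (\<theta> - x) * u x)) \<longlonglongrightarrow> 0"
    by (rule Lim_null_comparison[rotated]) (use bnd in auto)
  from tendsto_diff[OF tendsto_const this, of "cmean (\<lambda>x. of_real (poisson s (\<theta> - x)) * u x)"]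
  have "(\<lambda>N. cmean (\<lambda>x. K N (\<theta> - x) * u x)) \<longlonglongrightarrow> cmean (\<lambda>x. of_real (poisson s (\<theta> - x)) * u x)"
    by simp
  moreover have "cmean (\<lambda>x. K N (\<theta> - x) * u x) = (\<Sum>n\<in>{-int N..int N}. of_real (exp (- real_of_int \<bar>n\<bar> * s)) * fcoef u n * cis (of_int n * \<theta>))" for N
  proof -
    have "cmean (\<lambda>x. K N (\<theta> - x) * u x)
      = (\<Sum>n\<in>{-int N..int N}. cmean (\<lambda>x. of_real (exp (- real_of_int \<bar>n\<bar> * s)) * cis (of_int n * (\<theta> - x)) * u x))"
      unfolding K_def sum_distrib_right by (rule cmean_sum) (auto intro!: continuous_intros u)
    also have "\<dots> = (\<Sum>n\<in>{-int N..int N}. of_real (exp (- real_of_int \<bar>n\<bar> * s)) * fcoef u n * cis (of_int n * \<theta>))"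
    proof (rule sum.cong[OF refl])
      fix n :: int
      have "of_real (exp (- real_of_int \<bar>n\<bar> * s)) * cis (of_int n * (\<theta> - x)) * u x
         = (of_real (exp (- real_of_int \<bar>n\<bar> * s)) * cis (of_int n * \<theta>)) * (u x * cnj (cis (of_int n * x)))" for x
        by (simp add: right_diff_distrib cis_cnj cis_mult)
      then show "cmean (\<lambda>x. of_real (exp (- real_of_int \<bar>n\<bar> * s)) * cis (of_int n * (\<theta> - x)) * u x) = of_real (exp (- real_of_int \<bar>n\<bar> * s)) * fcoef u n * cis (of_int n * \<theta>)"
        unfolding fcoef_def by (simp only: cmean_cmult) (simp add: mult_ac)
    qed
    finally show ?thesis .
  qed
  ultimately show ?thesis by simp
qed

lemma cmean_poisson:
  assumes s: "s > 0"
  shows "cmean (\<lambda>x. poisson s (\<theta> - x)) = 1"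
proof -
  have f1: "fcoef (\<lambda>_. 1) n = (if n = 0 then 1 else 0)" for n
    using fcoef_cis[of 1 0 n] by simp
  have "(\<Sum>n\<in>{-int N..int N}. of_real (exp (- real_of_int \<bar>n\<bar> * s)) * fcoef (\<lambda>_. 1) n * cis (of_int n * \<theta>))
    = (\<Sum>n\<in>{-int N..int N}. if n = 0 then 1 else 0)" for N
    by (intro sum.cong) (auto simp: f1)
  also have "(\<Sum>n\<in>{-int N..int N}. if n = 0 then 1 else 0) = (1::complex)" for N by simp
  finally have "(\<lambda>N. 1::complex) \<longlonglongrightarrow> cmean (\<lambda>x. of_real (poisson s (\<theta> - x)) * 1)"
    using poisson_conv[OF s, of "\<lambda>_. 1" \<theta>] by simp
  then have "cmean (\<lambda>x. complex_of_real (poisson s (\<theta> - x))) = 1"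
    using LIMSEQ_unique[OF _ tendsto_const] by simp
  then have "complex_of_real (cmean (\<lambda>x. poisson s (\<theta> - x))) = 1"
    using cmean_of_real[OF cont_poisson[OF s]] by metis
  then show ?thesis by simp
qed

text \<open>The number n depends neither on s, \<theta> nor on w. The right-hand side is linear in the powers of 1 / w, so that
  integrating it against the cutoff leaves only the constant term.\<close>

lemma poisson_log_lower_bound:
  assumes z: "continuous_on UNIV \<zeta>" "\<And>x. cmod (\<zeta> x) \<le> M" and M: "0 < M" "M < M1" and e: "e > 0"
  obtains n where "\<And>s \<theta> w. s > 0 \<Longrightarrow> cmod w \<ge> M1 \<Longrightarrow> cmod w \<ge> 1 \<Longrightarrow>
     Re (cnj w * (w - cmean (\<lambda>x. of_real (poisson s (\<theta> - x)) * \<zeta> x)))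
     \<ge> sinh s * (1 - s - e - 2 * Re (\<Sum>k\<in>{1..n}. cmean (\<lambda>x. \<zeta> x ^ k) / of_nat k / w ^ k))"
proof -
  define q where "q = M / M1"
  have q: "0 \<le> q" "q < 1" using M by (auto simp: q_def)
  obtain n where n: "\<And>x. cmod x \<le> q \<Longrightarrow> \<bar>ln (cmod (1 - x)) + Re (\<Sum>k\<in>{1..n}. x ^ k / of_nat k)\<bar> \<le> e / 2"
    using ln_one_minus_series_uniform[OF q half_gt_zero[OF e]] by blast
  show thesis
  proof (rule that[of n])
    fix s \<theta> :: real and w :: complex
    assume s: "s > 0" and w: "cmod w \<ge> M1" "cmod w \<ge> 1"
    have w0: "w \<noteq> 0" using w by auto
    have zq: "cmod (\<zeta> x / w) \<le> q" for x
      using z(2)[of x] w M unfolding q_def norm_divide by (intro frac_le) auto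
    have zw: "1 - \<zeta> x / w \<noteq> 0" for x using zq[of x] q by (metis diff_0_right eq_iff_diff_eq_0 norm_one not_less)
    have lc: "continuous_on UNIV (\<lambda>x. ln (cmod (1 - \<zeta> x / w)))"
      by (intro continuous_intros z w0) (use zw w0 in auto)
    have kc: "continuous_on UNIV (\<lambda>x. ln (2 * (cosh s - cos (\<theta> - x))))"
      by (intro continuous_intros) (use cosh_minus_cos_pos[OF s] less_imp_neq in force)
    note pc = cont_poisson[OF s, of \<theta>]
    have pt: "sinh s * (1 + 2 * ln (cmod (1 - \<zeta> x / w)) - ln (2 * (cosh s - cos (\<theta> - x))))
       \<le> (cmod w)\<^sup>2 * poisson s (\<theta> - x) - Re (cnj w * (of_real (poisson s (\<theta> - x)) * \<zeta> x))" for x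
    proof -
      define D where "D = 2 * (cosh s - cos (\<theta> - x))"
      have D: "D > 0" using cosh_minus_cos_pos[OF s] by (simp add: D_def)
      have sh: "sinh s > 0" using s by simp
      have "w - \<zeta> x = w * (1 - \<zeta> x / w)" using w0 by (simp add: field_simps)
      then have nw: "cmod (w - \<zeta> x) = cmod w * cmod (1 - \<zeta> x / w)" by (simp add: norm_mult)
      \<comment> \<open>Normalised so that \<open>sinh s * y\<close> is the Poisson kernel times |w
        - \<zeta> x|^2 / 2, while ln D has the explicit mean s. This is the quotient to which y
        \<ge> 1 + ln y is applied.\<close>
      define y where "y = (cmod (w - \<zeta> x))\<^sup>2 / D"
      have y: "y > 0" using D nw w0 zw[of x] by (simp add: y_def)
      have "ln y = 2 * (ln (cmod w) + ln (cmod (1 - \<zeta> x / w))) - ln D"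
        unfolding y_def nw using D w0 zw[of x] by (simp add: ln_div ln_realpow ln_mult power_mult_distrib)
      \<comment> \<open>Here |w| \<ge> 1 enters: the term 2 ln |w| is discarded from the lower
        bound.\<close>
      moreover have "ln (cmod w) \<ge> 0" using w by simp
      moreover have "ln y \<le> y - 1" using y by (rule ln_le_minus_one)
      ultimately have "1 + 2 * ln (cmod (1 - \<zeta> x / w)) - ln D \<le> y"
        unfolding distrib_left by linarith
      then have "sinh s * (1 + 2 * ln (cmod (1 - \<zeta> x / w)) - ln D) \<le> sinh s * y" using sh by simp
      also have "\<dots> = poisson s (\<theta> - x) * ((cmod (w - \<zeta> x))\<^sup>2 / 2)"
        by (simp add: y_def poisson_def D_def)
      \<comment> \<open>|\<zeta> x| \<le> |w| permits replacing the quadratic expression by one that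
        is affine in \<zeta> x, so that its mean is a Poisson integral.\<close>
      also have "\<dots> \<le> poisson s (\<theta> - x) * ((cmod w)\<^sup>2 - Re (cnj w * \<zeta> x))"
      proof (rule mult_left_mono)
        have "(cmod (\<zeta> x))\<^sup>2 \<le> (cmod w)\<^sup>2" using z(2)[of x] w M by (intro power_mono) auto
        moreover have "(cmod (w - \<zeta> x))\<^sup>2 = (cmod w)\<^sup>2 - 2 * Re (cnj w * \<zeta> x) + (cmod (\<zeta> x))\<^sup>2"
          unfolding cmod_power2 by (simp add: power2_eq_square algebra_simps)
        ultimately show "(cmod (w - \<zeta> x))\<^sup>2 / 2 \<le> (cmod w)\<^sup>2 - Re (cnj w * \<zeta> x)" by simp
        show "0 \<le> poisson s (\<theta> - x)" using sh D by (simp add: poisson_def D_def)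
      qed
      also have "\<dots> = (cmod w)\<^sup>2 * poisson s (\<theta> - x) - Re (cnj w * (of_real (poisson s (\<theta> - x)) * \<zeta> x))"
        by (simp add: algebra_simps)
      finally show ?thesis by (simp add: D_def)
    qed
    have "sinh s * (1 + 2 * cmean (\<lambda>x. ln (cmod (1 - \<zeta> x / w))) - s)
       = cmean (\<lambda>x. sinh s * (1 + 2 * ln (cmod (1 - \<zeta> x / w)) - ln (2 * (cosh s - cos (\<theta> - x)))))"
    proof -
      have "cmean (\<lambda>x. 1 + 2 * ln (cmod (1 - \<zeta> x / w)) - ln (2 * (cosh s - cos (\<theta> - x))))
        = cmean (\<lambda>x. 1 + 2 * ln (cmod (1 - \<zeta> x / w))) - cmean (\<lambda>x. ln (2 * (cosh s - cos (\<theta> - x))))"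
        by (intro cmean_diff continuous_on_add continuous_on_mult continuous_on_const lc kc)
      also have "cmean (\<lambda>x. 1 + 2 * ln (cmod (1 - \<zeta> x / w))) = cmean (\<lambda>x. 1) + cmean (\<lambda>x. 2 * ln (cmod (1 - \<zeta> x / w)))"
        by (intro cmean_add continuous_on_mult continuous_on_const lc)
      finally show ?thesis by (simp only: cmean_rmult cmean_const cmean_ln_kernel[OF s])
    qed
    also have "\<dots> \<le> cmean (\<lambda>x. (cmod w)\<^sup>2 * poisson s (\<theta> - x) - Re (cnj w * (of_real (poisson s (\<theta> - x)) * \<zeta> x)))"
      by (intro cmean_mono pt continuous_on_add continuous_on_diff continuous_on_mult continuous_on_const continuous_on_Re continuous_on_of_real lc kc pc z)
    also have "\<dots> = (cmod w)\<^sup>2 - Re (cnj w * cmean (\<lambda>x. of_real (poisson s (\<theta> - x)) * \<zeta> x))"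
      by (subst cmean_diff; (intro continuous_intros pc z)?)
        (subst cmean_Re, (intro continuous_intros pc z), simp only: cmean_cmult cmean_rmult cmean_poisson[OF s] mult_1_right)
    also have "\<dots> = Re (cnj w * (w - cmean (\<lambda>x. of_real (poisson s (\<theta> - x)) * \<zeta> x)))"
      by (simp add: cmod_power2, simp add: power2_eq_square algebra_simps)
    finally have 1: "sinh s * (1 + 2 * cmean (\<lambda>x. ln (cmod (1 - \<zeta> x / w))) - s)
      \<le> Re (cnj w * (w - cmean (\<lambda>x. of_real (poisson s (\<theta> - x)) * \<zeta> x)))" .
    have 2: "cmean (\<lambda>x. ln (cmod (1 - \<zeta> x / w))) \<ge> - Re (\<Sum>k\<in>{1..n}. cmean (\<lambda>x. \<zeta> x ^ k) / of_nat k / w ^ k) - e / 2"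
    proof -
      have c1: "continuous_on UNIV (\<lambda>x. \<Sum>k\<in>{1..n}. (\<zeta> x / w) ^ k / of_nat k)"
        by (intro continuous_intros z w0) (use w0 in auto)
      have "cmean (\<lambda>x. \<Sum>k\<in>{1..n}. (\<zeta> x / w) ^ k / of_nat k) = (\<Sum>k\<in>{1..n}. cmean (\<lambda>x. (\<zeta> x / w) ^ k / of_nat k))"
        by (rule cmean_sum) (use w0 in \<open>auto intro!: continuous_intros z\<close>)
      also have "\<dots> = (\<Sum>k\<in>{1..n}. cmean (\<lambda>x. \<zeta> x ^ k) / of_nat k / w ^ k)"
      proof (rule sum.cong[OF refl])
        fix k
        have "(\<zeta> x / w) ^ k / of_nat k = \<zeta> x ^ k * (1 / (of_nat k * w ^ k))" for x
          by (simp add: power_divide)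
        then show "cmean (\<lambda>x. (\<zeta> x / w) ^ k / of_nat k) = cmean (\<lambda>x. \<zeta> x ^ k) / of_nat k / w ^ k"
          by (simp only: cmean_cmult_right) simp
      qed
      finally have m: "cmean (\<lambda>x. Re (\<Sum>k\<in>{1..n}. (\<zeta> x / w) ^ k / of_nat k)) = Re (\<Sum>k\<in>{1..n}. cmean (\<lambda>x. \<zeta> x ^ k) / of_nat k / w ^ k)"
        using cmean_Re[OF c1] by simp
      have "norm (cmean (\<lambda>x. ln (cmod (1 - \<zeta> x / w)) + Re (\<Sum>k\<in>{1..n}. (\<zeta> x / w) ^ k / of_nat k))) \<le> e / 2"
        by (intro norm_cmean_le continuous_on_add lc continuous_on_Re c1) (use n zq in auto)
      moreover have "cmean (\<lambda>x. ln (cmod (1 - \<zeta> x / w)) + Re (\<Sum>k\<in>{1..n}. (\<zeta> x / w) ^ k / of_nat k))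
        = cmean (\<lambda>x. ln (cmod (1 - \<zeta> x / w))) + Re (\<Sum>k\<in>{1..n}. cmean (\<lambda>x. \<zeta> x ^ k) / of_nat k / w ^ k)"
        unfolding m[symmetric] by (intro cmean_add lc continuous_on_Re c1)
      ultimately show ?thesis unfolding real_norm_def by linarith
    qed
    have "sinh s * (1 - s - e - 2 * Re (\<Sum>k\<in>{1..n}. cmean (\<lambda>x. \<zeta> x ^ k) / of_nat k / w ^ k))
      \<le> sinh s * (1 + 2 * cmean (\<lambda>x. ln (cmod (1 - \<zeta> x / w))) - s)"
      using 2 s by (intro mult_left_mono) (auto simp del: Re_sum)
    then show "sinh s * (1 - s - e - 2 * Re (\<Sum>k\<in>{1..n}. cmean (\<lambda>x. \<zeta> x ^ k) / of_nat k / w ^ k))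
      \<le> Re (cnj w * (w - cmean (\<lambda>x. of_real (poisson s (\<theta> - x)) * \<zeta> x)))" using 1 by linarith
  qed
qed

section \<open>Harmonic functions on a strip\<close>

definition strip_cont :: "real \<Rightarrow> (real \<Rightarrow> real \<Rightarrow> 'a::euclidean_space) \<Rightarrow> bool" where
  "strip_cont b F \<longleftrightarrow> continuous_on ({0<..<b} \<times> UNIV) (\<lambda>p. F (fst p) (snd p))"

lemma strip_cont_slice:
  assumes "strip_cont b F" "0 < t" "t < b"
  shows "continuous_on UNIV (F t)"
proof -
  have "continuous_on UNIV (\<lambda>x. (\<lambda>p. F (fst p) (snd p)) (t, x))"
    by (rule continuous_on_compose2[OF assms(1)[unfolded strip_cont_def]])
      (use assms in \<open>auto intro!: continuous_intros\<close>)
  then show ?thesis by simp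
qed

lemma strip_cont_vslice:
  assumes "strip_cont b F"
  shows "continuous_on {0<..<b} (\<lambda>t. F t x)"
proof -
  have "continuous_on {0<..<b} (\<lambda>t. (\<lambda>p. F (fst p) (snd p)) (t, x))"
    by (rule continuous_on_compose2[OF assms(1)[unfolded strip_cont_def]])
      (auto intro!: continuous_intros)
  then show ?thesis by simp
qed

lemma strip_cont_compose:
  assumes "continuous_on UNIV g" "strip_cont b F"
  shows "strip_cont b (\<lambda>t x. g (F t x))"
  using assms unfolding strip_cont_def by (auto intro: continuous_on_compose2)

lemma strip_cont_add: "strip_cont b F \<Longrightarrow> strip_cont b G \<Longrightarrow> strip_cont b (\<lambda>t x. F t x + G t x)"
  and strip_cont_diff: "strip_cont b F \<Longrightarrow> strip_cont b G \<Longrightarrow> strip_cont b (\<lambda>t x. F t x - G t x)"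
  unfolding strip_cont_def by (auto intro: continuous_intros)

lemma strip_cont_mult:
  fixes F G :: "real \<Rightarrow> real \<Rightarrow> 'a::{euclidean_space, real_normed_algebra}"
  shows "strip_cont b F \<Longrightarrow> strip_cont b G \<Longrightarrow> strip_cont b (\<lambda>t x. F t x * G t x)"
  unfolding strip_cont_def by (auto intro: continuous_intros)

lemma strip_cont_const: "strip_cont b (\<lambda>t x. c)"
  unfolding strip_cont_def by auto

lemma strip_cont_fst: "continuous_on UNIV g \<Longrightarrow> strip_cont b (\<lambda>t x. g t)"
  and strip_cont_snd: "continuous_on UNIV g \<Longrightarrow> strip_cont b (\<lambda>t x. g x)"
  unfolding strip_cont_def by (auto intro!: continuous_on_compose2[of UNIV g] continuous_intros)

lemma strip_cont_Re: "strip_cont b F \<Longrightarrow> strip_cont b (\<lambda>t x. Re (F t x))"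
  and strip_cont_Im: "strip_cont b F \<Longrightarrow> strip_cont b (\<lambda>t x. Im (F t x))"
  and strip_cont_cnj: "strip_cont b F \<Longrightarrow> strip_cont b (\<lambda>t x. cnj (F t x))"
  and strip_cont_norm: "strip_cont b F \<Longrightarrow> strip_cont b (\<lambda>t x. cmod (F t x))"
  and strip_cont_of_real: "strip_cont b F' \<Longrightarrow> strip_cont b (\<lambda>t x. complex_of_real (F' t x))"
  unfolding strip_cont_def by (auto intro!: continuous_intros)

lemma strip_cont_power:
  fixes F :: "real \<Rightarrow> real \<Rightarrow> 'a::{euclidean_space, real_normed_algebra_1}"
  shows "strip_cont b F \<Longrightarrow> strip_cont b (\<lambda>t x. F t x ^ n)"
  unfolding strip_cont_def by (auto intro!: continuous_intros)

lemma strip_cont_sum: "finite I \<Longrightarrow> (\<And>i. i \<in> I \<Longrightarrow> strip_cont b (F i)) \<Longrightarrow> strip_cont b (\<lambda>t x. \<Sum>i\<in>I. F i t x)"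
  unfolding strip_cont_def by (auto intro!: continuous_intros)

lemmas strip_cont_intros = strip_cont_add strip_cont_diff strip_cont_mult strip_cont_const strip_cont_Re
  strip_cont_Im strip_cont_cnj strip_cont_norm strip_cont_of_real strip_cont_power strip_cont_sum

section \<open>Differentiation under the mean and Green's formula\<close>

lemma cmean_leibniz:
  fixes F :: "real \<Rightarrow> real \<Rightarrow> 'a::euclidean_space"
  assumes d: "\<And>t x. 0 < t \<Longrightarrow> t < b \<Longrightarrow> ((\<lambda>t. F t x) has_vector_derivative G t x) (at t)"
    and F: "strip_cont b F" and G: "strip_cont b G" and t: "0 < t" "t < b"
  shows "((\<lambda>t. cmean (F t)) has_vector_derivative cmean (G t)) (at t)"
proof -
  have "((\<lambda>t. integral (cbox 0 (2*pi)) (F t)) has_vector_derivative integral (cbox 0 (2*pi)) (G t)) (at t within {0<..<b})"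
  proof (rule leibniz_rule_vector_derivative)
    show "((\<lambda>x. F x s) has_vector_derivative G x s) (at x within {0<..<b})" if "x \<in> {0<..<b}" for x s
      using d[of x s] that by (auto intro: has_vector_derivative_at_within)
    show "F x integrable_on cbox 0 (2 * pi)" if "x \<in> {0<..<b}" for x
      using cont_int[OF strip_cont_slice[OF F]] that by auto
    show "continuous_on ({0<..<b} \<times> cbox 0 (2 * pi)) (\<lambda>(x, y). G x y)"
      using G unfolding strip_cont_def case_prod_unfold by (rule continuous_on_subset) auto
  qed (use t in auto)
  then have "((\<lambda>t. integral {0..2*pi} (F t)) has_vector_derivative integral {0..2*pi} (G t)) (at t)"
    using t by (simp add: at_within_open[of t "{0<..<b}"])
  then show ?thesis unfolding cmean_def
    by (rule bounded_linear.has_vector_derivative[OF bounded_linear_scaleR_right])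
qed

lemma cmean_strip_cont:
  fixes F :: "real \<Rightarrow> real \<Rightarrow> 'a::euclidean_space"
  assumes F: "strip_cont b F"
  shows "continuous_on {0<..<b} (\<lambda>t. cmean (F t))"
proof -
  have "continuous_on {0<..<b} (\<lambda>t. integral (cbox 0 (2*pi)) (F t))"
    by (rule integral_continuous_on_param)
      (use F in \<open>auto simp: strip_cont_def case_prod_unfold intro: continuous_on_subset\<close>)
  then show ?thesis unfolding cmean_def by (auto intro!: continuous_intros)
qed

lemma cmean_deriv_0:
  fixes u :: "real \<Rightarrow> 'a::euclidean_space"
  assumes "\<And>x. (u has_vector_derivative u' x) (at x)" "u (2 * pi) = u 0"
  shows "cmean u' = 0"
proof -
  have "(u' has_integral (u (2*pi) - u 0)) {0..2*pi}"
    by (rule fundamental_theorem_of_calculus) (auto intro: has_vector_derivative_at_within assms)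
  then show ?thesis using assms(2) by (simp add: cmean_def integral_unique)
qed

text \<open>The mean of the x-derivative of u v_t vanishes by periodicity. Subtracting it from the
  derivative of the mean of u v_x cancels the mixed derivative of v and leaves the density of du
  wedge dv.\<close>

lemma green_deriv:
  fixes u v :: "real \<Rightarrow> real \<Rightarrow> complex"
  assumes ut: "\<And>t x. 0 < t \<Longrightarrow> t < b \<Longrightarrow> ((\<lambda>t. u t x) has_vector_derivative ut t x) (at t)"
    and ux: "\<And>t x. 0 < t \<Longrightarrow> t < b \<Longrightarrow> ((\<lambda>x. u t x) has_vector_derivative ux t x) (at x)"
    and vxt: "\<And>t x. 0 < t \<Longrightarrow> t < b \<Longrightarrow> ((\<lambda>t. vx t x) has_vector_derivative vtx t x) (at t)"
    and vtx: "\<And>t x. 0 < t \<Longrightarrow> t < b \<Longrightarrow> ((\<lambda>x. vt t x) has_vector_derivative vtx t x) (at x)"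
    and c: "strip_cont b u" "strip_cont b ut" "strip_cont b ux" "strip_cont b vt" "strip_cont b vx" "strip_cont b vtx"
    and per: "\<And>t x. 0 < t \<Longrightarrow> t < b \<Longrightarrow> u t (2 * pi) = u t 0" "\<And>t x. 0 < t \<Longrightarrow> t < b \<Longrightarrow> vt t (2 * pi) = vt t 0"
    and t: "0 < t" "t < b"
  shows "((\<lambda>t. cmean (\<lambda>x. u t x * vx t x)) has_vector_derivative cmean (\<lambda>x. ut t x * vx t x - ux t x * vt t x)) (at t)"
proof -
  have "((\<lambda>t. cmean (\<lambda>x. u t x * vx t x)) has_vector_derivative cmean (\<lambda>x. u t x * vtx t x + ut t x * vx t x)) (at t)"
    by (rule cmean_leibniz[OF has_vector_derivative_mult[OF ut vxt]])
      (use c t in \<open>auto intro!: strip_cont_intros\<close>)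
  moreover have "cmean (\<lambda>x. u t x * vtx t x + ux t x * vt t x) = 0"
    by (rule cmean_deriv_0[of "\<lambda>x. u t x * vt t x", OF has_vector_derivative_mult[OF ux vtx]])
      (use t per in auto)
  moreover have "cmean (\<lambda>x. ut t x * vx t x - ux t x * vt t x)
     = cmean (\<lambda>x. u t x * vtx t x + ut t x * vx t x) - cmean (\<lambda>x. u t x * vtx t x + ux t x * vt t x)"
    using c[THEN strip_cont_slice, OF t]
    by (subst cmean_diff[symmetric]) (auto intro!: continuous_intros)
  ultimately show ?thesis by simp
qed

lemma Re_cnj_mult: "Re (cnj z * z) = (cmod z)\<^sup>2"
  by (simp only: cmod_power2) (simp add: power2_eq_square)

lemma has_vector_derivative_Re_cnj_mult:
  assumes "(u has_vector_derivative u') (at y)" "(v has_vector_derivative v') (at y)"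
  shows "((\<lambda>y. Re (cnj (u y) * v y)) has_vector_derivative Re (cnj (u y) * v' + cnj u' * v y)) (at y)"
  by (rule bounded_linear.has_vector_derivative[OF bounded_linear_Re
        has_vector_derivative_mult[OF bounded_linear.has_vector_derivative[OF bounded_linear_cnj assms(1)] assms(2)]])

lemma has_vector_derivative_norm_square:
  fixes u :: "real \<Rightarrow> complex"
  assumes "(u has_vector_derivative u') (at y)"
  shows "((\<lambda>y. (cmod (u y))\<^sup>2) has_vector_derivative 2 * Re (cnj (u y) * u')) (at y)"
  using has_vector_derivative_Re_cnj_mult[OF assms assms] unfolding Re_cnj_mult by (simp add: mult_ac)

lemma strip_ftc:
  fixes Y :: "real \<Rightarrow> 'a::euclidean_space"
  assumes "\<And>t. 0 < t \<Longrightarrow> t < b \<Longrightarrow> (Y has_vector_derivative y t) (at t)" "0 < s" "s \<le> t" "t < b"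
  shows "integral {s..t} y = Y t - Y s"
  by (rule integral_unique, rule fundamental_theorem_of_calculus)
    (use assms in \<open>auto intro: has_vector_derivative_at_within\<close>)

text \<open>\<open>Htx\<close> is postulated as the t-derivative of \<open>Hx\<close> alone; that it
  is also the x-derivative of \<open>Ht\<close> is proved in \<open>dHtx\<close>. All conditions
  concern the open strip, and the behaviour at t = 0 is left open.\<close>

locale harmonic_strip =
  fixes H Ht Hx Htt Htx Hxx :: "real \<Rightarrow> real \<Rightarrow> complex" and b :: real
  assumes b_pos: "0 < b"
    and dHt: "\<And>t x. 0 < t \<Longrightarrow> t < b \<Longrightarrow> ((\<lambda>t. H t x) has_vector_derivative Ht t x) (at t)"
    and dHx: "\<And>t x. 0 < t \<Longrightarrow> t < b \<Longrightarrow> ((\<lambda>x. H t x) has_vector_derivative Hx t x) (at x)"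
    and dHtt: "\<And>t x. 0 < t \<Longrightarrow> t < b \<Longrightarrow> ((\<lambda>t. Ht t x) has_vector_derivative Htt t x) (at t)"
    and dHxt: "\<And>t x. 0 < t \<Longrightarrow> t < b \<Longrightarrow> ((\<lambda>t. Hx t x) has_vector_derivative Htx t x) (at t)"
    and dHxx: "\<And>t x. 0 < t \<Longrightarrow> t < b \<Longrightarrow> ((\<lambda>x. Hx t x) has_vector_derivative Hxx t x) (at x)"
    and sc: "strip_cont b H" "strip_cont b Ht" "strip_cont b Hx" "strip_cont b Htt" "strip_cont b Htx" "strip_cont b Hxx"
    and per: "\<And>t x. 0 < t \<Longrightarrow> t < b \<Longrightarrow> H t (x + 2 * pi) = H t x"
      "\<And>t x. 0 < t \<Longrightarrow> t < b \<Longrightarrow> Ht t (x + 2 * pi) = Ht t x"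
      "\<And>t x. 0 < t \<Longrightarrow> t < b \<Longrightarrow> Hx t (x + 2 * pi) = Hx t x"
    and harmonic: "\<And>t x. 0 < t \<Longrightarrow> t < b \<Longrightarrow> Htt t x + Hxx t x = 0"
begin

lemmas slice = sc[THEN strip_cont_slice]

text \<open>Schwarz's theorem by integration: H(s, y) - H(s, a) is the integral of
  \<open>Hx s\<close> over [a, y], and differentiating in s under the integral shows that
  \<open>Ht t\<close> is a primitive of \<open>Htx t\<close>. The base point a = x - 1 makes x an
  interior point.\<close>

lemma dHtx:
  assumes t: "0 < t" "t < b"
  shows "((\<lambda>x. Ht t x) has_vector_derivative Htx t x) (at x)"
proof -
  define a where "a = x - 1"
  have eq: "Ht t y = Ht t a + integral {a..y} (Htx t)" if y: "y \<ge> a" for y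
  proof -
    have 1: "integral {a..y} (Hx s) = H s y - H s a" if "0 < s" "s < b" for s
      by (rule integral_unique, rule fundamental_theorem_of_calculus[OF y])
        (rule has_vector_derivative_at_within[OF dHx[OF that]])
    have "((\<lambda>s. integral (cbox a y) (Hx s)) has_vector_derivative integral (cbox a y) (Htx t)) (at t within {0<..<b})"
    proof (rule leibniz_rule_vector_derivative)
      show "((\<lambda>x. Hx x s) has_vector_derivative Htx x s) (at x within {0<..<b})" if "x \<in> {0<..<b}" for x s
        using dHxt[of x s] that by (auto intro: has_vector_derivative_at_within)
      show "Hx x integrable_on cbox a y" if "x \<in> {0<..<b}" for x
        using cont_int[OF slice(3)] that by auto
      show "continuous_on ({0<..<b} \<times> cbox a y) (\<lambda>(x, y). Htx x y)"
        using sc(5) unfolding strip_cont_def case_prod_unfold by (rule continuous_on_subset) auto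
    qed (use t in auto)
    then have "((\<lambda>s. integral {a..y} (Hx s)) has_vector_derivative integral {a..y} (Htx t)) (at t)"
      using t by (simp add: at_within_open[of t "{0<..<b}"])
    moreover have "((\<lambda>s. integral {a..y} (Hx s)) has_vector_derivative (Ht t y - Ht t a)) (at t)"
    proof (rule has_vector_derivative_transform_within_open[of "\<lambda>s. H s y - H s a" _ _ "{0<..<b}"])
      show "((\<lambda>s. H s y - H s a) has_vector_derivative Ht t y - Ht t a) (at t)"
        by (intro derivative_intros dHt t)
    qed (use t 1 in auto)
    ultimately have "integral {a..y} (Htx t) = Ht t y - Ht t a"
      by (rule vector_derivative_unique_at)
    then show ?thesis by simp
  qed
  have "((\<lambda>y. integral {a..y} (Htx t)) has_vector_derivative Htx t x) (at x within {a..x + 1})"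
    by (rule integral_has_vector_derivative)
      (use slice(5)[OF t] in \<open>auto simp: a_def intro: continuous_on_subset\<close>)
  then have "((\<lambda>y. integral {a..y} (Htx t)) has_vector_derivative Htx t x) (at x)"
    by (simp add: at_within_Icc_at a_def)
  then have "((\<lambda>y. Ht t a + integral {a..y} (Htx t)) has_vector_derivative Htx t x) (at x)"
    by (auto intro!: derivative_eq_intros)
  then show ?thesis
    by (rule has_vector_derivative_transform_within_open[of _ _ _ "{a<..}"]) (auto simp: a_def intro!: eq[symmetric, unfolded a_def])
qed

section \<open>Mean square, Dirichlet energy and Fourier modes\<close>

definition U where "U t = cmean (\<lambda>x. (cmod (H t x))\<^sup>2)"
definition U1 where "U1 t = 2 * cmean (\<lambda>x. Re (cnj (H t x) * Ht t x))"
text \<open>The Dirichlet density averaged over a period. By \<open>U1_deriv\<close> it equals U'' /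
  2, which turns an increment of U' into the energy of a strip.\<close>

definition D where "D t = cmean (\<lambda>x. (cmod (Ht t x))\<^sup>2 + (cmod (Hx t x))\<^sup>2)"
definition f where "f n t = fcoef (H t) n"
definition f1 where "f1 n t = fcoef (Ht t) n"

lemma per0: "0 < t \<Longrightarrow> t < b \<Longrightarrow> H t (2 * pi) = H t 0" "0 < t \<Longrightarrow> t < b \<Longrightarrow> Ht t (2 * pi) = Ht t 0"
   "0 < t \<Longrightarrow> t < b \<Longrightarrow> Hx t (2 * pi) = Hx t 0"
  using per[of t 0] by auto

lemma cnj_cis_deriv: "((\<lambda>x. cnj (cis (of_int n * x))) has_vector_derivative - (\<i> * of_int n) * cnj (cis (of_int n * x))) (at x)"
  using has_vector_derivative_cis[of "- of_int n" x UNIV] unfolding cis_cnj by simp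

lemma fcoef_deriv:
  assumes "\<And>x. (u has_vector_derivative u' x) (at x)" "continuous_on UNIV u'" "u (2 * pi) = u 0"
  shows "fcoef u' n = \<i> * of_int n * fcoef u n"
proof -
  have u: "continuous_on UNIV u"
    using assms(1) has_vector_derivative_continuous continuous_at_imp_continuous_on by blast
  have "cmean (\<lambda>x. u x * (- (\<i> * of_int n) * cnj (cis (of_int n * x))) + u' x * cnj (cis (of_int n * x))) = 0"
    by (rule cmean_deriv_0[OF has_vector_derivative_mult[OF assms(1) cnj_cis_deriv]]) (simp only: assms(3) cis_of_int_2pi mult_zero_right cis_zero)
  also have "cmean (\<lambda>x. u x * (- (\<i> * of_int n) * cnj (cis (of_int n * x))) + u' x * cnj (cis (of_int n * x)))
     = cmean (\<lambda>x. (- (\<i> * of_int n)) * (u x * cnj (cis (of_int n * x)))) + fcoef u' n"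
    unfolding fcoef_def by (subst cmean_add[symmetric]) (auto intro!: continuous_intros u assms(2) simp: mult_ac)
  also have "\<dots> = - (\<i> * of_int n) * fcoef u n + fcoef u' n" unfolding cmean_cmult fcoef_def ..
  finally show ?thesis by (simp add: eq_neg_iff_add_eq_0)
qed

lemma fcoef_Hx: "0 < t \<Longrightarrow> t < b \<Longrightarrow> fcoef (Hx t) n = \<i> * of_int n * f n t"
  unfolding f_def by (rule fcoef_deriv[OF dHx slice(3) per0(1)])

lemma fcoef_Htt: "0 < t \<Longrightarrow> t < b \<Longrightarrow> fcoef (Htt t) n = of_int n ^ 2 * f n t"
proof -
  assume t: "0 < t" "t < b"
  have "fcoef (Hxx t) n = \<i> * of_int n * fcoef (Hx t) n"
    using t by (intro fcoef_deriv[OF dHxx slice(6) per0(3)])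
  moreover have "Htt t = (\<lambda>x. (-1) * Hxx t x)" using harmonic[OF t] by (auto simp: eq_neg_iff_add_eq_0)
  ultimately show ?thesis using fcoef_cmult[of "-1" "Hxx t" n] t
    by (simp add: fcoef_Hx power2_eq_square mult_ac)
qed

lemma fcoef_leibniz:
  assumes d: "\<And>t x. 0 < t \<Longrightarrow> t < b \<Longrightarrow> ((\<lambda>t. F t x) has_vector_derivative G t x) (at t)"
    and F: "strip_cont b F" and G: "strip_cont b G" and t: "0 < t" "t < b"
  shows "((\<lambda>t. fcoef (F t) n) has_vector_derivative fcoef (G t) n) (at t)"
  unfolding fcoef_def
proof (rule cmean_leibniz[OF _ _ _ t])
  have c: "strip_cont b (\<lambda>t x. cnj (cis (of_int n * x)))" by (rule strip_cont_snd) (intro continuous_intros)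
  show "strip_cont b (\<lambda>t \<theta>. F t \<theta> * cnj (cis (real_of_int n * \<theta>)))" "strip_cont b (\<lambda>t \<theta>. G t \<theta> * cnj (cis (real_of_int n * \<theta>)))"
    by (intro strip_cont_mult F G c)+
  show "((\<lambda>t. F t x * cnj (cis (real_of_int n * x))) has_vector_derivative G t x * cnj (cis (real_of_int n * x))) (at t)"
    if "0 < t" "t < b" for t x
    by (rule bounded_linear.has_vector_derivative[OF bounded_linear_mult_left d[OF that]])
qed

lemma f_deriv: "0 < t \<Longrightarrow> t < b \<Longrightarrow> (f n has_vector_derivative f1 n t) (at t)"
  unfolding f_def f1_def by (rule fcoef_leibniz[OF dHt sc(1,2)])

lemma f1_deriv: "0 < t \<Longrightarrow> t < b \<Longrightarrow> (f1 n has_vector_derivative of_int n ^ 2 * f n t) (at t)"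
  using fcoef_leibniz[OF dHtt sc(2,4), of t n] unfolding f1_def[abs_def] by (simp add: fcoef_Htt)

lemma U_deriv: "0 < t \<Longrightarrow> t < b \<Longrightarrow> (U has_real_derivative U1 t) (at t)"
proof -
  assume t: "0 < t" "t < b"
  have "(U has_vector_derivative cmean (\<lambda>x. 2 * Re (cnj (H t x) * Ht t x))) (at t)"
    unfolding U_def
  proof (rule cmean_leibniz[OF _ _ _ t])
    show "((\<lambda>t. (cmod (H t x))\<^sup>2) has_vector_derivative 2 * Re (cnj (H t x) * Ht t x)) (at t)" if "0 < t" "t < b" for t x
      by (rule has_vector_derivative_norm_square[OF dHt[OF that]])
  qed (intro strip_cont_intros sc)+
  then show ?thesis unfolding U1_def cmean_rmult has_real_derivative_iff_has_vector_derivative .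
qed

text \<open>H_tt = - H_xx, and integration by parts over a period turns the mean of - Re (cnj H
  H_xx) into that of |H_x|^2.\<close>

lemma U1_deriv: "0 < t \<Longrightarrow> t < b \<Longrightarrow> (U1 has_real_derivative 2 * D t) (at t)"
proof -
  assume t: "0 < t" "t < b"
  have "((\<lambda>t. cmean (\<lambda>x. Re (cnj (H t x) * Ht t x))) has_vector_derivative
    cmean (\<lambda>x. (cmod (Ht t x))\<^sup>2 + Re (cnj (H t x) * Htt t x))) (at t)"
  proof (rule cmean_leibniz[OF _ _ _ t])
    show "((\<lambda>t. Re (cnj (H t x) * Ht t x)) has_vector_derivative (cmod (Ht t x))\<^sup>2 + Re (cnj (H t x) * Htt t x)) (at t)" if "0 < t" "t < b" for t x
      using has_vector_derivative_Re_cnj_mult[OF dHt[OF that, of x] dHtt[OF that, of x]] unfolding plus_complex.sel Re_cnj_mult by (simp only: add.commute)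
  qed (intro strip_cont_intros sc)+
  moreover have "cmean (\<lambda>x. Re (cnj (H t x) * Hxx t x + cnj (Hx t x) * Hx t x)) = 0"
    by (rule cmean_deriv_0[of "\<lambda>x. Re (cnj (H t x) * Hx t x)"],
      rule has_vector_derivative_Re_cnj_mult[OF dHx[OF t] dHxx[OF t]])
      (simp add: per0 t)
  moreover have "cmean (\<lambda>x. (cmod (Ht t x))\<^sup>2 + Re (cnj (H t x) * Htt t x)) + cmean (\<lambda>x. Re (cnj (H t x) * Hxx t x + cnj (Hx t x) * Hx t x)) = D t"
  proof -
    have r: "Re (cnj (H t x) * Htt t x) + Re (cnj (H t x) * Hxx t x) = 0" for x
    proof -
      have "Htt t x = - Hxx t x" using harmonic[OF t, of x] by (simp add: eq_neg_iff_add_eq_0)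
      then show ?thesis by simp
    qed
    have "(cmod (Ht t x))\<^sup>2 + Re (cnj (H t x) * Htt t x) + Re (cnj (H t x) * Hxx t x + cnj (Hx t x) * Hx t x)
        = (cmod (Ht t x))\<^sup>2 + (cmod (Hx t x))\<^sup>2" for x
      using r[of x] unfolding plus_complex.sel Re_cnj_mult by linarith
    note pt = this
    have "cmean (\<lambda>x. (cmod (Ht t x))\<^sup>2 + Re (cnj (H t x) * Htt t x)) + cmean (\<lambda>x. Re (cnj (H t x) * Hxx t x + cnj (Hx t x) * Hx t x))
      = cmean (\<lambda>x. ((cmod (Ht t x))\<^sup>2 + Re (cnj (H t x) * Htt t x)) + Re (cnj (H t x) * Hxx t x + cnj (Hx t x) * Hx t x))"
      by (rule cmean_add[symmetric]) (intro continuous_intros slice t)+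
    then show ?thesis unfolding D_def pt .
  qed
  ultimately have "((\<lambda>t. cmean (\<lambda>x. Re (cnj (H t x) * Ht t x))) has_vector_derivative D t) (at t)" by simp
  then have "((\<lambda>t. cmean (\<lambda>x. Re (cnj (H t x) * Ht t x))) has_real_derivative D t) (at t)"
    by (simp add: has_real_derivative_iff_has_vector_derivative)
  then show ?thesis unfolding U1_def by (rule DERIV_cmult)
qed

lemma D_nonneg: "0 < t \<Longrightarrow> t < b \<Longrightarrow> 0 \<le> D t"
  unfolding D_def by (intro cmean_nonneg continuous_intros slice) auto

lemma U1_mono: "0 < s \<Longrightarrow> s \<le> t \<Longrightarrow> t < b \<Longrightarrow> U1 s \<le> U1 t"
  by (rule DERIV_nonneg_imp_nondecreasing[of s t U1])
    (auto intro!: exI[of _ "2 * D _"] U1_deriv mult_nonneg_nonneg D_nonneg)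

lemma integral_D: "0 < s \<Longrightarrow> s \<le> t \<Longrightarrow> t < b \<Longrightarrow> integral {s..t} D = (U1 t - U1 s) / 2"
proof -
  assume *: "0 < s" "s \<le> t" "t < b"
  have "integral {s..t} (\<lambda>t. 2 * D t) = U1 t - U1 s"
    by (rule strip_ftc[OF _ *]) (use U1_deriv has_real_derivative_iff_has_vector_derivative in blast)
  then show ?thesis by (simp add: integral_mult_right)
qed

lemma hs_deriv: "(hs m has_real_derivative cosh (m * t)) (at t)"
  unfolding hs_def by (cases "m = 0") (auto intro!: derivative_eq_intros)

text \<open>For fixed t the right-hand side is constant in s, since its derivative vanishes by f'' =
  m^2 f; at s = t it is \<open>f n t\<close>.\<close>

lemma f_shift:
  fixes n :: int
  assumes st: "0 < s" "s < b" "0 < t" "t < b"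
  defines "m \<equiv> real_of_int \<bar>n\<bar>"
  shows "f n t = f n s * of_real (cosh (m * (t - s))) + f1 n s * of_real (hs m (t - s))"
proof -
  define Y where "Y = (\<lambda>s. f n s * of_real (cosh (m * (t - s))) + f1 n s * of_real (hs m (t - s)))"
  have mm: "of_int n ^ 2 = complex_of_real (m\<^sup>2)" by (simp add: m_def)
  have hsm: "m\<^sup>2 * hs m x = m * sinh (m * x)" for x by (simp add: hs_def power2_eq_square)
  have d: "(Y has_vector_derivative 0) (at s)" if "0 < s" "s < b" for s
  proof -
    have c: "((\<lambda>s. complex_of_real (cosh (m * (t - s)))) has_vector_derivative of_real (- m * sinh (m * (t - s)))) (at s)"
      by (rule has_vector_derivative_of_real) (auto intro!: derivative_eq_intros)
    have h: "((\<lambda>s. complex_of_real (hs m (t - s))) has_vector_derivative of_real (- cosh (m * (t - s)))) (at s)"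
    proof (rule has_vector_derivative_of_real)
      have "((\<lambda>s. hs m (t - s)) has_real_derivative cosh (m * (t - s)) * (- 1)) (at s)"
        by (rule DERIV_chain2[OF hs_deriv]) (auto intro!: derivative_eq_intros)
      then show "((\<lambda>s. hs m (t - s)) has_real_derivative - cosh (m * (t - s))) (at s)" by simp
    qed
    have "(Y has_vector_derivative (f n s * of_real (- m * sinh (m * (t - s))) + f1 n s * of_real (cosh (m * (t - s))))
       + (f1 n s * of_real (- cosh (m * (t - s))) + of_int n ^ 2 * f n s * of_real (hs m (t - s)))) (at s)"
      unfolding Y_def by (intro derivative_intros has_vector_derivative_mult f_deriv f1_deriv c h that)
    moreover have "of_int n ^ 2 * f n s * of_real (hs m (t - s)) = f n s * of_real (m * sinh (m * (t - s)))"
      unfolding mm hsm[symmetric] by simp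
    ultimately show ?thesis by simp
  qed
  obtain c where "\<And>x. x \<in> {0<..<b} \<Longrightarrow> Y x = c"
    by (rule has_vector_derivative_zero_constant[of "{0<..<b}" Y]) (use d in \<open>auto intro: has_vector_derivative_at_within\<close>)
  then have "Y s = Y t" using st by auto
  then show ?thesis by (simp add: Y_def hs_def)
qed

text \<open>(f' + m f)' = m (f' + m f), so this combination carries only the growing exponential.
  Read from a fixed t back to s it is damped by exp(-m (t - s)), which is the source of the
  estimates that stay uniform as s tends to 0.\<close>

lemma f1_shift:
  fixes n :: int
  assumes st: "0 < s" "s < b" "0 < t" "t < b"
  defines "m \<equiv> real_of_int \<bar>n\<bar>"
  shows "f1 n s + of_real m * f n s = of_real (exp (- m * (t - s))) * (f1 n t + of_real m * f n t)"
proof -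
  define Y where "Y = (\<lambda>s. of_real (exp (- m * s)) * (f1 n s + of_real m * f n s))"
  have "real_of_int n * real_of_int n = m * m" by (simp add: m_def)
  moreover have "of_int n ^ 2 = complex_of_real (real_of_int n * real_of_int n)" by (simp add: power2_eq_square)
  ultimately have mm: "of_int n ^ 2 = complex_of_real m * of_real m" by simp
  have d: "(Y has_vector_derivative 0) (at s)" if "0 < s" "s < b" for s
  proof -
    have c: "((\<lambda>s. complex_of_real (exp (- m * s))) has_vector_derivative of_real (- m * exp (- m * s))) (at s)"
      by (rule has_vector_derivative_of_real) (auto intro!: derivative_eq_intros)
    have "(Y has_vector_derivative of_real (exp (- m * s)) * (of_int n ^ 2 * f n s + of_real m * f1 n s)
       + of_real (- m * exp (- m * s)) * (f1 n s + of_real m * f n s)) (at s)"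
      unfolding Y_def
      by (intro derivative_intros has_vector_derivative_mult f_deriv f1_deriv c that
          bounded_linear.has_vector_derivative[OF bounded_linear_mult_right])
    then show ?thesis unfolding mm by (simp add: algebra_simps)
  qed
  obtain c where "\<And>x. x \<in> {0<..<b} \<Longrightarrow> Y x = c"
    by (rule has_vector_derivative_zero_constant[of "{0<..<b}" Y]) (use d in \<open>auto intro: has_vector_derivative_at_within\<close>)
  then have "Y s = Y t" using st by auto
  then have e: "of_real (exp (m * s)) * Y s = of_real (exp (m * s)) * Y t" by simp
  have k: "complex_of_real (exp (m * s)) * (of_real (exp (- m * x)) * z) = of_real (exp (- m * (x - s))) * z" for x z
    unfolding mult.assoc[symmetric] of_real_mult[symmetric] exp_add[symmetric] by (simp add: algebra_simps)
  show ?thesis using e unfolding Y_def k by simp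
qed

end

section \<open>Green's formula with a cutoff\<close>

text \<open>A C^1 function \<psi> is enough for Green's formula, so \<omega> may be the positive
  part of a quadratic with roots A0 and B0. K is its total mass and \<psi> the mass to the right of
  x.\<close>

lemma smooth_cutoff:
  fixes A0 B0 :: real
  assumes AB: "0 < A0" "A0 < B0"
  obtains \<omega> \<psi> :: "real \<Rightarrow> real" and K where
    "continuous_on UNIV \<omega>" "\<And>x. 0 \<le> \<omega> x" "\<And>x. A0 < x \<Longrightarrow> x < B0 \<Longrightarrow> 0 < \<omega> x" "\<And>x. x \<le> A0 \<Longrightarrow> \<omega> x = 0"
    "\<And>x. x \<ge> B0 \<Longrightarrow> \<omega> x = 0" "K > 0" "\<And>x. 0 < x \<Longrightarrow> (\<psi> has_real_derivative - \<omega> x) (at x)"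
    "\<And>x. 0 < x \<Longrightarrow> x \<le> A0 \<Longrightarrow> \<psi> x = K" "\<And>x. B0 \<le> x \<Longrightarrow> \<psi> x = 0"
    "\<And>x. 0 < x \<Longrightarrow> 0 \<le> \<psi> x" "\<And>x. 0 < x \<Longrightarrow> \<psi> x \<le> K"
proof
  define \<omega> where "\<omega> = (\<lambda>x. max 0 ((x - A0) * (B0 - x)))"
  define K where "K = integral {0..B0} \<omega>"
  define \<psi> where "\<psi> = (\<lambda>x. K - integral {0..x} \<omega>)"
  show c: "continuous_on UNIV \<omega>" unfolding \<omega>_def by (intro continuous_intros)
  show nn: "0 \<le> \<omega> x" for x by (simp add: \<omega>_def)
  show pos: "0 < \<omega> x" if "A0 < x" "x < B0" for x using that by (simp add: \<omega>_def)
  show z: "\<omega> x = 0" if "x \<le> A0" for x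
  proof -
    have "(x - A0) * (B0 - x) \<le> 0" using that AB by (intro mult_nonpos_nonneg) auto
    then show ?thesis by (simp add: \<omega>_def)
  qed
  show z2: "\<omega> x = 0" if "x \<ge> B0" for x
  proof -
    have "(x - A0) * (B0 - x) \<le> 0" using that AB by (intro mult_nonneg_nonpos) auto
    then show ?thesis by (simp add: \<omega>_def)
  qed
  have int: "\<omega> integrable_on {x..y}" for x y by (rule cont_int[OF c])
  have "K \<noteq> 0"
  proof
    assume "K = 0"
    then have "\<omega> ((A0 + B0) / 2) = 0"
      using integral_eq_0_iff[of 0 B0 \<omega>] continuous_on_subset[OF c, of "{0..B0}"] nn AB
      unfolding K_def by auto
    moreover have "\<omega> ((A0 + B0) / 2) > 0" using AB by (intro pos) auto
    ultimately show False by simp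
  qed
  moreover have "K \<ge> 0" unfolding K_def by (rule integral_nonneg[OF int]) (use nn in auto)
  ultimately show "K > 0" by simp
  show "(\<psi> has_real_derivative - \<omega> x) (at x)" if "0 < x" for x
  proof -
    have "((\<lambda>x. integral {0..x} \<omega>) has_real_derivative \<omega> x) (at x within {0..x+1})"
      by (rule integral_has_real_derivative) (use that in \<open>auto intro: continuous_on_subset[OF c]\<close>)
    then have "((\<lambda>x. integral {0..x} \<omega>) has_real_derivative \<omega> x) (at x)"
      using that by (simp add: at_within_Icc_at)
    then show ?thesis unfolding \<psi>_def by (auto intro!: derivative_eq_intros)
  qed
  show "\<psi> x = K" if "0 < x" "x \<le> A0" for x
  proof -
    have "integral {0..x} \<omega> = integral {0..x} (\<lambda>_. 0)" by (rule integral_cong) (use z that in auto)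
    then show ?thesis by (simp add: \<psi>_def)
  qed
  show pz: "\<psi> x = 0" if "B0 \<le> x" for x
  proof -
    have "integral {B0..x} \<omega> = integral {B0..x} (\<lambda>_. 0)" by (rule integral_cong) (use z2 in auto)
    moreover have "integral {0..B0} \<omega> + integral {B0..x} \<omega> = integral {0..x} \<omega>"
      by (rule Henstock_Kurzweil_Integration.integral_combine[OF _ _ int]) (use AB that in auto)
    ultimately show ?thesis by (simp add: \<psi>_def K_def)
  qed
  show "\<psi> x \<le> K" if "0 < x" for x
    using integral_nonneg[OF int, of 0 x] nn by (simp add: \<psi>_def)
  show "0 \<le> \<psi> x" if "0 < x" for x
  proof (cases "x \<le> B0")
    case True
    have "integral {0..x} \<omega> + integral {x..B0} \<omega> = integral {0..B0} \<omega>"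
      by (rule Henstock_Kurzweil_Integration.integral_combine[OF _ _ int]) (use True that in auto)
    then show ?thesis using integral_nonneg[OF int, of x B0] nn by (simp add: \<psi>_def K_def)
  qed (use pz in auto)
qed

text \<open>A mean in x but a plain integral in t: in this normalisation Green's formula relates it
  to \<open>cmean\<close> on the end slices without extra factors.\<close>

definition smean :: "real \<Rightarrow> real \<Rightarrow> (real \<Rightarrow> real \<Rightarrow> 'a::euclidean_space) \<Rightarrow> 'a" where
  "smean s t F = integral {s..t} (\<lambda>\<tau>. cmean (F \<tau>))"

context
  fixes b s t :: real
  assumes st: "0 < s" "s \<le> t" "t < b"
begin

lemma smean_int: "strip_cont b F \<Longrightarrow> (\<lambda>\<tau>. cmean (F \<tau>)) integrable_on {s..t}"
  by (intro integrable_continuous_real continuous_on_subset[OF cmean_strip_cont]) (use st in auto)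

lemma smean_add: "strip_cont b F \<Longrightarrow> strip_cont b G \<Longrightarrow> smean s t (\<lambda>\<tau> x. F \<tau> x + G \<tau> x) = smean s t F + smean s t G"
  unfolding smean_def by (subst integral_add[OF smean_int smean_int, symmetric])
    (auto intro!: integral_cong cmean_add strip_cont_slice[of b] simp: st(1,3) less_le_trans[OF st(1)] le_less_trans[OF _ st(3)])

lemma smean_diff: "strip_cont b F \<Longrightarrow> strip_cont b G \<Longrightarrow> smean s t (\<lambda>\<tau> x. F \<tau> x - G \<tau> x) = smean s t F - smean s t G"
  unfolding smean_def by (subst integral_diff[OF smean_int smean_int, symmetric])
    (auto intro!: integral_cong cmean_diff strip_cont_slice[of b] simp: st(1,3) less_le_trans[OF st(1)] le_less_trans[OF _ st(3)])

lemma smean_sum: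
  assumes "finite I" "\<And>i. i \<in> I \<Longrightarrow> strip_cont b (F i)"
  shows "smean s t (\<lambda>\<tau> x. \<Sum>i\<in>I. F i \<tau> x) = (\<Sum>i\<in>I. smean s t (F i))"
proof -
  have "smean s t (\<lambda>\<tau> x. \<Sum>i\<in>I. F i \<tau> x) = integral {s..t} (\<lambda>\<tau>. \<Sum>i\<in>I. cmean (F i \<tau>))"
    unfolding smean_def
    by (intro integral_cong cmean_sum assms(1) strip_cont_slice[of b] assms(2)) (use st in auto)
  also have "\<dots> = (\<Sum>i\<in>I. smean s t (F i))"
    unfolding smean_def by (intro integral_sum assms smean_int)
  finally show ?thesis .
qed

lemma smean_cmult: "smean s t (\<lambda>\<tau> x. c * F \<tau> x) = c * smean s t F" for c :: complex
  unfolding smean_def cmean_cmult by (rule integral_mult_right)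

lemma smean_rmult: "smean s t (\<lambda>\<tau> x. c * F \<tau> x) = c * smean s t F" for c :: real
  unfolding smean_def cmean_rmult by (rule integral_mult_right)

lemma smean_const: "smean s t (\<lambda>\<tau> x. c) = (t - s) *\<^sub>R c"
  unfolding smean_def using st by simp

lemma smean_linear:
  assumes "bounded_linear L" "strip_cont b F"
  shows "smean s t (\<lambda>\<tau> x. L (F \<tau> x)) = L (smean s t F)"
proof -
  have "smean s t (\<lambda>\<tau> x. L (F \<tau> x)) = integral {s..t} (L \<circ> (\<lambda>\<tau>. cmean (F \<tau>)))"
    unfolding smean_def o_def
    by (intro integral_cong cmean_linear[OF assms(1)] strip_cont_slice[OF assms(2)]) (use st in auto)
  also have "\<dots> = L (smean s t F)" unfolding smean_def by (rule integral_linear[OF smean_int[OF assms(2)] assms(1)])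
  finally show ?thesis .
qed

lemma smean_mono:
  fixes F G :: "real \<Rightarrow> real \<Rightarrow> real"
  assumes "strip_cont b F" "strip_cont b G" "\<And>\<tau> x. s \<le> \<tau> \<Longrightarrow> \<tau> \<le> t \<Longrightarrow> F \<tau> x \<le> G \<tau> x"
  shows "smean s t F \<le> smean s t G"
  unfolding smean_def
  by (intro integral_le smean_int assms(1,2) cmean_mono strip_cont_slice[of b] assms) (use st in auto)

lemma norm_smean_le:
  fixes F :: "real \<Rightarrow> real \<Rightarrow> 'a::euclidean_space"
  assumes "strip_cont b F" "strip_cont b G" "\<And>\<tau> x. s \<le> \<tau> \<Longrightarrow> \<tau> \<le> t \<Longrightarrow> norm (F \<tau> x) \<le> G \<tau> x"
  shows "norm (smean s t F) \<le> smean s t G"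
  unfolding smean_def
  by (intro integral_norm_bound_integral smean_int assms(1,2) norm_cmean_le_cmean strip_cont_slice[of b] assms) (use st in auto)

end

context harmonic_strip
begin

text \<open>The Jacobian determinant of H in the coordinates (t, x).\<close>

definition J where "J t x = Im (cnj (Ht t x) * Hx t x)"

lemma J_cont: "strip_cont b J"
  unfolding J_def by (intro strip_cont_intros sc)

definition E where "E t x = (cmod (H t x))\<^sup>2"

lemma E_cont: "strip_cont b E"
  unfolding E_def by (intro strip_cont_intros sc)

lemma E_deriv_t: "0 < t \<Longrightarrow> t < b \<Longrightarrow> ((\<lambda>t. E t x) has_real_derivative 2 * Re (cnj (H t x) * Ht t x)) (at t)"
  and E_deriv_x: "0 < t \<Longrightarrow> t < b \<Longrightarrow> ((\<lambda>x. E t x) has_real_derivative 2 * Re (cnj (H t x) * Hx t x)) (at x)"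
proof -
  assume t: "0 < t" "t < b"
  show "((\<lambda>t. E t x) has_real_derivative 2 * Re (cnj (H t x) * Ht t x)) (at t)"
    unfolding E_def has_real_derivative_iff_has_vector_derivative by (rule has_vector_derivative_norm_square[OF dHt[OF t]])
  show "((\<lambda>x. E t x) has_real_derivative 2 * Re (cnj (H t x) * Hx t x)) (at x)"
    unfolding E_def has_real_derivative_iff_has_vector_derivative by (rule has_vector_derivative_norm_square[OF dHx[OF t]])
qed

end

text \<open>\<open>inner\<close> and \<open>outer\<close> make \<psi>(E) equal to K on the slice s
  and to 0 on the slice t, so that Green's formula retains a single boundary term, with constant
  weight.\<close>

locale cutoff_strip = harmonic_strip +
  fixes \<omega> \<psi> :: "real \<Rightarrow> real" and K A0 B0 s t :: real
  assumes st: "0 < s" "s \<le> t" "t < b"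
    and nz: "\<And>t x. 0 < t \<Longrightarrow> t < b \<Longrightarrow> H t x \<noteq> 0"
    and \<omega>: "continuous_on UNIV \<omega>" "\<And>x. 0 \<le> \<omega> x" "\<And>x. x \<le> A0 \<Longrightarrow> \<omega> x = 0" "\<And>x. x \<ge> B0 \<Longrightarrow> \<omega> x = 0"
    and K: "K > 0"
    and \<psi>: "\<And>x. 0 < x \<Longrightarrow> (\<psi> has_real_derivative - \<omega> x) (at x)"
      "\<And>x. 0 < x \<Longrightarrow> x \<le> A0 \<Longrightarrow> \<psi> x = K" "\<And>x. B0 \<le> x \<Longrightarrow> \<psi> x = 0"
      "\<And>x. 0 < x \<Longrightarrow> 0 \<le> \<psi> x" "\<And>x. 0 < x \<Longrightarrow> \<psi> x \<le> K"
    and inner: "\<And>x. E s x \<le> A0" and outer: "\<And>x. B0 \<le> E t x"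
begin

lemma E_pos: "0 < \<tau> \<Longrightarrow> \<tau> < b \<Longrightarrow> 0 < E \<tau> x"
  using nz by (simp add: E_def)

lemma \<omega>_cont: "strip_cont b (\<lambda>t x. \<omega> (E t x))"
  by (rule strip_cont_compose[OF \<omega>(1) E_cont])

lemma \<psi>_cont: "strip_cont b (\<lambda>t x. \<psi> (E t x))"
proof -
  have "continuous_on {0<..} \<psi>" 
    using \<psi>(1) by (intro continuous_at_imp_continuous_on) (auto intro: DERIV_isCont)
  then show ?thesis using E_cont unfolding strip_cont_def
    by (rule continuous_on_compose2) (auto simp: E_pos)
qed

lemma \<psi>E_deriv_t: "0 < \<tau> \<Longrightarrow> \<tau> < b \<Longrightarrow> ((\<lambda>t. complex_of_real (\<psi> (E t x))) has_vector_derivative of_real (- \<omega> (E \<tau> x) * (2 * Re (cnj (H \<tau> x) * Ht \<tau> x)))) (at \<tau>)"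
  and \<psi>E_deriv_x: "0 < \<tau> \<Longrightarrow> \<tau> < b \<Longrightarrow> ((\<lambda>x. complex_of_real (\<psi> (E \<tau> x))) has_vector_derivative of_real (- \<omega> (E \<tau> x) * (2 * Re (cnj (H \<tau> x) * Hx \<tau> x)))) (at x)"
proof -
  assume \<tau>: "0 < \<tau>" "\<tau> < b"
  show "((\<lambda>t. complex_of_real (\<psi> (E t x))) has_vector_derivative of_real (- \<omega> (E \<tau> x) * (2 * Re (cnj (H \<tau> x) * Ht \<tau> x)))) (at \<tau>)"
    by (rule has_vector_derivative_of_real[OF DERIV_chain2[OF \<psi>(1)[OF E_pos[OF \<tau>]] E_deriv_t[OF \<tau>]]])
  show "((\<lambda>x. complex_of_real (\<psi> (E \<tau> x))) has_vector_derivative of_real (- \<omega> (E \<tau> x) * (2 * Re (cnj (H \<tau> x) * Hx \<tau> x)))) (at x)"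
    by (rule has_vector_derivative_of_real[OF DERIV_chain2[OF \<psi>(1)[OF E_pos[OF \<tau>]] E_deriv_x[OF \<tau>]]])
qed

text \<open>This is \<open>green_deriv\<close> for u = \<psi>(E) G, integrated from s to t. As
  \<psi>' = -\<omega>, the derivatives of E come with the weight \<omega>; v appears through its
  derivatives \<open>vt\<close> and \<open>vx\<close>.\<close>

lemma green_cutoff:
  fixes G Gt Gx vt vx vtx :: "real \<Rightarrow> real \<Rightarrow> complex"
  assumes Gt: "\<And>t x. 0 < t \<Longrightarrow> t < b \<Longrightarrow> ((\<lambda>t. G t x) has_vector_derivative Gt t x) (at t)"
    and Gx: "\<And>t x. 0 < t \<Longrightarrow> t < b \<Longrightarrow> ((\<lambda>x. G t x) has_vector_derivative Gx t x) (at x)"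
    and vxt: "\<And>t x. 0 < t \<Longrightarrow> t < b \<Longrightarrow> ((\<lambda>t. vx t x) has_vector_derivative vtx t x) (at t)"
    and vtx: "\<And>t x. 0 < t \<Longrightarrow> t < b \<Longrightarrow> ((\<lambda>x. vt t x) has_vector_derivative vtx t x) (at x)"
    and c: "strip_cont b G" "strip_cont b Gt" "strip_cont b Gx" "strip_cont b vt" "strip_cont b vx" "strip_cont b vtx"
    and per: "\<And>t. 0 < t \<Longrightarrow> t < b \<Longrightarrow> G t (2 * pi) = G t 0" "\<And>t. 0 < t \<Longrightarrow> t < b \<Longrightarrow> vt t (2 * pi) = vt t 0"
  shows "smean s t (\<lambda>t x.
      of_real (\<omega> (E t x)) * G t x * (of_real (2 * Re (cnj (H t x) * Ht t x)) * vx t x - of_real (2 * Re (cnj (H t x) * Hx t x)) * vt t x)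
      - of_real (\<psi> (E t x)) * (Gt t x * vx t x - Gx t x * vt t x))
     = of_real K * cmean (\<lambda>x. G s x * vx s x)"
proof -
  define u where "u = (\<lambda>t x. of_real (\<psi> (E t x)) * G t x)"
  define ut where "ut = (\<lambda>t x. of_real (\<psi> (E t x)) * Gt t x + of_real (- \<omega> (E t x) * (2 * Re (cnj (H t x) * Ht t x))) * G t x)"
  define ux where "ux = (\<lambda>t x. of_real (\<psi> (E t x)) * Gx t x + of_real (- \<omega> (E t x) * (2 * Re (cnj (H t x) * Hx t x))) * G t x)"
  define Y where "Y = (\<lambda>t. cmean (\<lambda>x. u t x * vx t x))"
  have mc: "strip_cont b (\<lambda>t x. - \<omega> (E t x) * (2 * Re (cnj (H t x) * F t x)))" if "strip_cont b F" for F
  proof -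
    have "strip_cont b (\<lambda>t x. (- 1) * \<omega> (E t x) * (2 * Re (cnj (H t x) * F t x)))"
      by (intro strip_cont_intros \<omega>_cont sc that)
    then show ?thesis by simp
  qed
  have "(Y has_vector_derivative cmean (\<lambda>x. ut \<tau> x * vx \<tau> x - ux \<tau> x * vt \<tau> x)) (at \<tau>)" if \<tau>: "0 < \<tau>" "\<tau> < b" for \<tau>
    unfolding Y_def
  proof (rule green_deriv[OF _ _ vxt vtx _ _ _ c(4-6) _ per(2) \<tau>])
    show "((\<lambda>t. u t x) has_vector_derivative ut t x) (at t)" if "0 < t" "t < b" for t x
      unfolding u_def ut_def by (rule has_vector_derivative_mult[OF \<psi>E_deriv_t Gt]) (use that in auto)
    show "((\<lambda>x. u t x) has_vector_derivative ux t x) (at x)" if "0 < t" "t < b" for t x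
      unfolding u_def ux_def by (rule has_vector_derivative_mult[OF \<psi>E_deriv_x Gx]) (use that in auto)
    show "strip_cont b u" unfolding u_def by (intro strip_cont_intros \<psi>_cont c)
    show "strip_cont b ut" "strip_cont b ux" unfolding ut_def ux_def
      by (intro strip_cont_add strip_cont_mult strip_cont_of_real \<psi>_cont mc c sc)+
    show "u t (2 * pi) = u t 0" if "0 < t" "t < b" for t
      using that per(1) per0 by (simp add: u_def E_def)
  qed
  from strip_ftc[OF this st]
  have 1: "smean s t (\<lambda>t x. ut t x * vx t x - ux t x * vt t x) = Y t - Y s" unfolding smean_def .
  have Yt: "Y t = 0" using \<psi>(3)[OF outer] by (simp add: Y_def u_def)
  have "\<psi> (E s x) = K" for x using \<psi>(2)[OF E_pos inner] st by simp
  then have Ys: "Y s = of_real K * cmean (\<lambda>x. G s x * vx s x)"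
    by (simp add: Y_def u_def mult.assoc cmean_cmult)
  have ptw: "of_real (\<omega> (E t x)) * G t x * (of_real (2 * Re (cnj (H t x) * Ht t x)) * vx t x - of_real (2 * Re (cnj (H t x) * Hx t x)) * vt t x)
      - of_real (\<psi> (E t x)) * (Gt t x * vx t x - Gx t x * vt t x) = (-1) * (ut t x * vx t x - ux t x * vt t x)" for t x
    unfolding ut_def ux_def by (simp add: algebra_simps)
  show ?thesis unfolding ptw smean_cmult[OF st] 1 Yt Ys by simp
qed

text \<open>d|H|^2 = cnj(H) dH + H d(cnj H). In the wedge product with dH or with d(cnj H) one of
  the two terms drops out, and the other is a multiple of the Jacobian.\<close>

lemma cross_identity: 
  fixes h a c :: complex
  shows "of_real (2 * Re (cnj h * a)) * c - of_real (2 * Re (cnj h * c)) * a = h * (2 * \<i> * of_real (Im (cnj a * c)))"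
    "of_real (2 * Re (cnj h * a)) * cnj c - of_real (2 * Re (cnj h * c)) * cnj a = cnj h * (- 2 * \<i> * of_real (Im (cnj a * c)))"
  by (auto simp: complex_eq_iff algebra_simps)

lemma inverse_power_deriv:
  fixes h :: "real \<Rightarrow> complex"
  assumes "(h has_vector_derivative h') (at y)" "h y \<noteq> 0"
  shows "((\<lambda>y. 1 / h y ^ Suc k) has_vector_derivative - of_nat (Suc k) * h' / h y ^ Suc (Suc k)) (at y)"
proof -
  have "((\<lambda>z. inverse z ^ Suc k) has_field_derivative of_nat (Suc k) * (- (inverse (h y) ^ Suc (Suc 0)) * inverse (h y) ^ (Suc k - Suc 0))) (at (h y))"
    by (rule DERIV_power[OF DERIV_inverse[OF assms(2)]])
  moreover have "of_nat (Suc k) * (- (inverse (h y) ^ Suc (Suc 0)) * inverse (h y) ^ (Suc k - Suc 0)) = - of_nat (Suc k) / h y ^ Suc (Suc k)"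
    using assms(2) by (simp add: field_simps del: of_nat_Suc)
  moreover have "(\<lambda>z. inverse z ^ Suc k) = (\<lambda>z::complex. 1 / z ^ Suc k)" by (simp add: inverse_eq_divide power_one_over)
  ultimately have "((\<lambda>z. 1 / z ^ Suc k) has_field_derivative - of_nat (Suc k) / h y ^ Suc (Suc k)) (at (h y))" by (simp only:)
  from field_vector_diff_chain_at[OF assms(1) this] show ?thesis by (simp add: o_def mult_ac)
qed

lemma strip_cont_divide_H: "strip_cont b F \<Longrightarrow> strip_cont b (\<lambda>t x. F t x / H t x ^ k)"
  using sc(1) nz unfolding strip_cont_def by (auto intro!: continuous_intros)

text \<open>For G = H^(-k-1) and v = H the product dG wedge dH is zero, so the \<psi>-term
  disappears and only the \<omega>-term remains. On the right, k = 0 gives the winding number, and k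
  \<ge> 1 the mean of an exact derivative.\<close>

lemma omega_J_power:
  "smean s t (\<lambda>t x. of_real (\<omega> (E t x) * J t x) / H t x ^ k) = of_real K / (2 * \<i>) * cmean (\<lambda>x. Hx s x / H s x ^ Suc k)"
proof -
  define G Gt Gx where "G = (\<lambda>t x. 1 / H t x ^ Suc k)" and "Gt = (\<lambda>t x. - of_nat (Suc k) * Ht t x / H t x ^ Suc (Suc k))"
    and "Gx = (\<lambda>t x. - of_nat (Suc k) * Hx t x / H t x ^ Suc (Suc k))"
  have "smean s t (\<lambda>t x.
      of_real (\<omega> (E t x)) * G t x * (of_real (2 * Re (cnj (H t x) * Ht t x)) * Hx t x - of_real (2 * Re (cnj (H t x) * Hx t x)) * Ht t x)
      - of_real (\<psi> (E t x)) * (Gt t x * Hx t x - Gx t x * Ht t x))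
     = of_real K * cmean (\<lambda>x. G s x * Hx s x)"
  proof (rule green_cutoff[OF _ _ dHxt dHtx])
    show "((\<lambda>t. G t x) has_vector_derivative Gt t x) (at t)" if "0 < t" "t < b" for t x
      unfolding G_def Gt_def by (rule inverse_power_deriv[OF dHt nz]) (use that in auto)
    show "((\<lambda>x. G t x) has_vector_derivative Gx t x) (at x)" if "0 < t" "t < b" for t x
      unfolding G_def Gx_def by (rule inverse_power_deriv[OF dHx nz]) (use that in auto)
    show "strip_cont b G" "strip_cont b Gt" "strip_cont b Gx"
      unfolding G_def Gt_def Gx_def by (intro strip_cont_divide_H strip_cont_intros sc)+
    show "G t (2 * pi) = G t 0" if "0 < t" "t < b" for t using that by (simp add: G_def per0)
  qed (use sc per0 in auto)
  also have "(\<lambda>t x.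
      of_real (\<omega> (E t x)) * G t x * (of_real (2 * Re (cnj (H t x) * Ht t x)) * Hx t x - of_real (2 * Re (cnj (H t x) * Hx t x)) * Ht t x)
      - of_real (\<psi> (E t x)) * (Gt t x * Hx t x - Gx t x * Ht t x))
     = (\<lambda>t x. of_real (\<omega> (E t x)) * G t x * (H t x * (2 * \<i> * of_real (J t x))))"
    unfolding cross_identity J_def Gt_def Gx_def by (intro ext) simp
  also have "smean s t \<dots> = smean s t (\<lambda>t x. (2 * \<i>) * (of_real (\<omega> (E t x) * J t x) / H t x ^ k))"
    unfolding smean_def
  proof (intro integral_cong)
    fix \<tau> assume "\<tau> \<in> {s..t}"
    then have "H \<tau> x \<noteq> 0" for x using st nz by auto
    then have "of_real (\<omega> (E \<tau> x)) * G \<tau> x * (H \<tau> x * (2 * \<i> * of_real (J \<tau> x))) = (2 * \<i>) * (of_real (\<omega> (E \<tau> x) * J \<tau> x) / H \<tau> x ^ k)" for x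
      unfolding G_def by (simp add: field_simps)
    then show "cmean (\<lambda>x. of_real (\<omega> (E \<tau> x)) * G \<tau> x * (H \<tau> x * (2 * \<i> * of_real (J \<tau> x))))
      = cmean (\<lambda>x. (2 * \<i>) * (of_real (\<omega> (E \<tau> x) * J \<tau> x) / H \<tau> x ^ k))" by simp
  qed
  finally have "(2 * \<i>) * smean s t (\<lambda>t x. of_real (\<omega> (E t x) * J t x) / H t x ^ k) = of_real K * cmean (\<lambda>x. G s x * Hx s x)"
    unfolding smean_cmult[OF st] .
  then show ?thesis unfolding G_def by (simp add: field_simps)
qed

lemma omega_J_power_zero:
  assumes "k \<ge> 1"
  shows "smean s t (\<lambda>t x. of_real (\<omega> (E t x) * J t x) / H t x ^ k) = 0"
proof -
  obtain j where k: "k = Suc j" using assms by (cases k) auto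
  have s: "0 < s" "s < b" using st by auto
  have "cmean (\<lambda>x. - of_nat (Suc j) * Hx s x / H s x ^ Suc (Suc j)) = 0"
    by (rule cmean_deriv_0[OF inverse_power_deriv[OF dHx nz]]) (use s per0 in auto)
  then have "- of_nat (Suc j) * cmean (\<lambda>x. Hx s x / H s x ^ Suc k) = 0"
    unfolding k cmean_cmult[symmetric] by simp
  then show ?thesis unfolding omega_J_power by (simp del: of_nat_Suc)
qed

text \<open>Green's formula for the pair G, cnj H; the left-hand side equals K A(s) for G = H and K X(s) for the function G
  of the next sections.\<close>

lemma green_G:
  fixes G Gt Gx :: "real \<Rightarrow> real \<Rightarrow> complex"
  assumes Gt: "\<And>t x. 0 < t \<Longrightarrow> t < b \<Longrightarrow> ((\<lambda>t. G t x) has_vector_derivative Gt t x) (at t)"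
    and Gx: "\<And>t x. 0 < t \<Longrightarrow> t < b \<Longrightarrow> ((\<lambda>x. G t x) has_vector_derivative Gx t x) (at x)"
    and c: "strip_cont b G" "strip_cont b Gt" "strip_cont b Gx"
    and per: "\<And>t. 0 < t \<Longrightarrow> t < b \<Longrightarrow> G t (2 * pi) = G t 0"
  shows "K * Re (\<i> * cmean (\<lambda>x. G s x * cnj (Hx s x)))
    = 2 * smean s t (\<lambda>t x. \<omega> (E t x) * J t x * Re (cnj (H t x) * G t x))
      - smean s t (\<lambda>t x. \<psi> (E t x) * Re (\<i> * (Gt t x * cnj (Hx t x) - Gx t x * cnj (Ht t x))))"
proof -
  have "of_real K * cmean (\<lambda>x. G s x * cnj (Hx s x)) = smean s t (\<lambda>t x.
      of_real (\<omega> (E t x)) * G t x * (of_real (2 * Re (cnj (H t x) * Ht t x)) * cnj (Hx t x) - of_real (2 * Re (cnj (H t x) * Hx t x)) * cnj (Ht t x))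
      - of_real (\<psi> (E t x)) * (Gt t x * cnj (Hx t x) - Gx t x * cnj (Ht t x)))" (is "_ = smean s t ?F")
    by (rule green_cutoff[OF Gt Gx bounded_linear.has_vector_derivative[OF bounded_linear_cnj dHxt] bounded_linear.has_vector_derivative[OF bounded_linear_cnj dHtx] c _ _ _ per, symmetric])
      (auto intro!: strip_cont_intros sc simp: per0)
  moreover have "strip_cont b ?F" by (intro strip_cont_intros \<omega>_cont \<psi>_cont c sc)
  ultimately have "Re (\<i> * (of_real K * cmean (\<lambda>x. G s x * cnj (Hx s x)))) = smean s t (\<lambda>t x. Re (\<i> * ?F t x))"
    using smean_linear[OF st bounded_linear_compose[OF bounded_linear_Re bounded_linear_mult_right[of \<i>]], of ?F] by simp
  also have "(\<lambda>t x. Re (\<i> * ?F t x)) = (\<lambda>t x. 2 * (\<omega> (E t x) * J t x * Re (cnj (H t x) * G t x))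
      - \<psi> (E t x) * Re (\<i> * (Gt t x * cnj (Hx t x) - Gx t x * cnj (Ht t x))))"
    unfolding cross_identity J_def by (intro ext) (simp add: algebra_simps)
  also have "smean s t \<dots> = 2 * smean s t (\<lambda>t x. \<omega> (E t x) * J t x * Re (cnj (H t x) * G t x))
      - smean s t (\<lambda>t x. \<psi> (E t x) * Re (\<i> * (Gt t x * cnj (Hx t x) - Gx t x * cnj (Ht t x))))"
    unfolding smean_rmult[OF st, symmetric]
    by (rule smean_diff[OF st]) (intro strip_cont_intros \<omega>_cont \<psi>_cont J_cont c sc)+
  finally show ?thesis by (simp add: algebra_simps)
qed

end

section \<open>Lower bound for the enclosed area\<close>

text \<open>The winding number of H(t, -) about 0 is only assumed to be -1, 0 or 1, which is what injectivity gives; it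
  turns out to be 1 since J is positive.\<close>

locale nitsche_strip = harmonic_strip +
  assumes gt1: "\<And>t x. 0 < t \<Longrightarrow> t < b \<Longrightarrow> 1 < cmod (H t x)"
    and lim1: "\<And>e. e > 0 \<Longrightarrow> \<exists>d>0. \<forall>t x. 0 < t \<longrightarrow> t < d \<longrightarrow> t < b \<longrightarrow> cmod (H t x) < 1 + e"
    and jac: "\<And>t x. 0 < t \<Longrightarrow> t < b \<Longrightarrow> 0 < J t x"
    and wind: "\<And>t. 0 < t \<Longrightarrow> t < b \<Longrightarrow> \<exists>N\<in>{-1, 0, 1 :: real}. cmean (\<lambda>x. Hx t x / H t x) = \<i> * of_real N"
begin

lemma nz: "0 < t \<Longrightarrow> t < b \<Longrightarrow> H t x \<noteq> 0"
  using gt1[of t x] by auto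

lemma E_gt1: "0 < t \<Longrightarrow> t < b \<Longrightarrow> 1 < E t x"
  using gt1[of t x] unfolding E_def by simp

lemma E_lim: "e > 0 \<Longrightarrow> \<exists>d>0. \<forall>t x. 0 < t \<longrightarrow> t < d \<longrightarrow> t < b \<longrightarrow> E t x < 1 + e"
proof -
  assume e: "e > 0"
  then have "sqrt (1 + e) - 1 > 0" by simp
  from lim1[OF this] obtain d where d: "d > 0" "\<And>t x. 0 < t \<Longrightarrow> t < d \<Longrightarrow> t < b \<Longrightarrow> cmod (H t x) < sqrt (1 + e)" by auto
  have "E t x < 1 + e" if "0 < t" "t < d" "t < b" for t x
  proof -
    have "(cmod (H t x))\<^sup>2 < (sqrt (1 + e))\<^sup>2" by (intro power_strict_mono d that) auto
    then show ?thesis using e by (simp add: E_def)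
  qed
  then show ?thesis using d(1) by blast
qed

lemma U_ge1: "0 < t \<Longrightarrow> t < b \<Longrightarrow> 1 \<le> U t"
proof -
  assume t: "0 < t" "t < b"
  have "cmean (\<lambda>x. 1) \<le> U t" unfolding U_def
    by (rule cmean_mono) (use E_gt1[OF t, unfolded E_def] less_imp_le in \<open>auto intro!: continuous_intros slice t\<close>)
  then show ?thesis by simp
qed

lemma U_gt1: "0 < t \<Longrightarrow> t < b \<Longrightarrow> 1 < U t"
proof -
  assume t: "0 < t" "t < b"
  have "U t \<noteq> 1"
  proof
    assume "U t = 1"
    then have "cmean (\<lambda>x. (cmod (H t x))\<^sup>2 - 1) = 0"
      unfolding U_def by (subst cmean_diff) (auto intro!: continuous_intros slice t)
    then have "(cmod (H t 0))\<^sup>2 - 1 = 0"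
      by (intro cmean_eq_0D[where f = "\<lambda>x. (cmod (H t x))\<^sup>2 - 1"] continuous_intros slice t)
        (use E_gt1[OF t, unfolded E_def] less_imp_le in auto)
    then show False using E_gt1[OF t, of 0] by (simp add: E_def)
  qed
  then show ?thesis using U_ge1[OF t] by simp
qed

lemma U_lim: "e > 0 \<Longrightarrow> \<exists>d>0. \<forall>t. 0 < t \<longrightarrow> t < d \<longrightarrow> t < b \<longrightarrow> U t \<le> 1 + e"
proof -
  assume "e > 0"
  then obtain d where d: "d > 0" "\<And>t x. 0 < t \<Longrightarrow> t < d \<Longrightarrow> t < b \<Longrightarrow> E t x < 1 + e" using E_lim by blast
  have "U t \<le> 1 + e" if t: "0 < t" "t < d" "t < b" for t
  proof -
    have "U t \<le> cmean (\<lambda>x. 1 + e)" unfolding U_def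
      by (rule cmean_mono) (use d(2)[OF t, unfolded E_def] less_imp_le in \<open>auto intro!: continuous_intros slice t\<close>)
    then show ?thesis by simp
  qed
  then show ?thesis using d(1) by blast
qed

text \<open>U' is nondecreasing, so a negative value at s would make U nonincreasing on (0, s] and
  keep it at or above U(s) > 1, against U -> 1 at t = 0. The strictness in \<open>U_gt1\<close> is
  essential.\<close>

lemma U1_nonneg: "0 < s \<Longrightarrow> s < b \<Longrightarrow> 0 \<le> U1 s"
proof (rule ccontr)
  assume s: "0 < s" "s < b" and "\<not> 0 \<le> U1 s"
  then have neg: "U1 s < 0" by simp
  have mono: "U s \<le> U t" if "0 < t" "t \<le> s" for t
  proof (rule DERIV_nonpos_imp_nonincreasing[OF that(2)])
    fix x assume x: "t \<le> x" "x \<le> s"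
    have "U1 x \<le> U1 s" using U1_mono x that s by auto
    then show "\<exists>y. (U has_real_derivative y) (at x) \<and> y \<le> 0"
      using U_deriv[of x] x that s neg by (intro exI[of _ "U1 x"]) auto
  qed
  obtain d where d: "d > 0" "\<And>t. 0 < t \<Longrightarrow> t < d \<Longrightarrow> t < b \<Longrightarrow> U t \<le> 1 + (U s - 1) / 2"
    using U_lim[of "(U s - 1) / 2"] U_gt1[OF s] by auto
  define t where "t = min s (d / 2)"
  have t: "0 < t" "t < d" "t < b" "t \<le> s" using s d(1) by (auto simp: t_def)
  show False using d(2)[OF t(1-3)] mono[OF t(1,4)] U_gt1[OF s] by (simp add: field_simps)
qed

text \<open>U' decreases to its infimum as t tends to 0, and the infimum is finite by
  \<open>U1_nonneg\<close>. By \<open>integral_D\<close> the energy of a thin strip at t = 0 is thus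
  small, even if the gradient of H is unbounded there.\<close>

lemma U1_small_gap:
  assumes "e > 0"
  shows "\<exists>t0. 0 < t0 \<and> t0 < b \<and> (\<forall>t s. 0 < s \<longrightarrow> s \<le> t \<longrightarrow> t \<le> t0 \<longrightarrow> U1 t - U1 s \<le> e)"
proof -
  have ne: "U1 ` {0<..<b} \<noteq> {}" using b_pos dense by (auto simp: Bex_def)
  have bd: "bdd_below (U1 ` {0<..<b})" using U1_nonneg by (intro bdd_belowI[of _ 0]) auto
  obtain t0 where t0: "0 < t0" "t0 < b" "U1 t0 < Inf (U1 ` {0<..<b}) + e"
    using cInf_lessD[OF ne, of "Inf (U1 ` {0<..<b}) + e"] assms by auto
  have "U1 t - U1 s \<le> e" if "0 < s" "s \<le> t" "t \<le> t0" for s t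
  proof -
    have "Inf (U1 ` {0<..<b}) \<le> U1 s" by (rule cInf_lower[OF _ bd]) (use that t0 in auto)
    moreover have "U1 t \<le> U1 t0" using U1_mono that t0 by auto
    ultimately show ?thesis using t0 by simp
  qed
  then show ?thesis using t0 by blast
qed

lemma exists_cutoff:
  assumes t0: "0 < t0" "t0 < b"
  obtains \<tau>0 A0 B0 M \<omega> \<psi> K where "0 < \<tau>0" "\<tau>0 < t0" "1 < M" "M < A0" "A0 < B0" "B0 \<le> 4"
    "\<And>s. 0 < s \<Longrightarrow> s < \<tau>0 \<Longrightarrow> cutoff_strip H Ht Hx Htt Htx Hxx b \<omega> \<psi> K A0 B0 s t0"
    "\<And>s x. 0 < s \<Longrightarrow> s < \<tau>0 \<Longrightarrow> E s x \<le> M" "\<And>x. A0 < x \<Longrightarrow> x < B0 \<Longrightarrow> 0 < \<omega> x"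
proof -
  have "continuous_on {0..2*pi} (E t0)"
    using strip_cont_slice[OF E_cont t0] continuous_on_subset by blast
  then have "\<exists>x\<in>{0..2*pi}. \<forall>y\<in>{0..2*pi}. E t0 x \<le> E t0 y"
    by (intro continuous_attains_inf) auto
  then obtain x0 where x0: "\<And>x. x \<in> {0..2*pi} \<Longrightarrow> E t0 x0 \<le> E t0 x" by blast
  have x0': "E t0 x0 \<le> E t0 x" for x
    using x0[of "Arg2pi (cis x)"] Arg2pi_ge_0[of "cis x"] Arg2pi_lt_2pi[of "cis x"] periodic_Arg2pi[of "H t0", OF per(1)[OF t0], of x]
    by (simp add: E_def)
  \<comment> \<open>B0 \<le> E(t0, -) puts the slice t0 beyond the cutoff, and the 4 ensures |H|
    \<le> 2 on the support of \<omega>. A0 and M are midpoints; the gap M < A0 keeps the quotients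
    H(s, y) / H uniformly inside the unit disk, as the logarithmic series requires.\<close>
  define B0 where "B0 = min (E t0 x0) 4"
  have B0: "1 < B0" "B0 \<le> 4" using E_gt1[OF t0, of x0] by (auto simp: B0_def)
  define A0 where "A0 = (1 + B0) / 2"
  define M where "M = (1 + A0) / 2"
  have AM: "1 < M" "M < A0" "A0 < B0" using B0 by (auto simp: A0_def M_def)
  obtain d where d: "d > 0" "\<And>t x. 0 < t \<Longrightarrow> t < d \<Longrightarrow> t < b \<Longrightarrow> E t x < 1 + (M - 1)"
    using E_lim[of "M - 1"] AM by auto
  define \<tau>0 where "\<tau>0 = min d (t0 / 2)"
  have \<tau>0: "0 < \<tau>0" "\<tau>0 < t0" using d t0 by (auto simp: \<tau>0_def)
  have A0: "0 < A0" using AM by simp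
  obtain \<omega> \<psi> K where w: "continuous_on UNIV \<omega>" "\<And>x. 0 \<le> \<omega> x" "\<And>x. A0 < x \<Longrightarrow> x < B0 \<Longrightarrow> 0 < \<omega> x" "\<And>x. x \<le> A0 \<Longrightarrow> \<omega> x = 0"
    "\<And>x. x \<ge> B0 \<Longrightarrow> \<omega> x = 0" "K > 0" "\<And>x. 0 < x \<Longrightarrow> (\<psi> has_real_derivative - \<omega> x) (at x)"
    "\<And>x. 0 < x \<Longrightarrow> x \<le> A0 \<Longrightarrow> \<psi> x = K" "\<And>x. B0 \<le> x \<Longrightarrow> \<psi> x = 0"
    "\<And>x. 0 < x \<Longrightarrow> 0 \<le> \<psi> x" "\<And>x. 0 < x \<Longrightarrow> \<psi> x \<le> K"
    by (rule smooth_cutoff[OF A0 AM(3)]) (rule that)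
  have EM: "E s x \<le> M" if "0 < s" "s < \<tau>0" for s x
    using d(2)[of s x] that t0 by (auto simp: \<tau>0_def)
  show ?thesis
  proof (rule that[OF \<tau>0 AM(1-3) B0(2) _ EM w(3)])
    fix s assume s: "0 < s" "s < \<tau>0"
    show "cutoff_strip H Ht Hx Htt Htx Hxx b \<omega> \<psi> K A0 B0 s t0"
    proof (unfold_locales)
      show "E s x \<le> A0" for x using EM[OF s, of x] AM by simp
      show "B0 \<le> E t0 x" for x using x0'[of x] by (simp add: B0_def)
    qed (use s \<tau>0 t0 nz w in auto)
  qed
qed

lemma cutoff_mass:
  assumes "cutoff_strip H Ht Hx Htt Htx Hxx b \<omega> \<psi> K A0 B0 s t0" and pos: "\<And>x. A0 < x \<Longrightarrow> x < B0 \<Longrightarrow> 0 < \<omega> x" and AB: "A0 < B0"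
  shows "smean s t0 (\<lambda>t x. \<omega> (E t x) * J t x) = K / 2"
proof -
  interpret C: cutoff_strip H Ht Hx Htt Htx Hxx b \<omega> \<psi> K A0 B0 s t0 by fact
  note st = C.st
  have s: "0 < s" "s < b" using st by auto
  obtain N where N: "N \<in> {-1, 0, 1 :: real}" "cmean (\<lambda>x. Hx s x / H s x) = \<i> * of_real N" using wind[OF s] by blast
  have c: "strip_cont b (\<lambda>t x. \<omega> (E t x) * J t x)" by (intro strip_cont_intros C.\<omega>_cont J_cont)
  have "smean s t0 (\<lambda>t x. complex_of_real (\<omega> (E t x) * J t x)) = of_real K / (2 * \<i>) * cmean (\<lambda>x. Hx s x / H s x)"
    using C.omega_J_power[of 0] by simp
  then have "complex_of_real (smean s t0 (\<lambda>t x. \<omega> (E t x) * J t x)) = of_real (K * N / 2)"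
    unfolding smean_linear[OF st bounded_linear_of_real c] N(2) by (simp add: complex_eq_iff)
  then have eq: "smean s t0 (\<lambda>t x. \<omega> (E t x) * J t x) = K * N / 2" by (simp only: of_real_eq_iff)
  have nn: "0 \<le> \<omega> (E t x) * J t x" if "0 < t" "t < b" for t x
    using C.\<omega>(2) jac[OF that] by (simp add: less_imp_le)
  have "smean s t0 (\<lambda>t x. \<omega> (E t x) * J t x) \<ge> smean s t0 (\<lambda>t x. 0)"
    by (rule smean_mono[OF st strip_cont_const c]) (use nn st in auto)
  then have ge: "smean s t0 (\<lambda>t x. \<omega> (E t x) * J t x) \<ge> 0" by (simp add: smean_def)
  have "smean s t0 (\<lambda>t x. \<omega> (E t x) * J t x) \<noteq> 0"
  proof
    assume 0: "smean s t0 (\<lambda>t x. \<omega> (E t x) * J t x) = 0"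
    have "continuous_on {s..t0} (\<lambda>t. E t 0)"
      by (rule continuous_on_subset[OF strip_cont_vslice[OF E_cont]]) (use st in auto)
    \<comment> \<open>This point excludes the winding number 0: there \<omega>(E) and J are both
      positive, whereas a vanishing integral of a nonnegative continuous function would make their
      product zero.\<close>
    then obtain t1 where t1: "s \<le> t1" "t1 \<le> t0" "E t1 0 = (A0 + B0) / 2"
      using IVT'[of "\<lambda>t. E t 0" s "(A0 + B0) / 2" t0] C.inner[of 0] C.outer[of 0] AB st by auto
    have t1': "0 < t1" "t1 < b" using t1 st by auto
    have cc: "continuous_on {s..t0} (\<lambda>t. cmean (\<lambda>x. \<omega> (E t x) * J t x))"
      by (rule continuous_on_subset[OF cmean_strip_cont[OF c]]) (use st in auto)
    have cnn: "0 \<le> cmean (\<lambda>x. \<omega> (E t x) * J t x)" if "t \<in> {s..t0}" for t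
      by (rule cmean_nonneg[OF strip_cont_slice[OF c]]) (use that st nn in auto)
    have "s < t0"
    proof (rule ccontr)
      assume "\<not> s < t0"
      then have "s = t0" using st by simp
      then show False using C.inner[of 0] C.outer[of 0] AB by simp
    qed
    then have "cmean (\<lambda>x. \<omega> (E t1 x) * J t1 x) = 0"
      using integral_eq_0_iff[OF cc] cnn 0 t1 unfolding smean_def by auto
    then have "\<omega> (E t1 0) * J t1 0 = 0"
      by (intro cmean_eq_0D[OF strip_cont_slice[OF c t1'] nn[OF t1']]) auto
    moreover have "\<omega> (E t1 0) > 0" using pos AB t1 by simp
    ultimately show False using jac[OF t1', of 0] by simp
  qed
  with ge have "smean s t0 (\<lambda>t x. \<omega> (E t x) * J t x) > 0" by (rule order.not_eq_order_implies_strict[OF not_sym, rotated])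
  then have "K * N / 2 > 0" unfolding eq .
  then have "N = 1" using N(1) C.K by (auto simp: zero_less_mult_iff)
  then show ?thesis using eq by simp
qed

text \<open>The integral form of the sum of n |f_n|^2 (see \<open>parseval_A\<close>), which is the
  shape in which Green's formula delivers it.\<close>

definition A where "A t = Re (\<i> * cmean (\<lambda>x. H t x * cnj (Hx t x)))"

lemma J_le: "2 * J t x \<le> (cmod (Ht t x))\<^sup>2 + (cmod (Hx t x))\<^sup>2"
proof -
  have "J t x \<le> cmod (cnj (Ht t x) * Hx t x)" unfolding J_def by (rule abs_Im_le_cmod[THEN order_trans[OF abs_ge_self]])
  also have "\<dots> = cmod (Ht t x) * cmod (Hx t x)" by (simp add: norm_mult)
  finally show ?thesis using sum_squares_bound[of "cmod (Ht t x)" "cmod (Hx t x)"] by simp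
qed

lemma smean_D: "0 < s \<Longrightarrow> s \<le> t \<Longrightarrow> t < b \<Longrightarrow> smean s t (\<lambda>t x. (cmod (Ht t x))\<^sup>2 + (cmod (Hx t x))\<^sup>2) = (U1 t - U1 s) / 2"
  using integral_D[of s t] unfolding smean_def D_def[abs_def] .

text \<open>Green's formula with G = H reads K A = 2 int \<omega> J |H|^2 - 2 int \<psi> J. In the
  first integral |H| > 1 leaves at least the mass K / 2; the second term is at most K times the
  Dirichlet energy of the strip, by \<open>J_le\<close> and \<psi> \<le> K.\<close>

lemma A_lower_cutoff:
  assumes "cutoff_strip H Ht Hx Htt Htx Hxx b \<omega> \<psi> K A0 B0 s t0" and pos: "\<And>x. A0 < x \<Longrightarrow> x < B0 \<Longrightarrow> 0 < \<omega> x" and AB: "A0 < B0"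
  shows "A s \<ge> 1 - (U1 t0 - U1 s) / 2"
proof -
  interpret C: cutoff_strip H Ht Hx Htt Htx Hxx b \<omega> \<psi> K A0 B0 s t0 by fact
  note st = C.st and mass = cutoff_mass[OF assms]
  have p: "0 < t \<and> t < b" if "s \<le> t" "t \<le> t0" for t using that st by auto
  have "K * A s = 2 * smean s t0 (\<lambda>t x. \<omega> (E t x) * J t x * Re (cnj (H t x) * H t x))
      - smean s t0 (\<lambda>t x. \<psi> (E t x) * Re (\<i> * (Ht t x * cnj (Hx t x) - Hx t x * cnj (Ht t x))))"
    unfolding A_def by (rule C.green_G[OF dHt dHx sc(1-3) per0(1)])
  also have "\<dots> \<ge> 2 * smean s t0 (\<lambda>t x. \<omega> (E t x) * J t x) - smean s t0 (\<lambda>t x. K * ((cmod (Ht t x))\<^sup>2 + (cmod (Hx t x))\<^sup>2))"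
  proof (intro diff_mono mult_left_mono smean_mono[OF st])
    fix t x assume "s \<le> t" "t \<le> t0"
    then have t: "0 < t" "t < b" using p by auto
    have "0 \<le> \<omega> (E t x) * J t x" using C.\<omega>(2) jac[OF t, of x] by simp
    then have "\<omega> (E t x) * J t x * 1 \<le> \<omega> (E t x) * J t x * E t x"
      using E_gt1[OF t, of x] by (intro mult_left_mono) auto
    then show "\<omega> (E t x) * J t x \<le> \<omega> (E t x) * J t x * Re (cnj (H t x) * H t x)"
      unfolding Re_cnj_mult by (simp add: E_def)
    have "Re (\<i> * (Ht t x * cnj (Hx t x) - Hx t x * cnj (Ht t x))) = 2 * J t x"
      by (simp add: J_def algebra_simps)
    moreover have "\<psi> (E t x) * (2 * J t x) \<le> K * (2 * J t x)"
      using C.\<psi>(5) C.E_pos[OF t] jac[OF t, of x] by (intro mult_right_mono) auto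
    moreover have "K * (2 * J t x) \<le> K * ((cmod (Ht t x))\<^sup>2 + (cmod (Hx t x))\<^sup>2)"
      using C.K J_le by (intro mult_left_mono) auto
    ultimately show "\<psi> (E t x) * Re (\<i> * (Ht t x * cnj (Hx t x) - Hx t x * cnj (Ht t x))) \<le> K * ((cmod (Ht t x))\<^sup>2 + (cmod (Hx t x))\<^sup>2)"
      by simp
  qed (auto intro!: strip_cont_intros sc C.\<omega>_cont C.\<psi>_cont J_cont)
  also have "2 * smean s t0 (\<lambda>t x. \<omega> (E t x) * J t x) - smean s t0 (\<lambda>t x. K * ((cmod (Ht t x))\<^sup>2 + (cmod (Hx t x))\<^sup>2)) = K * (1 - (U1 t0 - U1 s) / 2)"
  proof -
    have "smean s t0 (\<lambda>t x. K * ((cmod (Ht t x))\<^sup>2 + (cmod (Hx t x))\<^sup>2)) = K * ((U1 t0 - U1 s) / 2)"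
      by (simp only: smean_rmult[OF st] smean_D[OF st])
    from arg_cong2[where f = "\<lambda>a b. 2 * a - b", OF mass this] show ?thesis by (simp only:) (simp add: algebra_simps)
  qed
  finally show ?thesis using C.K by simp
qed

lemma A_lower: "e > 0 \<Longrightarrow> \<exists>d>0. \<forall>s. 0 < s \<longrightarrow> s < d \<longrightarrow> s < b \<longrightarrow> 1 - e \<le> A s"
proof -
  assume e: "e > 0"
  obtain t0 where t0: "0 < t0" "t0 < b" "\<And>t s. 0 < s \<Longrightarrow> s \<le> t \<Longrightarrow> t \<le> t0 \<Longrightarrow> U1 t - U1 s \<le> 2 * e"
    using U1_small_gap[of "2 * e"] e by auto
  from exists_cutoff[OF t0(1,2)]
  obtain \<tau>0 A0 B0 M \<omega> \<psi> K where c: "0 < \<tau>0" "\<tau>0 < t0" "A0 < B0"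
    "\<And>s. 0 < s \<Longrightarrow> s < \<tau>0 \<Longrightarrow> cutoff_strip H Ht Hx Htt Htx Hxx b \<omega> \<psi> K A0 B0 s t0"
    "\<And>x. A0 < x \<Longrightarrow> x < B0 \<Longrightarrow> 0 < \<omega> x" by metis
  have "1 - e \<le> A s" if s: "0 < s" "s < \<tau>0" for s
    using A_lower_cutoff[OF c(4)[OF s] c(5,3)] t0(3)[of s t0] s c(2) by (simp add: field_simps)
  then show ?thesis using c(1) by blast
qed

end

section \<open>The modified Poisson remainder\<close>

text \<open>km m \<sigma> = sinh(m \<sigma>) / (m sinh \<sigma>), written as an exponential sum to be regular at \<sigma> = 0; the value at m = 0 is 1
  instead of the limit \<sigma> / sinh \<sigma>.\<close>

definition km :: "nat \<Rightarrow> real \<Rightarrow> real" where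
  "km m \<sigma> = (if m = 0 then 1 else (\<Sum>j<m. exp ((real m - 1 - 2 * real j) * \<sigma>)) / m)"

definition km' :: "nat \<Rightarrow> real \<Rightarrow> real" where
  "km' m \<sigma> = (if m = 0 then 0 else (\<Sum>j<m. (real m - 1 - 2 * real j) * exp ((real m - 1 - 2 * real j) * \<sigma>)) / m)"

lemma km_deriv: "(km m has_real_derivative km' m \<sigma>) (at \<sigma>)"
  unfolding km_def[abs_def] km'_def by (cases "m = 0") (auto intro!: derivative_eq_intros simp: mult_ac)

lemma km_cont: "continuous_on UNIV (km m)" "continuous_on UNIV (km' m)"
  unfolding km_def[abs_def] km'_def[abs_def] by (cases "m = 0"; auto intro!: continuous_intros)+

lemma km_zero: "km m 0 = 1"
  by (simp add: km_def)

text \<open>Multiplication by 2 sinh \<sigma> telescopes the exponential sum. For m = 0 the two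
  sides would be sinh \<sigma> and \<sigma>; their difference is the correction term in
  \<open>poisson_remainder\<close>.\<close>

lemma km_sinh: "m \<ge> 1 \<Longrightarrow> km m \<sigma> * sinh \<sigma> = hs (real m) \<sigma>"
proof -
  assume m: "m \<ge> 1"
  define a where "a = (\<lambda>j. exp ((real m - 2 * real j) * \<sigma>))"
  have "exp ((real m - 1 - 2 * real j) * \<sigma>) * sinh \<sigma> = (a j - a (Suc j)) / 2" for j
  proof -
    have 1: "exp ((real m - 1 - 2 * real j) * \<sigma>) * exp \<sigma> = a j"
      "exp ((real m - 1 - 2 * real j) * \<sigma>) * exp (- \<sigma>) = a (Suc j)"
      unfolding a_def exp_add[symmetric] by (simp_all add: algebra_simps)
    have "exp ((real m - 1 - 2 * real j) * \<sigma>) * sinh \<sigma> = (exp ((real m - 1 - 2 * real j) * \<sigma>) * exp \<sigma> - exp ((real m - 1 - 2 * real j) * \<sigma>) * exp (- \<sigma>)) / 2"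
      by (simp add: sinh_field_def right_diff_distrib)
    then show ?thesis unfolding 1 .
  qed
  then have "(\<Sum>j<m. exp ((real m - 1 - 2 * real j) * \<sigma>)) * sinh \<sigma> = (\<Sum>j<m. (a j - a (Suc j)) / 2)"
    unfolding sum_distrib_right by (rule sum.cong[OF refl])
  also have "\<dots> = (a 0 - a m) / 2"
    unfolding sum_divide_distrib[symmetric] sum_lessThan_telescope' ..
  also have "\<dots> = sinh (real m * \<sigma>)" by (simp add: a_def sinh_field_def)
  finally show ?thesis using m by (simp add: km_def hs_def)
qed

lemma km_bound:
  assumes "\<sigma> \<ge> 0"
  shows "\<bar>km m \<sigma>\<bar> \<le> exp (real m * \<sigma>)" "\<bar>km' m \<sigma>\<bar> \<le> real m * exp (real m * \<sigma>)"
proof -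
  have e: "exp ((real m - 1 - 2 * real j) * \<sigma>) \<le> exp (real m * \<sigma>)" for j
    using assms by (intro exp_le_cancel_iff[THEN iffD2] mult_right_mono) auto
  have ab: "\<bar>real m - 1 - 2 * real j\<bar> \<le> real m" if "j < m" for j using that by linarith
  show "\<bar>km m \<sigma>\<bar> \<le> exp (real m * \<sigma>)"
  proof (cases "m = 0")
    case False
    have "\<bar>\<Sum>j<m. exp ((real m - 1 - 2 * real j) * \<sigma>)\<bar> \<le> (\<Sum>j<m. exp (real m * \<sigma>))"
      by (rule order_trans[OF sum_abs sum_mono]) (use e in simp)
    then show ?thesis using False by (simp add: km_def pos_divide_le_eq mult.commute)
  qed (simp add: km_def)
  show "\<bar>km' m \<sigma>\<bar> \<le> real m * exp (real m * \<sigma>)"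
  proof (cases "m = 0")
    case False
    have "\<bar>\<Sum>j<m. (real m - 1 - 2 * real j) * exp ((real m - 1 - 2 * real j) * \<sigma>)\<bar> \<le> (\<Sum>j<m. real m * exp (real m * \<sigma>))"
    proof (rule order_trans[OF sum_abs sum_mono])
      fix j assume "j \<in> {..<m}"
      then show "\<bar>(real m - 1 - 2 * real j) * exp ((real m - 1 - 2 * real j) * \<sigma>)\<bar> \<le> real m * exp (real m * \<sigma>)"
        unfolding abs_mult using ab[of j] e[of j] by (intro mult_mono) auto
    qed
    then show ?thesis using False by (simp add: km'_def pos_divide_le_eq mult_ac)
  qed (simp add: km'_def)
qed

text \<open>exp v \<ge> v^2 / 2 at v = c (1 + k) / 2: one half of the exponential decay absorbs the
  square, the other half stays as a geometric factor.\<close>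

lemma poly_exp_bound:
  assumes c: "c > (0::real)"
  shows "(1 + real k)\<^sup>2 * exp (- real k * c) \<le> 8 / c\<^sup>2 * exp (c / 2) * exp (- c / 2) ^ k"
proof -
  define u where "u = 1 + real k"
  have u: "u > 0" by (simp add: u_def)
  have "1 + c * u / 2 + (c * u / 2)\<^sup>2 / 2 \<le> exp (c * u / 2)"
    using c u by (intro exp_lower_Taylor_quadratic) auto
  moreover have "1 + c * u / 2 \<ge> 0" using c u by simp
  ultimately have "(c * u / 2)\<^sup>2 / 2 \<le> exp (c * u / 2)" by linarith
  then have "c\<^sup>2 * u\<^sup>2 \<le> 8 * exp (c * u / 2)" by (simp add: power_mult_distrib power_divide)
  then have "u\<^sup>2 \<le> 8 / c\<^sup>2 * exp (c * u / 2)" using c by (simp add: field_simps)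
  then have "(1 + real k)\<^sup>2 \<le> 8 / c\<^sup>2 * exp (c * (1 + real k) / 2)" by (simp only: u_def)
  then have "(1 + real k)\<^sup>2 * exp (- real k * c) \<le> 8 / c\<^sup>2 * exp (c * (1 + real k) / 2) * exp (- real k * c)"
    by (intro mult_right_mono) auto
  also have "\<dots> = 8 / c\<^sup>2 * (exp (c * (1 + real k) / 2) * exp (- real k * c))" by simp
  also have "exp (c * (1 + real k) / 2) * exp (- real k * c) = exp (c / 2) * exp (- c / 2) ^ k"
    unfolding exp_of_nat_mult[symmetric] exp_add[symmetric] by (simp add: field_simps)
  finally show ?thesis by simp
qed

lemma sym_sum_bound:
  fixes a :: "int \<Rightarrow> complex"
  assumes a: "\<And>n. cmod (a n) \<le> C * q ^ nat \<bar>n\<bar>" and q: "0 \<le> q" "q < 1" and C: "0 \<le> C"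
  shows "(\<Sum>n\<in>{-int N..int N}. cmod (a n)) \<le> 2 * C / (1 - q)"
proof -
  have "(\<Sum>n\<in>{-int N..int N}. cmod (a n)) \<le> (\<Sum>k<Suc N. 2 * C * q ^ k)"
    unfolding sum_int_symmetric
  proof (rule sum_mono)
    fix k :: nat
    have "cmod (a 0) \<le> 2 * C" using a[of 0] C by simp
    then show "(if k = 0 then cmod (a 0) else cmod (a (int k)) + cmod (a (- int k))) \<le> 2 * C * q ^ k"
      using a[of "int k"] a[of "- int k"] by simp
  qed
  also have "\<dots> = 2 * C * (\<Sum>k<Suc N. q ^ k)" by (simp only: sum_distrib_left)
  also have "(\<Sum>k<Suc N. q ^ k) \<le> 1 / (1 - q)"
  proof -
    have "(\<Sum>k<Suc N. q ^ k) = (1 - q ^ Suc N) / (1 - q)" using geometric_sum[of q "Suc N"] q by (simp add: field_simps)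
    also have "\<dots> \<le> 1 / (1 - q)" using q by (intro divide_right_mono) auto
    finally show ?thesis .
  qed
  finally show ?thesis using C by (simp add: mult_left_mono)
qed

lemma sym_sum_tail:
  fixes a :: "int \<Rightarrow> complex"
  assumes a: "\<And>n. cmod (a n) \<le> C * q ^ nat \<bar>n\<bar>" and q: "0 \<le> q" "q < 1" and C: "0 \<le> C"
    and L: "(\<lambda>N. \<Sum>n\<in>{-int N..int N}. a n) \<longlonglongrightarrow> L"
  shows "cmod (L - (\<Sum>n\<in>{-int N..int N}. a n)) \<le> 2 * C * q ^ Suc N / (1 - q)"
proof -
  define S where "S = (\<lambda>N. \<Sum>n\<in>{-int N..int N}. a n)"
  have "cmod (S (N + j) - S N) \<le> 2 * C * q ^ Suc N * (\<Sum>i<j. q ^ i)" for j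
  proof (induction j)
    case (Suc j)
    have "S (N + Suc j) = S (N + j) + (a (int (N + Suc j)) + a (- int (N + Suc j)))"
      unfolding S_def sum_int_symmetric by simp
    then have "S (N + Suc j) - S N = (S (N + j) - S N) + (a (int (N + Suc j)) + a (- int (N + Suc j)))" by simp
    also have "cmod \<dots> \<le> cmod (S (N + j) - S N) + (cmod (a (int (N + Suc j))) + cmod (a (- int (N + Suc j))))"
      by (intro order_trans[OF norm_triangle_ineq] add_mono norm_triangle_ineq order_refl)
    also have "\<dots> \<le> 2 * C * q ^ Suc N * (\<Sum>i<j. q ^ i) + (C * q ^ (N + Suc j) + C * q ^ (N + Suc j))"
      using a[of "int (N + Suc j)"] a[of "- int (N + Suc j)"]
      by (intro add_mono Suc) (simp_all del: of_nat_Suc of_nat_add)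
    also have "\<dots> = 2 * C * q ^ Suc N * (\<Sum>i<Suc j. q ^ i)" by (simp add: power_add algebra_simps)
    finally show ?case .
  qed simp
  also have "2 * C * q ^ Suc N * (\<Sum>i<j. q ^ i) \<le> 2 * C * q ^ Suc N / (1 - q)" for j
  proof -
    have "(\<Sum>i<j. q ^ i) = (1 - q ^ j) / (1 - q)" using geometric_sum[of q j] q by (simp add: field_simps)
    also have "\<dots> \<le> 1 / (1 - q)" using q by (intro divide_right_mono) auto
    finally have "2 * C * q ^ Suc N * (\<Sum>i<j. q ^ i) \<le> 2 * C * q ^ Suc N * (1 / (1 - q))"
      using C q by (intro mult_left_mono) auto
    then show ?thesis by simp
  qed
  finally have h: "cmod (S (N + j) - S N) \<le> 2 * C * q ^ Suc N / (1 - q)" for j .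
  have "cmod (S (j + N) - S N) \<le> 2 * C * q ^ Suc N / (1 - q)" for j
    using h[of j] by (simp only: add.commute[of j N])
  moreover have "(\<lambda>j. cmod (S (j + N) - S N)) \<longlonglongrightarrow> cmod (L - S N)"
    using L unfolding S_def[symmetric] by (intro tendsto_intros LIMSEQ_ignore_initial_segment)
  ultimately have "cmod (L - S N) \<le> 2 * C * q ^ Suc N / (1 - q)"
    by (intro LIMSEQ_le_const2[of _ "cmod (L - S N)"]) blast+
  then show ?thesis by (simp only: S_def)
qed

section \<open>The remainder as a trigonometric polynomial, with bounds uniform in s\<close>

context harmonic_strip
begin

text \<open>Mode by mode the t-derivative, at t = s, of the difference between H and the Poisson
  extension of H(s, -), whose modes are f_n(s) exp(-|n| (t - s)).\<close>

definition g where "g n s = f1 n s + of_real (real_of_int \<bar>n\<bar>) * f n s"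

text \<open>Up to the mode 0, the limit of sinh(t - s) G for large N is the difference of H and the Poisson integral of
  H(s, -).\<close>

definition G where "G s N t x = (\<Sum>n\<in>{-int N..int N}. g n s * (of_real (km (nat \<bar>n\<bar>) (t - s)) * cis (of_int n * x)))"
definition Gt where "Gt s N t x = (\<Sum>n\<in>{-int N..int N}. g n s * (of_real (km' (nat \<bar>n\<bar>) (t - s)) * cis (of_int n * x)))"
definition Gx where "Gx s N t x = (\<Sum>n\<in>{-int N..int N}. g n s * (of_real (km (nat \<bar>n\<bar>) (t - s)) * (\<i> * of_int n * cis (of_int n * x))))"

lemma G_cont: "strip_cont b (G s N)" "strip_cont b (Gt s N)" "strip_cont b (Gx s N)"
proof -
  have k: "strip_cont b (\<lambda>t x. complex_of_real (km m (t - s)))" "strip_cont b (\<lambda>t x. complex_of_real (km' m (t - s)))" for m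
    by (rule strip_cont_fst, intro continuous_intros continuous_on_compose2[OF km_cont(1)] continuous_on_compose2[OF km_cont(2)], auto)+
  have c: "strip_cont b (\<lambda>t x. cis (of_int n * x))" for n by (rule strip_cont_snd) (intro continuous_intros)
  show "strip_cont b (G s N)" "strip_cont b (Gt s N)" "strip_cont b (Gx s N)"
    unfolding G_def[abs_def] Gt_def[abs_def] Gx_def[abs_def]
    by (intro strip_cont_sum strip_cont_mult strip_cont_const k c finite_atLeastAtMost_int)+
qed

lemma G_deriv_t: "((\<lambda>t. G s N t x) has_vector_derivative Gt s N t x) (at t)"
proof -
  have "((\<lambda>t. of_real (km m (t - s)) * z) has_vector_derivative of_real (km' m (t - s)) * z) (at t)" for m and z :: complex
  proof (rule bounded_linear.has_vector_derivative[OF bounded_linear_mult_left], rule has_vector_derivative_of_real)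
    have "((\<lambda>t. km m (t - s)) has_real_derivative km' m (t - s) * 1) (at t)"
      by (rule DERIV_chain2[OF km_deriv]) (auto intro!: derivative_eq_intros)
    then show "((\<lambda>t. km m (t - s)) has_real_derivative km' m (t - s)) (at t)" by simp
  qed
  then show ?thesis unfolding G_def Gt_def
    by (intro has_vector_derivative_sum bounded_linear.has_vector_derivative[OF bounded_linear_mult_right])
qed

lemma G_deriv_x: "((\<lambda>x. G s N t x) has_vector_derivative Gx s N t x) (at x)"
  unfolding G_def Gx_def
  by (intro has_vector_derivative_sum bounded_linear.has_vector_derivative[OF bounded_linear_mult_right] has_vector_derivative_cis[of "of_int n" for n, simplified])

lemma G_per: "G s N t (2 * pi) = G s N t 0"
  unfolding G_def by (simp only: cis_of_int_2pi mult_zero_right cis_zero)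

text \<open>Kept as a partial sum, so that \<open>G\<close> is a trigonometric polynomial to which
  Green's formula applies; the lower bounds are proved for all large N.\<close>

definition X where "X N s = (\<Sum>n\<in>{-int N..int N}. of_int n * Re (g n s * cnj (f n s)))"

lemma X_eq:
  assumes s: "0 < s" "s < b"
  shows "Re (\<i> * cmean (\<lambda>x. G s N s x * cnj (Hx s x))) = X N s"
proof -
  have "cmean (\<lambda>x. G s N s x * cnj (Hx s x)) = (\<Sum>n\<in>{-int N..int N}. cmean (\<lambda>x. g n s * cis (of_int n * x) * cnj (Hx s x)))"
    unfolding G_def by (subst cmean_sum[symmetric])
      (auto intro!: continuous_intros slice s simp: km_zero sum_distrib_right)
  also have "\<dots> = (\<Sum>n\<in>{-int N..int N}. g n s * cnj (\<i> * of_int n * f n s))"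
    by (simp only: cmean_trig_cnj[OF slice(3)[OF s]] fcoef_Hx[OF s])
  finally have "\<i> * cmean (\<lambda>x. G s N s x * cnj (Hx s x)) = (\<Sum>n\<in>{-int N..int N}. of_int n * (g n s * cnj (f n s)))"
    by (simp add: sum_distrib_left mult_ac)
  then show ?thesis unfolding X_def by (simp add: Re_sum)
qed

lemma fcoef_bound: "continuous_on UNIV u \<Longrightarrow> cmod (fcoef u n) \<le> sqrt (cmean (\<lambda>x. (cmod (u x))\<^sup>2))"
  using bessel[of u "{n}"] by (intro real_le_rsqrt) simp

definition K2 where "K2 t = sqrt (U t) + sqrt (D t)"

lemma f_bound: "0 < t \<Longrightarrow> t < b \<Longrightarrow> cmod (f n t) \<le> sqrt (U t)"
  unfolding f_def U_def by (intro fcoef_bound slice)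

lemma U_nonneg: "0 < t \<Longrightarrow> t < b \<Longrightarrow> 0 \<le> U t"
  unfolding U_def by (intro cmean_nonneg continuous_intros slice) auto

text \<open>\<open>f1_shift\<close> transports the estimate to the reference time t, where Bessel's
  inequality bounds the coefficients of H and H_t; the constant does not degenerate as s tends to
  0.\<close>

lemma g_bound:
  assumes "0 < s" "s < b" "0 < t" "t < b"
  shows "cmod (g n s) \<le> K2 t * (1 + real_of_int \<bar>n\<bar>) * exp (- real_of_int \<bar>n\<bar> * (t - s))"
proof -
  define m where "m = real_of_int \<bar>n\<bar>"
  have m: "m \<ge> 0" by (simp add: m_def)
  have "g n s = of_real (exp (- m * (t - s))) * (f1 n t + of_real m * f n t)"
    using f1_shift[OF assms, of n] unfolding g_def m_def by simp
  then have "cmod (g n s) = exp (- m * (t - s)) * cmod (f1 n t + of_real m * f n t)"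
    by (simp add: norm_mult)
  also have "cmod (f1 n t + of_real m * f n t) \<le> K2 t * (1 + m)"
  proof -
    have 1: "cmod (f1 n t) \<le> sqrt (D t)"
    proof -
      have "cmean (\<lambda>x. (cmod (Ht t x))\<^sup>2) \<le> D t" unfolding D_def
        by (intro cmean_mono continuous_intros slice assms) auto
      then show ?thesis using fcoef_bound[OF slice(2)[OF assms(3,4)], of n] unfolding f1_def
        by (meson order_trans real_sqrt_le_iff)
    qed
    have "cmod (f1 n t + of_real m * f n t) \<le> cmod (f1 n t) + m * cmod (f n t)"
      using m by (intro order_trans[OF norm_triangle_ineq]) (simp add: norm_mult)
    also have "\<dots> \<le> sqrt (D t) + m * sqrt (U t)" using 1 f_bound[OF assms(3,4), of n] m by (intro add_mono mult_left_mono)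
    also have "\<dots> \<le> sqrt (D t) + m * sqrt (U t) + (sqrt (U t) + m * sqrt (D t))"
      using m U_nonneg[OF assms(3,4)] D_nonneg[OF assms(3,4)] by simp
    also have "\<dots> = K2 t * (1 + m)" by (simp add: K2_def algebra_simps)
    finally show ?thesis .
  qed
  finally show ?thesis by (simp add: m_def mult_ac)
qed

text \<open>\<open>K3\<close> and \<open>qq\<close> are the constant and the ratio of the geometric
  majorant in \<open>term_bound\<close>: \<open>poly_exp_bound\<close> with c = t / 2. They depend
  on the reference time and not on s.\<close>

definition K3 where "K3 t = K2 t * (8 / (t/2)\<^sup>2 * exp (t/4))"
definition qq :: "real \<Rightarrow> real" where "qq t = exp (- t / 4)"

lemma K3_nonneg: "0 < t \<Longrightarrow> t < b \<Longrightarrow> 0 \<le> K3 t" "0 < t \<Longrightarrow> t < b \<Longrightarrow> 0 \<le> K2 t"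
  using U_nonneg[of t] D_nonneg[of t] by (auto simp: K3_def K2_def)

lemma qq: "0 < t \<Longrightarrow> 0 \<le> qq t" "0 < t \<Longrightarrow> qq t < 1"
  by (auto simp: qq_def)

text \<open>The decay exp(-m (t2 - s)) of g outweighs the growth exp(m (t - s)) of the multiplier:
  what remains is exp(-m (t2 - t)), at most exp(-m t2 / 2) because t \<le> t2 / 2. The polynomial
  factor is quadratic, one power from g and one from y.\<close>

lemma term_bound:
  assumes s: "0 < s" "s \<le> t" "t \<le> t2 / 2" "t2 < b" and y: "cmod y \<le> (1 + real_of_int \<bar>n\<bar>) * exp (real_of_int \<bar>n\<bar> * (t - s))"
  shows "cmod (g n s * y) \<le> K3 t2 * qq t2 ^ nat \<bar>n\<bar>"
proof -
  define m where "m = nat \<bar>n\<bar>"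
  have m: "real_of_int \<bar>n\<bar> = real m" by (simp add: m_def)
  have t2: "0 < t2" "0 < t2 / 2" using s by auto
  have "cmod (g n s * y) \<le> (K2 t2 * (1 + real m) * exp (- real m * (t2 - s))) * ((1 + real m) * exp (real m * (t - s)))"
    unfolding norm_mult using g_bound[of s t2 n] y s t2 K3_nonneg(2)[of t2] m
    by (intro mult_mono) auto
  also have "\<dots> = K2 t2 * ((1 + real m)\<^sup>2 * (exp (- real m * (t2 - s)) * exp (real m * (t - s))))"
    by (simp add: power2_eq_square)
  also have "exp (- real m * (t2 - s)) * exp (real m * (t - s)) = exp (- real m * (t2 - t))"
    unfolding exp_add[symmetric] by (simp add: algebra_simps)
  also have "K2 t2 * ((1 + real m)\<^sup>2 * exp (- real m * (t2 - t))) \<le> K2 t2 * ((1 + real m)\<^sup>2 * exp (- real m * (t2 / 2)))"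
  proof -
    have "real m * (t2 / 2) \<le> real m * (t2 - t)" using s by (intro mult_left_mono) auto
    then have "exp (- real m * (t2 - t)) \<le> exp (- real m * (t2 / 2))" by simp
    then show ?thesis using s t2 K3_nonneg(2)[of t2] by (intro mult_left_mono) auto
  qed
  also have "\<dots> \<le> K2 t2 * (8 / (t2 / 2)\<^sup>2 * exp (t2 / 2 / 2) * exp (- (t2 / 2) / 2) ^ m)"
    using poly_exp_bound[OF t2(2)] K3_nonneg(2)[of t2] s t2 by (intro mult_left_mono) auto
  also have "\<dots> = K3 t2 * qq t2 ^ nat \<bar>n\<bar>" by (simp add: K3_def qq_def m_def)
  finally show ?thesis .
qed

lemma G_deriv_bounds:
  assumes s: "0 < s" "s \<le> t" "t \<le> t2 / 2" "t2 < b"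
  shows "cmod (Gt s N t x) \<le> 2 * K3 t2 / (1 - qq t2)" "cmod (Gx s N t x) \<le> 2 * K3 t2 / (1 - qq t2)"
proof -
  have t2: "0 < t2" using s by auto
  have m: "real (nat \<bar>n\<bar>) = real_of_int \<bar>n\<bar>" for n by simp
  have \<sigma>: "t - s \<ge> 0" using s by simp
  have mm: "x \<le> (1 + real_of_int \<bar>n\<bar>) * e" if "x \<le> real_of_int \<bar>n\<bar> * e" "e \<ge> 0" for x e n
    using that by (simp add: algebra_simps)
  have 1: "cmod (g n s * (of_real (km' (nat \<bar>n\<bar>) (t - s)) * cis (of_int n * x))) \<le> K3 t2 * qq t2 ^ nat \<bar>n\<bar>" for n
    by (rule term_bound[OF s]) (use mm[OF km_bound(2)[OF \<sigma>, of "nat \<bar>n\<bar>", unfolded m]] in \<open>simp add: norm_mult\<close>)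
  have 2: "cmod (g n s * (of_real (km (nat \<bar>n\<bar>) (t - s)) * (\<i> * of_int n * cis (of_int n * x)))) \<le> K3 t2 * qq t2 ^ nat \<bar>n\<bar>" for n
  proof (rule term_bound[OF s])
    have "\<bar>km (nat \<bar>n\<bar>) (t - s)\<bar> * real_of_int \<bar>n\<bar> \<le> exp (real_of_int \<bar>n\<bar> * (t - s)) * real_of_int \<bar>n\<bar>"
      by (intro mult_right_mono km_bound(1)[OF \<sigma>, of "nat \<bar>n\<bar>", unfolded m]) auto
    then have "\<bar>km (nat \<bar>n\<bar>) (t - s)\<bar> * real_of_int \<bar>n\<bar> \<le> (1 + real_of_int \<bar>n\<bar>) * exp (real_of_int \<bar>n\<bar> * (t - s))"
      by (intro mm) (auto simp: mult.commute)
    then show "cmod (of_real (km (nat \<bar>n\<bar>) (t - s)) * (\<i> * of_int n * cis (of_int n * x))) \<le> (1 + real_of_int \<bar>n\<bar>) * exp (real_of_int \<bar>n\<bar> * (t - s))"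
      by (simp add: norm_mult)
  qed
  show "cmod (Gt s N t x) \<le> 2 * K3 t2 / (1 - qq t2)"
    unfolding Gt_def by (rule order_trans[OF norm_sum sym_sum_bound[OF 1 qq[OF t2] K3_nonneg(1)[OF t2 s(4)]]])
  show "cmod (Gx s N t x) \<le> 2 * K3 t2 / (1 - qq t2)"
    unfolding Gx_def by (rule order_trans[OF norm_sum sym_sum_bound[OF 2 qq[OF t2] K3_nonneg(1)[OF t2 s(4)]]])
qed

lemma hs_le: "\<sigma> \<ge> 0 \<Longrightarrow> m \<ge> 0 \<Longrightarrow> hs (real m) \<sigma> \<le> sinh \<sigma> * exp (real m * \<sigma>) \<and> 0 \<le> hs (real m) \<sigma>"
proof -
  assume \<sigma>: "\<sigma> \<ge> 0"
  show ?thesis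
  proof (cases "m = 0")
    case True
    then show ?thesis using x_le_sinh[OF \<sigma>] \<sigma> by (simp add: hs_def)
  next
    case False
    have "hs (real m) \<sigma> = km m \<sigma> * sinh \<sigma>" using km_sinh[of m \<sigma>] False by simp
    also have "\<dots> \<le> exp (real m * \<sigma>) * sinh \<sigma>"
      using km_bound(1)[OF \<sigma>, of m] \<sigma> by (intro mult_right_mono) auto
    finally show ?thesis using \<sigma> by (simp add: mult.commute) (simp add: hs_def)
  qed
qed

lemma f_shift_exp:
  fixes n :: int
  assumes "0 < s" "s < b" "0 < t" "t < b"
  shows "f n t = of_real (exp (- real_of_int \<bar>n\<bar> * (t - s))) * f n s + g n s * of_real (hs (real_of_int \<bar>n\<bar>) (t - s))"
proof -
  define m \<sigma> where "m = real_of_int \<bar>n\<bar>" and "\<sigma> = t - s"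
  have "cosh (m * \<sigma>) = exp (- m * \<sigma>) + m * hs m \<sigma>"
    using cosh_minus_sinh[of "m * \<sigma>"] by (simp add: hs_def)
  then have "complex_of_real (cosh (m * \<sigma>)) = of_real (exp (- m * \<sigma>)) + of_real m * of_real (hs m \<sigma>)"
    by (metis of_real_add of_real_mult)
  moreover have "g n s = f1 n s + of_real m * f n s" by (simp add: g_def m_def)
  ultimately show ?thesis
    using f_shift[OF assms, of n] unfolding m_def[symmetric] \<sigma>_def[symmetric] by (simp add: algebra_simps)
qed

text \<open>By \<open>f_shift_exp\<close> each mode of the difference is g_n(s) \<open>hs\<close>
  |n| \<sigma>, and \<open>hs\<close> is sinh \<sigma> times \<open>km\<close> except for n = 0,
  whence the correction with \<open>g 0 s\<close>. The majorant B provides the summability for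
  pointwise convergence at t.\<close>

lemma poisson_remainder:
  assumes s: "0 < s" "s < t" "t \<le> t2 / 2" "t2 < b"
  shows "(\<lambda>N. of_real (sinh (t - s)) * G s N t x - of_real (sinh (t - s) - (t - s)) * g 0 s)
    \<longlonglongrightarrow> H t x - cmean (\<lambda>y. of_real (poisson (t - s) (x - y)) * H s y)"
proof -
  define \<sigma> where "\<sigma> = t - s"
  have \<sigma>: "\<sigma> > 0" using s by (simp add: \<sigma>_def)
  have sb: "0 < s" "s < b" and tb: "0 < t" "t < b" and t2: "0 < t2" using s by auto
  have m: "real (nat \<bar>n\<bar>) = real_of_int \<bar>n\<bar>" for n by simp
  define B where "B = (\<lambda>k. sqrt (U s) * exp (- \<sigma>) ^ k + sinh \<sigma> * K3 t2 * qq t2 ^ k)"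
  have fb: "cmod (fcoef (H t) n) \<le> B (nat \<bar>n\<bar>)" for n
  proof -
    define k where "k = nat \<bar>n\<bar>"
    have k: "real_of_int \<bar>n\<bar> = real k" by (simp add: k_def)
    have h: "hs (real k) \<sigma> \<le> sinh \<sigma> * exp (real k * \<sigma>)" "0 \<le> hs (real k) \<sigma>" using hs_le[of \<sigma> k] \<sigma> by auto
    have "cmod (g n s * of_real (hs (real k) \<sigma> / sinh \<sigma>)) \<le> K3 t2 * qq t2 ^ nat \<bar>n\<bar>"
    proof (rule term_bound[OF s(1) _ s(3,4)])
      have "hs (real k) \<sigma> / sinh \<sigma> \<le> exp (real k * \<sigma>)" using h \<sigma> by (simp add: pos_divide_le_eq mult.commute)
      also have "\<dots> \<le> (1 + real k) * exp (real k * \<sigma>)" by simp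
      finally show "cmod (complex_of_real (hs (real k) \<sigma> / sinh \<sigma>)) \<le> (1 + real_of_int \<bar>n\<bar>) * exp (real_of_int \<bar>n\<bar> * (t - s))"
        using h \<sigma> unfolding k \<sigma>_def[symmetric] norm_of_real by simp
    qed (use s in simp)
    then have "cmod (g n s * of_real (hs (real k) \<sigma>)) \<le> sinh \<sigma> * (K3 t2 * qq t2 ^ k)"
      using \<sigma> h by (simp add: norm_mult norm_divide k_def[symmetric] pos_divide_le_eq mult_ac)
    moreover have "cmod (of_real (exp (- real k * \<sigma>)) * f n s) \<le> exp (- real k * \<sigma>) * sqrt (U s)"
      using f_bound[OF sb, of n] by (simp add: norm_mult)
    moreover have "exp (- real k * \<sigma>) = exp (- \<sigma>) ^ k" by (simp add: exp_of_nat_mult[symmetric])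
    ultimately have "cmod (of_real (exp (- real k * \<sigma>)) * f n s + g n s * of_real (hs (real k) \<sigma>)) \<le> B k"
      unfolding B_def by (intro order_trans[OF norm_triangle_ineq]) (simp add: mult_ac)
    then show ?thesis using f_shift_exp[OF sb tb, of n] unfolding f_def[symmetric] k \<sigma>_def[symmetric] k_def[symmetric] by simp
  qed
  have "summable B" unfolding B_def
    using \<sigma> qq[OF t2] by (intro summable_add summable_mult summable_geometric) auto
  from fourier_pointwise[OF slice(1)[OF tb] per(1)[OF tb] fb this]
  have 1: "(\<lambda>N. \<Sum>n\<in>{-int N..int N}. f n t * cis (of_int n * x)) \<longlonglongrightarrow> H t x" by (simp add: f_def)
  have 2: "(\<lambda>N. \<Sum>n\<in>{-int N..int N}. of_real (exp (- real_of_int \<bar>n\<bar> * \<sigma>)) * f n s * cis (of_int n * x))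
     \<longlonglongrightarrow> cmean (\<lambda>y. of_real (poisson \<sigma> (x - y)) * H s y)"
    using poisson_conv[OF \<sigma> slice(1)[OF sb], of x] unfolding f_def .
  have "(\<Sum>n\<in>{-int N..int N}. f n t * cis (of_int n * x)) - (\<Sum>n\<in>{-int N..int N}. of_real (exp (- real_of_int \<bar>n\<bar> * \<sigma>)) * f n s * cis (of_int n * x))
    = of_real (sinh \<sigma>) * G s N t x - of_real (sinh \<sigma> - \<sigma>) * g 0 s" for N
  proof -
    have "f n t * cis (of_int n * x) - of_real (exp (- real_of_int \<bar>n\<bar> * \<sigma>)) * f n s * cis (of_int n * x)
      = of_real (sinh \<sigma>) * (g n s * (of_real (km (nat \<bar>n\<bar>) (t - s)) * cis (of_int n * x))) - (if n = 0 then of_real (sinh \<sigma> - \<sigma>) * g 0 s else 0)" for n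
    proof -
      have hs: "hs (real_of_int \<bar>n\<bar>) \<sigma> = sinh \<sigma> * km (nat \<bar>n\<bar>) \<sigma> - (if n = 0 then sinh \<sigma> - \<sigma> else 0)"
      proof (cases "n = 0")
        case False
        then have "nat \<bar>n\<bar> \<ge> 1" by simp
        from km_sinh[OF this, of \<sigma>] show ?thesis using False m[of n] by (simp add: mult.commute)
      qed (simp add: hs_def km_def)
      have "f n t * cis (of_int n * x) - of_real (exp (- real_of_int \<bar>n\<bar> * \<sigma>)) * f n s * cis (of_int n * x)
        = g n s * of_real (hs (real_of_int \<bar>n\<bar>) \<sigma>) * cis (of_int n * x)"
        unfolding f_shift_exp[OF sb tb, of n] \<sigma>_def[symmetric] by (simp add: algebra_simps)
      then show ?thesis unfolding hs \<sigma>_def[symmetric] by (auto simp: algebra_simps)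
    qed
    then have "(\<Sum>n\<in>{-int N..int N}. f n t * cis (of_int n * x)) - (\<Sum>n\<in>{-int N..int N}. of_real (exp (- real_of_int \<bar>n\<bar> * \<sigma>)) * f n s * cis (of_int n * x))
      = (\<Sum>n\<in>{-int N..int N}. of_real (sinh \<sigma>) * (g n s * (of_real (km (nat \<bar>n\<bar>) (t - s)) * cis (of_int n * x))) - (if n = 0 then of_real (sinh \<sigma> - \<sigma>) * g 0 s else 0))"
      unfolding sum_subtractf[symmetric] by (intro sum.cong) auto
    also have "\<dots> = of_real (sinh \<sigma>) * G s N t x - of_real (sinh \<sigma> - \<sigma>) * g 0 s"
      unfolding sum_subtractf G_def sum_distrib_left by simp
    finally show ?thesis .
  qed
  then show ?thesis using tendsto_diff[OF 1 2] unfolding \<sigma>_def[symmetric] by simp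
qed

text \<open>The logarithmic bound carries a factor sinh(t - s); dividing by it gives an estimate
  that does not degenerate as t approaches s. The losses are the correction at mode 0, where (sinh
  \<sigma> - \<sigma>) / sinh \<sigma> \<le> \<sigma>, and the tail of the series beyond N, each
  multiplied by |H| \<le> 2.\<close>

lemma G_pointwise:
  assumes s: "0 < s" "s < t" "t \<le> t2 / 2" "t2 < b"
    and lower: "Re (cnj (H t x) * (H t x - cmean (\<lambda>y. of_real (poisson (t - s) (x - y)) * H s y))) \<ge> sinh (t - s) * P"
    and H2: "cmod (H t x) \<le> 2"
  shows "Re (cnj (H t x) * G s N t x) \<ge> P - 2 * (t - s) * K2 t2 - 2 * (2 * K3 t2 * qq t2 ^ Suc N / (1 - qq t2))"
proof -
  define \<sigma> where "\<sigma> = t - s"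
  have \<sigma>: "\<sigma> > 0" using s by (simp add: \<sigma>_def)
  have t2: "0 < t2" using s by auto
  have sh: "sinh \<sigma> > 0" using \<sigma> by simp
  define R where "R = H t x - cmean (\<lambda>y. of_real (poisson \<sigma> (x - y)) * H s y)"
  define L where "L = (R + of_real (sinh \<sigma> - \<sigma>) * g 0 s) / of_real (sinh \<sigma>)"
  have "(\<lambda>N. (of_real (sinh \<sigma>) * G s N t x - of_real (sinh \<sigma> - \<sigma>) * g 0 s + of_real (sinh \<sigma> - \<sigma>) * g 0 s) / of_real (sinh \<sigma>)) \<longlonglongrightarrow> L"
    unfolding L_def using sh by (intro tendsto_intros poisson_remainder[OF s, of x, folded \<sigma>_def, folded R_def]) auto
  then have lim: "(\<lambda>N. G s N t x) \<longlonglongrightarrow> L" using sh by simp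
  have tb: "cmod (g n s * (of_real (km (nat \<bar>n\<bar>) (t - s)) * cis (of_int n * x))) \<le> K3 t2 * qq t2 ^ nat \<bar>n\<bar>" for n
  proof (rule term_bound[OF s(1) _ s(3,4)])
    have "\<bar>km (nat \<bar>n\<bar>) (t - s)\<bar> \<le> exp (real (nat \<bar>n\<bar>) * (t - s))" using km_bound(1)[of "t - s" "nat \<bar>n\<bar>"] \<sigma> \<sigma>_def by simp
    also have "\<dots> \<le> (1 + real (nat \<bar>n\<bar>)) * exp (real (nat \<bar>n\<bar>) * (t - s))" by simp
    finally show "cmod (of_real (km (nat \<bar>n\<bar>) (t - s)) * cis (of_int n * x)) \<le> (1 + real_of_int \<bar>n\<bar>) * exp (real_of_int \<bar>n\<bar> * (t - s))"
      by (simp add: norm_mult)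
  qed (use s in simp)
  have tail: "cmod (L - G s N t x) \<le> 2 * K3 t2 * qq t2 ^ Suc N / (1 - qq t2)"
    unfolding G_def by (rule sym_sum_tail[OF tb qq[OF t2] K3_nonneg(1)[OF t2 s(4)]]) (use lim in \<open>simp add: G_def\<close>)
  have "cmod (g 0 s) \<le> K2 t2" using g_bound[of s t2 0] s by simp
  moreover have "0 \<le> sinh \<sigma> - \<sigma>" using x_le_sinh[of \<sigma>] \<sigma> by simp
  moreover have "sinh \<sigma> - \<sigma> \<le> \<sigma> * sinh \<sigma>"
  proof -
    have "sinh \<sigma> \<le> \<sigma> * cosh \<sigma>" using sinh_le_x_cosh[of \<sigma>] \<sigma> by simp
    also have "\<dots> \<le> \<sigma> * (1 + sinh \<sigma>)"
    proof (rule mult_left_mono)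
      have "exp (- \<sigma>) \<le> 1" using \<sigma> by simp
      then show "cosh \<sigma> \<le> 1 + sinh \<sigma>" using cosh_minus_sinh[of \<sigma>] by linarith
    qed (use \<sigma> in simp)
    finally show ?thesis by (simp add: algebra_simps)
  qed
  ultimately have z: "cmod (of_real (sinh \<sigma> - \<sigma>) * g 0 s) \<le> \<sigma> * sinh \<sigma> * K2 t2"
    unfolding norm_mult norm_of_real by (intro mult_mono) auto
  have "Re (cnj (H t x) * R) = Re (cnj (H t x) * (of_real (sinh \<sigma>) * L)) - Re (cnj (H t x) * (of_real (sinh \<sigma> - \<sigma>) * g 0 s))"
  proof -
    have "of_real (sinh \<sigma>) * L = R + of_real (sinh \<sigma> - \<sigma>) * g 0 s" using sh by (simp add: L_def)
    then show ?thesis by (simp only: distrib_left plus_complex.sel)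
  qed
  moreover have "- Re (cnj (H t x) * (of_real (sinh \<sigma> - \<sigma>) * g 0 s)) \<le> 2 * (\<sigma> * sinh \<sigma> * K2 t2)"
  proof -
    have "- Re (cnj (H t x) * (of_real (sinh \<sigma> - \<sigma>) * g 0 s)) \<le> cmod (cnj (H t x) * (of_real (sinh \<sigma> - \<sigma>) * g 0 s))"
      using abs_Re_le_cmod by (metis abs_le_D2)
    also have "\<dots> \<le> 2 * (\<sigma> * sinh \<sigma> * K2 t2)"
      unfolding norm_mult[of "cnj (H t x)"] complex_mod_cnj using H2 z by (intro mult_mono) auto
    finally show ?thesis .
  qed
  moreover have "Re (cnj (H t x) * (of_real (sinh \<sigma>) * L)) = sinh \<sigma> * Re (cnj (H t x) * L)" by (simp add: algebra_simps)
  ultimately have "sinh \<sigma> * P \<le> sinh \<sigma> * Re (cnj (H t x) * L) + 2 * (\<sigma> * sinh \<sigma> * K2 t2)"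
    using lower unfolding \<sigma>_def[symmetric] R_def[symmetric] by linarith
  then have "sinh \<sigma> * P \<le> sinh \<sigma> * (Re (cnj (H t x) * L) + 2 * \<sigma> * K2 t2)" by (simp add: algebra_simps)
  then have 1: "P \<le> Re (cnj (H t x) * L) + 2 * \<sigma> * K2 t2" using sh by simp
  have "Re (cnj (H t x) * L) - Re (cnj (H t x) * G s N t x) \<le> cmod (cnj (H t x) * (L - G s N t x))"
    by (metis complex_Re_le_cmod minus_complex.sel(1) right_diff_distrib)
  also have "\<dots> \<le> 2 * (2 * K3 t2 * qq t2 ^ Suc N / (1 - qq t2))"
    unfolding norm_mult complex_mod_cnj using H2 tail by (intro mult_mono) auto
  finally show ?thesis using 1 unfolding \<sigma>_def[symmetric] by linarith
qed

end

section \<open>Lower bound for X\<close>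

context nitsche_strip
begin

text \<open>The \<omega>-term of \<open>green_G\<close> is bounded below by integrating
  \<open>G_pointwise\<close> against \<omega> J. In the \<psi>-term the gradient of G is bounded
  uniformly in s and N, while that of H is controlled only in the mean square; y \<le> d y^2 + 1 /
  (4 d) pays one part by the energy and the other by the thickness of the strip.\<close>

lemma X_lower_cutoff:
  assumes cut: "cutoff_strip H Ht Hx Htt Htx Hxx b \<omega> \<psi> K A0 B0 s t0"
    and pos: "\<And>x. A0 < x \<Longrightarrow> x < B0 \<Longrightarrow> 0 < \<omega> x" and AB: "1 < M" "M < A0" "A0 < B0" "B0 \<le> 4"
    and EM: "\<And>x. E s x \<le> M"
    and t2: "t0 \<le> t2 / 2" "t2 < b" and e: "e > 0" and d: "d > 0"
  shows "\<exists>N0. \<forall>N\<ge>N0. X N s \<ge> 1 - t0 - 2 * e - 2 * t0 * K2 t2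
    - 2 * K3 t2 / (1 - qq t2) * (d * ((U1 t0 - U1 s) / 2) + (t0 - s) / (2 * d))"
proof -
  interpret C: cutoff_strip H Ht Hx Htt Htx Hxx b \<omega> \<psi> K A0 B0 s t0 by fact
  note st = C.st and mass = cutoff_mass[OF cut pos AB(3)]
  have sb: "0 < s" "s < b" using st by auto
  have t2p: "0 < t2" using st t2 by auto
  have zb: "cmod (H s x) \<le> sqrt M" for x
    using EM[of x] unfolding E_def by (rule real_le_rsqrt)
  have M: "0 < sqrt M" "sqrt M < sqrt A0" using AB by auto
  obtain n where n: "\<And>\<sigma> \<theta> w. \<sigma> > 0 \<Longrightarrow> cmod w \<ge> sqrt A0 \<Longrightarrow> cmod w \<ge> 1 \<Longrightarrow>
     Re (cnj w * (w - cmean (\<lambda>x. of_real (poisson \<sigma> (\<theta> - x)) * H s x)))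
     \<ge> sinh \<sigma> * (1 - \<sigma> - e - 2 * Re (\<Sum>k\<in>{1..n}. cmean (\<lambda>x. H s x ^ k) / of_nat k / w ^ k))"
    by (rule poisson_log_lower_bound[OF slice(1)[OF sb] zb M e]) blast
  define c where "c = (\<lambda>k. cmean (\<lambda>x. H s x ^ k) / of_nat k)"
  define K1 where "K1 = 2 * K3 t2 / (1 - qq t2)"
  have K1: "K1 \<ge> 0" unfolding K1_def using K3_nonneg(1)[OF t2p t2(2)] qq[OF t2p] by simp
  have "(\<lambda>N. 2 * (2 * K3 t2 * qq t2 ^ Suc N / (1 - qq t2))) \<longlonglongrightarrow> 2 * (2 * K3 t2 * 0 / (1 - qq t2))"
    using qq[OF t2p] by (intro tendsto_intros LIMSEQ_Suc[OF LIMSEQ_realpow_zero]) auto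
  then have "(\<lambda>N. 2 * (2 * K3 t2 * qq t2 ^ Suc N / (1 - qq t2))) \<longlonglongrightarrow> 0" by simp
  from order_tendstoD(2)[OF this e] obtain N0 where "\<And>N. N \<ge> N0 \<Longrightarrow> 2 * (2 * K3 t2 * qq t2 ^ Suc N / (1 - qq t2)) < e"
    unfolding eventually_sequentially by blast
  then have N0: "\<And>N. N \<ge> N0 \<Longrightarrow> 2 * (2 * K3 t2 * qq t2 ^ Suc N / (1 - qq t2)) \<le> e"
    by (rule less_imp_le)
  define \<eta> where "\<eta> = 1 - t0 - e - 2 * t0 * K2 t2 - e"
  have K2: "K2 t2 \<ge> 0" using K3_nonneg(2)[OF t2p t2(2)] .
  have "X N s \<ge> \<eta> - K1 * (d * ((U1 t0 - U1 s) / 2) + (t0 - s) / (2 * d))" if N: "N \<ge> N0" for N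
  proof -
    define W where "W = (\<lambda>t x. complex_of_real (\<omega> (E t x) * J t x))"
    have Wc: "strip_cont b W" unfolding W_def by (intro strip_cont_intros C.\<omega>_cont J_cont)
    have pw: "\<omega> (E t x) * J t x * \<eta> - 2 * Re (\<Sum>k\<in>{1..n}. c k * (W t x / H t x ^ k)) \<le> \<omega> (E t x) * J t x * Re (cnj (H t x) * G s N t x)"
      if t: "s \<le> t" "t \<le> t0" for t x
    \<comment> \<open>Where the weight vanishes both sides are 0. Elsewhere E > A0, which forces t >
      s, since E(s, -) \<le> A0, and gives |H| \<ge> sqrt A0, as the Poisson estimate
      requires.\<close>
    proof (cases "\<omega> (E t x) = 0")
      case False
      have tb: "0 < t" "t < b" using t st by auto
      have EAB: "A0 < E t x" "E t x < B0" using C.\<omega>(3)[of "E t x"] C.\<omega>(4)[of "E t x"] False by force+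
      have st': "s < t" using EAB(1) C.inner[of x] t by (cases "s = t") auto
      have "E t x \<le> 4" using EAB AB by simp
      then have "sqrt (E t x) \<le> sqrt 4" by (rule real_sqrt_le_mono)
      then have H2: "cmod (H t x) \<le> 2" by (simp add: E_def)
      have H1: "sqrt A0 \<le> cmod (H t x)" using EAB(1) unfolding E_def by (intro real_le_lsqrt) (use AB in auto)
      define S where "S = Re (\<Sum>k\<in>{1..n}. c k / H t x ^ k)"
      have lower: "Re (cnj (H t x) * (H t x - cmean (\<lambda>y. of_real (poisson (t - s) (x - y)) * H s y))) \<ge> sinh (t - s) * (1 - (t - s) - e - 2 * S)"
        unfolding S_def c_def by (rule n) (use st' H1 gt1[OF tb, of x] in auto)
      have "Re (cnj (H t x) * G s N t x) \<ge> (1 - (t - s) - e - 2 * S) - 2 * (t - s) * K2 t2 - 2 * (2 * K3 t2 * qq t2 ^ Suc N / (1 - qq t2))"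
        by (rule G_pointwise[OF sb(1) st' _ t2(2) lower H2]) (use t t2 in auto)
      moreover have "(t - s) * K2 t2 \<le> t0 * K2 t2" using t sb K2 by (intro mult_right_mono) auto
      moreover have "t - s \<le> t0" using t sb by auto
      ultimately have ge: "Re (cnj (H t x) * G s N t x) \<ge> \<eta> - 2 * S"
        using N0[OF N] unfolding \<eta>_def by linarith
      have "0 \<le> \<omega> (E t x) * J t x" using C.\<omega>(2) jac[OF tb, of x] by simp
      from mult_left_mono[OF ge this] have "\<omega> (E t x) * J t x * (\<eta> - 2 * S) \<le> \<omega> (E t x) * J t x * Re (cnj (H t x) * G s N t x)" .
      moreover have "\<omega> (E t x) * J t x * S = Re (\<Sum>k\<in>{1..n}. c k * (W t x / H t x ^ k))"
      proof -
        have "(\<Sum>k\<in>{1..n}. c k * (W t x / H t x ^ k)) = of_real (\<omega> (E t x) * J t x) * (\<Sum>k\<in>{1..n}. c k / H t x ^ k)"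
          unfolding W_def sum_distrib_left by (simp add: mult_ac)
        then show ?thesis unfolding S_def by (simp only: Re_complex_of_real times_complex.sel Im_complex_of_real mult_zero_left diff_zero)
      qed
      ultimately show ?thesis by (simp add: right_diff_distrib)
    qed (simp add: W_def)
    have Wk: "strip_cont b (\<lambda>t x. c k * (W t x / H t x ^ k))" for k
      by (intro strip_cont_mult strip_cont_const C.strip_cont_divide_H Wc)
    have lin: "smean s t0 (\<lambda>t x. \<omega> (E t x) * J t x * \<eta> - 2 * Re (\<Sum>k\<in>{1..n}. c k * (W t x / H t x ^ k))) = \<eta> * (K / 2)"
    proof -
      have "smean s t0 (\<lambda>t x. \<Sum>k\<in>{1..n}. c k * (W t x / H t x ^ k)) = (\<Sum>k\<in>{1..n}. smean s t0 (\<lambda>t x. c k * (W t x / H t x ^ k)))"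
        by (rule smean_sum[OF st finite_atLeastAtMost Wk])
      also have "\<dots> = 0"
      proof (rule sum.neutral, rule ballI)
        fix k assume "k \<in> {1..n}"
        then have "smean s t0 (\<lambda>t x. W t x / H t x ^ k) = 0" unfolding W_def by (intro C.omega_J_power_zero) auto
        then show "smean s t0 (\<lambda>t x. c k * (W t x / H t x ^ k)) = 0" unfolding smean_cmult[OF st] by simp
      qed
      finally have z: "smean s t0 (\<lambda>t x. Re (\<Sum>k\<in>{1..n}. c k * (W t x / H t x ^ k))) = 0"
        using smean_linear[OF st bounded_linear_Re, of "\<lambda>t x. \<Sum>k\<in>{1..n}. c k * (W t x / H t x ^ k)"]
          strip_cont_sum[of "{1..n}" b "\<lambda>k t x. c k * (W t x / H t x ^ k)"] Wk by simp
      have "smean s t0 (\<lambda>t x. \<eta> * (\<omega> (E t x) * J t x) - 2 * Re (\<Sum>k\<in>{1..n}. c k * (W t x / H t x ^ k)))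
        = smean s t0 (\<lambda>t x. \<eta> * (\<omega> (E t x) * J t x)) - smean s t0 (\<lambda>t x. 2 * Re (\<Sum>k\<in>{1..n}. c k * (W t x / H t x ^ k)))"
        by (intro smean_diff[OF st] strip_cont_mult strip_cont_const strip_cont_Re strip_cont_sum finite_atLeastAtMost Wk C.\<omega>_cont J_cont)
      also have "\<dots> = \<eta> * (K / 2) - 2 * 0"
        by (simp only: smean_rmult[OF st] mass z)
      finally show ?thesis by (simp only: mult.commute[of _ \<eta>] mult_zero_right diff_zero)
    qed
    have sumc: "strip_cont b (\<lambda>t x. Re (\<Sum>k\<in>{1..n}. c k * (W t x / H t x ^ k)))"
      by (intro strip_cont_Re strip_cont_sum finite_atLeastAtMost Wk)
    have 1: "\<eta> * (K / 2) \<le> smean s t0 (\<lambda>t x. \<omega> (E t x) * J t x * Re (cnj (H t x) * G s N t x))"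
      unfolding lin[symmetric]
      by (rule smean_mono[OF st _ _ pw]) (intro strip_cont_intros C.\<omega>_cont J_cont sumc sc G_cont)+
    define Q where "Q = (\<lambda>t x. \<psi> (E t x) * Re (\<i> * (Gt s N t x * cnj (Hx t x) - Gx s N t x * cnj (Ht t x))))"
    define V where "V = (\<lambda>t x. K * K1 * (d * ((cmod (Ht t x))\<^sup>2 + (cmod (Hx t x))\<^sup>2) + 1 / (2 * d)))"
    have 2: "norm (smean s t0 Q) \<le> smean s t0 V"
    proof (rule norm_smean_le[OF st])
      show "strip_cont b Q" unfolding Q_def by (intro strip_cont_intros C.\<psi>_cont G_cont sc)
      show "strip_cont b V" unfolding V_def by (intro strip_cont_intros sc)
      fix t x assume t: "s \<le> t" "t \<le> t0"
      have tb: "0 < t" "t < b" using t st by auto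
      have tt: "t \<le> t2 / 2" using t t2 by simp
      have Gb: "cmod (Gt s N t x) \<le> K1" "cmod (Gx s N t x) \<le> K1"
        using G_deriv_bounds[OF sb(1) t(1) tt t2(2)] by (auto simp: K1_def)
      have y: "y \<le> d * y\<^sup>2 + 1 / (4 * d)" for y
      proof -
        have "0 \<le> (2 * d * y - 1)\<^sup>2 / (4 * d)" using d by simp
        also have "\<dots> = d * y\<^sup>2 - y + 1 / (4 * d)" using d by (simp add: field_simps power2_eq_square)
        finally show ?thesis by simp
      qed
      have "cmod (Gt s N t x * cnj (Hx t x) - Gx s N t x * cnj (Ht t x)) \<le> K1 * cmod (Hx t x) + K1 * cmod (Ht t x)"
        using Gb by (intro order_trans[OF norm_triangle_ineq4] add_mono) (auto simp: norm_mult intro!: mult_right_mono)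
      also have "\<dots> = K1 * (cmod (Hx t x) + cmod (Ht t x))" by (simp add: distrib_left)
      also have "\<dots> \<le> K1 * (d * ((cmod (Ht t x))\<^sup>2 + (cmod (Hx t x))\<^sup>2) + 1 / (2 * d))"
      proof (rule mult_left_mono[OF _ K1])
        have "1 / (4 * d) + 1 / (4 * d) = 1 / (2 * d)" by (simp add: field_simps)
        then show "cmod (Hx t x) + cmod (Ht t x) \<le> d * ((cmod (Ht t x))\<^sup>2 + (cmod (Hx t x))\<^sup>2) + 1 / (2 * d)"
          using y[of "cmod (Hx t x)"] y[of "cmod (Ht t x)"] by (simp only: distrib_left)
      qed
      finally have b1: "cmod (Gt s N t x * cnj (Hx t x) - Gx s N t x * cnj (Ht t x)) \<le> K1 * (d * ((cmod (Ht t x))\<^sup>2 + (cmod (Hx t x))\<^sup>2) + 1 / (2 * d))" .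
      have "\<bar>Re (\<i> * (Gt s N t x * cnj (Hx t x) - Gx s N t x * cnj (Ht t x)))\<bar> \<le> cmod (Gt s N t x * cnj (Hx t x) - Gx s N t x * cnj (Ht t x))"
        by (rule order_trans[OF abs_Re_le_cmod]) (simp add: norm_mult)
      then have b2: "\<bar>Re (\<i> * (Gt s N t x * cnj (Hx t x) - Gx s N t x * cnj (Ht t x)))\<bar> \<le> K1 * (d * ((cmod (Ht t x))\<^sup>2 + (cmod (Hx t x))\<^sup>2) + 1 / (2 * d))"
        using b1 by linarith
      have p: "0 \<le> \<psi> (E t x)" "\<psi> (E t x) \<le> K" using C.\<psi>(4,5) C.E_pos[OF tb] by auto
      have "\<bar>\<psi> (E t x)\<bar> * \<bar>Re (\<i> * (Gt s N t x * cnj (Hx t x) - Gx s N t x * cnj (Ht t x)))\<bar> \<le> K * (K1 * (d * ((cmod (Ht t x))\<^sup>2 + (cmod (Hx t x))\<^sup>2) + 1 / (2 * d)))"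
        using p b2 C.K by (intro mult_mono) auto
      then show "norm (Q t x) \<le> V t x" unfolding Q_def V_def real_norm_def abs_mult by (simp only: mult.assoc)
    qed
    have V: "smean s t0 V = K * K1 * (d * ((U1 t0 - U1 s) / 2) + (t0 - s) / (2 * d))"
    proof -
      have c: "strip_cont b (\<lambda>t x. d * ((cmod (Ht t x))\<^sup>2 + (cmod (Hx t x))\<^sup>2))" by (intro strip_cont_intros sc)
      show ?thesis unfolding V_def
        by (simp only: smean_rmult[OF st] smean_add[OF st c strip_cont_const] smean_D[OF st] smean_const[OF st]) simp
    qed
    have "K * X N s = 2 * smean s t0 (\<lambda>t x. \<omega> (E t x) * J t x * Re (cnj (H t x) * G s N t x)) - smean s t0 Q"
      unfolding X_eq[OF sb, symmetric] Q_def
      by (rule C.green_G[OF G_deriv_t G_deriv_x G_cont G_per])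
    also have "\<dots> \<ge> 2 * (\<eta> * (K / 2)) - smean s t0 V"
      using 1 2 by (intro diff_mono mult_left_mono) auto
    also have "2 * (\<eta> * (K / 2)) - smean s t0 V = K * (\<eta> - K1 * (d * ((U1 t0 - U1 s) / 2) + (t0 - s) / (2 * d)))"
      unfolding V by (simp add: algebra_simps)
    finally show ?thesis using C.K by simp
  qed
  then show ?thesis unfolding \<eta>_def K1_def by (intro exI[of _ N0]) (auto simp: algebra_simps)
qed

lemma X_lower:
  assumes e: "e > 0"
  shows "\<exists>d>0. \<forall>s. 0 < s \<longrightarrow> s < d \<longrightarrow> s < b \<longrightarrow> (\<exists>N0. \<forall>N\<ge>N0. X N s \<ge> 1 - e)"
proof -
  define t2 where "t2 = b / 2"
  have t2: "0 < t2" "t2 < b" using b_pos by (auto simp: t2_def)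
  define K1 where "K1 = 2 * K3 t2 / (1 - qq t2)"
  have K1: "K1 \<ge> 0" unfolding K1_def using K3_nonneg(1)[OF t2] qq[OF t2(1)] by simp
  have K2: "K2 t2 \<ge> 0" using K3_nonneg(2)[OF t2] .
  have U1: "U1 t2 \<ge> 0" using U1_nonneg[OF t2] .
  \<comment> \<open>d has to precede t0, because the term (t0 - s) / (2 d) is made small by the
    choice of t0 for given d. The budget is e / 5 for the energy part, e / 5 for all terms
    proportional to t0, and 2 e / 5 for the truncated logarithm and the tail in N.\<close>
  define d where "d = e / (5 * (1 + K1 * U1 t2))"
  have d: "d > 0" unfolding d_def using e K1 U1 by (intro divide_pos_pos mult_pos_pos add_pos_nonneg) auto
  have d1: "K1 * (d * U1 t2) \<le> e / 5"
  proof -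
    have p: "1 + K1 * U1 t2 > 0" using K1 U1 by (intro add_pos_nonneg) auto
    have "K1 * (d * U1 t2) = e / 5 * (K1 * U1 t2 / (1 + K1 * U1 t2))" by (simp add: d_def)
    also have "\<dots> \<le> e / 5 * 1" using e p by (intro mult_left_mono) (auto simp: pos_divide_le_eq)
    finally show ?thesis by simp
  qed
  define t0 where "t0 = min (t2 / 2) (e / (5 * (1 + 2 * K2 t2 + K1 / (2 * d))))"
  have q: "1 + 2 * K2 t2 + K1 / (2 * d) > 0" using K1 K2 d by (intro add_pos_nonneg) auto
  have "t0 \<le> t2 / 2" unfolding t0_def by (rule min.cobounded1)
  moreover have "0 < t0" using t2 e q by (auto simp: t0_def)
  ultimately have t0: "0 < t0" "t0 \<le> t2 / 2" "t0 < b" using t2 by auto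
  have t0e: "t0 + 2 * t0 * K2 t2 + K1 * (t0 / (2 * d)) \<le> e / 5"
  proof -
    have "t0 * (1 + 2 * K2 t2 + K1 / (2 * d)) \<le> e / (5 * (1 + 2 * K2 t2 + K1 / (2 * d))) * (1 + 2 * K2 t2 + K1 / (2 * d))"
      using q by (intro mult_right_mono) (auto simp: t0_def)
    also have "\<dots> = e / 5"
    proof -
      have "e / (5 * z) * z = e / 5" if "z > 0" for z using that by simp
      from this[OF q] show ?thesis .
    qed
    finally show ?thesis by (simp add: algebra_simps)
  qed
  obtain \<tau>0 A0 B0 M \<omega> \<psi> K where c: "0 < \<tau>0" "\<tau>0 < t0" "1 < M" "M < A0" "A0 < B0" "B0 \<le> 4"
    "\<And>s. 0 < s \<Longrightarrow> s < \<tau>0 \<Longrightarrow> cutoff_strip H Ht Hx Htt Htx Hxx b \<omega> \<psi> K A0 B0 s t0"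
    "\<And>s x. 0 < s \<Longrightarrow> s < \<tau>0 \<Longrightarrow> E s x \<le> M" "\<And>x. A0 < x \<Longrightarrow> x < B0 \<Longrightarrow> 0 < \<omega> x"
    by (rule exists_cutoff[OF t0(1,3)]) (rule that)
  have "\<exists>N0. \<forall>N\<ge>N0. X N s \<ge> 1 - e" if s: "0 < s" "s < \<tau>0" for s
  proof -
    have e5: "e / 5 > 0" using e by simp
    obtain N0 where N0: "\<And>N. N \<ge> N0 \<Longrightarrow> X N s \<ge> 1 - t0 - 2 * (e / 5) - 2 * t0 * K2 t2
        - K1 * (d * ((U1 t0 - U1 s) / 2) + (t0 - s) / (2 * d))"
      using X_lower_cutoff[OF c(7)[OF s] c(9) c(3-6) c(8)[OF s] t0(2) t2(2) e5 d] unfolding K1_def by blast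
    have "(U1 t0 - U1 s) / 2 \<le> U1 t2"
    proof -
      have "U1 t0 \<le> U1 t2" using t0 t2 by (intro U1_mono) auto
      moreover have "0 \<le> U1 s" using s c t0 by (intro U1_nonneg) auto
      ultimately show ?thesis using U1 by (simp add: field_simps)
    qed
    then have "d * ((U1 t0 - U1 s) / 2) + (t0 - s) / (2 * d) \<le> d * U1 t2 + t0 / (2 * d)"
      using d s by (intro add_mono mult_left_mono divide_right_mono) auto
    from mult_left_mono[OF this K1]
    have "K1 * (d * ((U1 t0 - U1 s) / 2) + (t0 - s) / (2 * d)) \<le> K1 * (d * U1 t2) + K1 * (t0 / (2 * d))"
      by (simp only: distrib_left)
    then have "1 - e \<le> 1 - t0 - 2 * (e / 5) - 2 * t0 * K2 t2
        - K1 * (d * ((U1 t0 - U1 s) / 2) + (t0 - s) / (2 * d))"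
      using d1 t0e e by linarith
    then have "1 - e \<le> X N s" if "N \<ge> N0" for N
      by (rule order_trans[OF _ N0[OF that]])
    then show ?thesis by blast
  qed
  then show ?thesis using c(1) by blast
qed

end

section \<open>The quadratic form and the lower bound\<close>

text \<open>With p = f_n(s) and q = f_n'(s), the contribution of mode n to U(T) - a U - \<beta> A -
  c U' - 2 d X. Both terms with d come from n Re (g_n cnj(f_n)).\<close>

definition mode_form :: "real \<Rightarrow> real \<Rightarrow> real \<Rightarrow> real \<Rightarrow> real \<Rightarrow> int \<Rightarrow> complex \<Rightarrow> complex \<Rightarrow> real" where
  "mode_form L a \<beta> c d n p q = (let m = real_of_int \<bar>n\<bar>; x = real_of_int n in
     (cmod (p * of_real (cosh (m * L)) + q * of_real (hs m L)))\<^sup>2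
     - (a + \<beta> * x + 2 * d * x * m) * (cmod p)\<^sup>2 - 2 * (c + d * x) * Re (cnj p * q))"

lemma norm_sq_combination:
  fixes p q :: complex and C S :: real
  shows "(cmod (p * of_real C + q * of_real S))\<^sup>2 = C\<^sup>2 * (cmod p)\<^sup>2 + 2 * C * S * Re (cnj p * q) + S\<^sup>2 * (cmod q)\<^sup>2"
  unfolding cmod_power2 by (simp add: power2_eq_square algebra_simps)

lemma hs_pos: "m \<ge> 0 \<Longrightarrow> L > 0 \<Longrightarrow> hs m L > 0"
  by (auto simp: hs_def)

text \<open>Completes the square in q. What remains is |p|^2 times the quantity whose positivity is
  \<open>mode_ineq\<close>; the factor S^2 avoids divisions.\<close>

lemma mode_form_complete_square:
  fixes L a \<beta> c d :: real and n :: int and p q :: complex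
  defines "m \<equiv> real_of_int \<bar>n\<bar>" and "x \<equiv> real_of_int n"
  defines "C \<equiv> cosh (m * L)" and "S \<equiv> hs m L"
  shows "S\<^sup>2 * mode_form L a \<beta> c d n p q =
    (cmod (p * of_real (C * S - (c + d * x)) + q * of_real (S\<^sup>2)))\<^sup>2
    + (2 * (c + d * x) * C * S - (c + d * x)\<^sup>2 - (a + \<beta> * x + 2 * d * x * m) * S\<^sup>2) * (cmod p)\<^sup>2"
  unfolding mode_form_def Let_def m_def[symmetric] x_def[symmetric] C_def[symmetric] S_def[symmetric] norm_sq_combination
  by (simp add: power2_eq_square algebra_simps)

lemma mode_form_pos:
  assumes "mode_ineq L a \<beta> c d n" "L > 0"
  shows "0 \<le> mode_form L a \<beta> c d n p q" "mode_form L a \<beta> c d n p q \<le> 0 \<Longrightarrow> p = 0 \<and> q = 0"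
proof -
  define m x where "m = real_of_int \<bar>n\<bar>" and "x = real_of_int n"
  define C S where "C = cosh (m * L)" and "S = hs m L"
  define k where "k = 2 * (c + d * x) * C * S - (c + d * x)\<^sup>2 - (a + \<beta> * x + 2 * d * x * m) * S\<^sup>2"
  have S: "S > 0" unfolding S_def m_def using assms(2) by (intro hs_pos) auto
  have k: "k > 0" using assms(1) unfolding mode_ineq_def Let_def k_def C_def S_def m_def x_def by simp
  have eq: "S\<^sup>2 * mode_form L a \<beta> c d n p q = (cmod (p * of_real (C * S - (c + d * x)) + q * of_real (S\<^sup>2)))\<^sup>2 + k * (cmod p)\<^sup>2"
    unfolding k_def C_def S_def m_def x_def by (rule mode_form_complete_square)
  have "S\<^sup>2 * mode_form L a \<beta> c d n p q \<ge> 0" unfolding eq using k by simp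
  then show "0 \<le> mode_form L a \<beta> c d n p q" using S by (simp add: zero_le_mult_iff)
  assume "mode_form L a \<beta> c d n p q \<le> 0"
  then have "S\<^sup>2 * mode_form L a \<beta> c d n p q \<le> 0" using S by (simp add: mult_le_0_iff)
  then have z: "(cmod (p * of_real (C * S - (c + d * x)) + q * of_real (S\<^sup>2)))\<^sup>2 + k * (cmod p)\<^sup>2 \<le> 0" unfolding eq .
  have "k * (cmod p)\<^sup>2 \<ge> 0" using k by simp
  moreover have "(cmod (p * of_real (C * S - (c + d * x)) + q * of_real (S\<^sup>2)))\<^sup>2 \<ge> 0" by simp
  ultimately have "k * (cmod p)\<^sup>2 = 0" "(cmod (p * of_real (C * S - (c + d * x)) + q * of_real (S\<^sup>2)))\<^sup>2 = 0"
    using z by linarith+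
  then show "p = 0 \<and> q = 0" using k S by simp
qed

lemma mode_form_1:
  assumes "a + \<beta> + 2 * d = (cosh L)\<^sup>2" "c + d = cosh L * sinh L"
  shows "mode_form L a \<beta> c d 1 p q = (sinh L * cmod q)\<^sup>2"
proof -
  have "mode_form L a \<beta> c d 1 p q = (cosh L)\<^sup>2 * (cmod p)\<^sup>2 + 2 * cosh L * sinh L * Re (cnj p * q) + (sinh L)\<^sup>2 * (cmod q)\<^sup>2
    - (a + \<beta> + 2 * d) * (cmod p)\<^sup>2 - 2 * (c + d) * Re (cnj p * q)"
    unfolding mode_form_def Let_def norm_sq_combination by (simp add: hs_def)
  then show ?thesis unfolding assms by (simp add: power_mult_distrib)
qed

text \<open>The two equations make the form degenerate at n = 1, as it must be because that mode occurs in the extremal map.\<close>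

definition admissible :: "real \<Rightarrow> real \<Rightarrow> real \<Rightarrow> real \<Rightarrow> real \<Rightarrow> bool" where
  "admissible L a \<beta> c d \<longleftrightarrow> 0 \<le> \<beta> \<and> 0 \<le> c \<and> 0 \<le> d \<and> a + \<beta> + 2 * d = (cosh L)\<^sup>2 \<and> c + d = cosh L * sinh L
     \<and> (\<forall>n. n \<noteq> 1 \<longrightarrow> mode_ineq L a \<beta> c d n)"

lemma admissible_small:
  assumes "0 < L" "L \<le> 1"
  shows "admissible L (1 - (sinh L)\<^sup>2) (2 * (sinh L)\<^sup>2) (cosh L * sinh L) 0"
  unfolding admissible_def using mode_ineq_small[OF assms] assms cosh_square_eq[of L] by (auto simp: cosh_pos_real less_imp_le)

lemma admissible_large:
  assumes "1 \<le> L"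
  shows "admissible L ((cosh L)\<^sup>2 - 2 * (cosh L * sinh L - 1)) 0 1 (cosh L * sinh L - 1)"
  unfolding admissible_def using mode_ineq_large[OF assms] cosh_sinh_large(1)[OF assms] by auto

lemma mode_form_nonneg:
  assumes "admissible L a \<beta> c d" "L > 0"
  shows "0 \<le> mode_form L a \<beta> c d n p q"
  using assms mode_form_pos(1)[of L a \<beta> c d n p q] mode_form_1[of a \<beta> d L c p q]
  unfolding admissible_def by (cases "n = 1") auto

section \<open>Summation over the modes and the limit s -> 0\<close>

context nitsche_strip
begin

lemma parseval_U: "0 < s \<Longrightarrow> s < b \<Longrightarrow> (\<lambda>N. \<Sum>n\<in>{-int N..int N}. (cmod (f n s))\<^sup>2) \<longlonglongrightarrow> U s"
proof -
  assume s: "0 < s" "s < b"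
  have "(\<lambda>N. Re (\<Sum>n\<in>{-int N..int N}. fcoef (H s) n * cnj (fcoef (H s) n))) \<longlonglongrightarrow> Re (cmean (\<lambda>x. H s x * cnj (H s x)))"
    by (intro tendsto_Re parseval slice s per(1))
  moreover have "Re (cmean (\<lambda>x. H s x * cnj (H s x))) = U s"
    unfolding U_def by (subst cmean_Re[symmetric], intro continuous_intros slice s) (simp only: mult.commute[of _ "cnj _"] Re_cnj_mult)
  moreover have "Re (\<Sum>n\<in>I. fcoef (H s) n * cnj (fcoef (H s) n)) = (\<Sum>n\<in>I. (cmod (f n s))\<^sup>2)" for I
    unfolding f_def Re_sum by (simp only: mult.commute[of _ "cnj _"] Re_cnj_mult)
  ultimately show ?thesis by simp
qed

lemma parseval_U1: "0 < s \<Longrightarrow> s < b \<Longrightarrow> (\<lambda>N. \<Sum>n\<in>{-int N..int N}. 2 * Re (cnj (f n s) * f1 n s)) \<longlonglongrightarrow> U1 s"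
proof -
  assume s: "0 < s" "s < b"
  have "(\<lambda>N. 2 * Re (\<Sum>n\<in>{-int N..int N}. fcoef (H s) n * cnj (fcoef (Ht s) n))) \<longlonglongrightarrow> 2 * Re (cmean (\<lambda>x. H s x * cnj (Ht s x)))"
    by (intro tendsto_intros parseval slice s per(1))
  moreover have "2 * Re (cmean (\<lambda>x. H s x * cnj (Ht s x))) = U1 s"
    unfolding U1_def by (subst cmean_Re[symmetric], intro continuous_intros slice s) simp
  moreover have "2 * Re (\<Sum>n\<in>I. fcoef (H s) n * cnj (fcoef (Ht s) n)) = (\<Sum>n\<in>I. 2 * Re (cnj (f n s) * f1 n s))" for I
    unfolding f_def f1_def Re_sum by (simp add: sum_distrib_left)
  ultimately show ?thesis by simp
qed

lemma parseval_A: "0 < s \<Longrightarrow> s < b \<Longrightarrow> (\<lambda>N. \<Sum>n\<in>{-int N..int N}. of_int n * (cmod (f n s))\<^sup>2) \<longlonglongrightarrow> A s"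
proof -
  assume s: "0 < s" "s < b"
  have "(\<lambda>N. Re (\<i> * (\<Sum>n\<in>{-int N..int N}. fcoef (H s) n * cnj (fcoef (Hx s) n)))) \<longlonglongrightarrow> A s"
    unfolding A_def by (intro tendsto_intros parseval slice s per(1))
  moreover have "Re (\<i> * (\<Sum>n\<in>I. fcoef (H s) n * cnj (fcoef (Hx s) n))) = (\<Sum>n\<in>I. of_int n * (cmod (f n s))\<^sup>2)" for I
  proof -
    have "\<i> * (f n s * cnj (\<i> * of_int n * f n s)) = of_real (of_int n * (cmod (f n s))\<^sup>2)" for n
    proof -
      have "\<i> * (f n s * cnj (\<i> * of_int n * f n s)) = of_int n * (f n s * cnj (f n s))" by (simp add: complex_eq_iff algebra_simps)
      then show ?thesis by (simp only: complex_norm_square[symmetric] of_real_mult of_real_of_int_eq)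
    qed
    then have "\<i> * (\<Sum>n\<in>I. fcoef (H s) n * cnj (fcoef (Hx s) n)) = of_real (\<Sum>n\<in>I. of_int n * (cmod (f n s))\<^sup>2)"
      unfolding sum_distrib_left fcoef_Hx[OF s] f_def[symmetric] of_real_sum by (intro sum.cong) auto
    then show ?thesis by (simp only: Re_complex_of_real)
  qed
  ultimately show ?thesis by simp
qed

text \<open>One nonnegative mode k is kept on the left for the case of equality, the others are
  dropped. As a may be negative, U(s) is used from both sides, hence |a| in the error, whereas A, U'
  and X enter through lower bounds with nonnegative coefficients.\<close>

lemma U_ge_modes:
  assumes s: "0 < s" "s < T" "T < b" and adm: "admissible (T - s) a \<beta> c d"
    and e: "e \<ge> 0" "U s \<le> 1 + e" "1 - e \<le> A s" "\<And>N. N \<ge> N0 \<Longrightarrow> 1 - e \<le> X N s"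
  shows "(cosh (T - s))\<^sup>2 - e * (\<bar>a\<bar> + \<beta> + 2 * d) + mode_form (T - s) a \<beta> c d k (f k s) (f1 k s) \<le> U T"
proof -
  have sb: "0 < s" "s < b" and Tb: "0 < T" "T < b" using s by auto
  have adm': "0 \<le> \<beta>" "0 \<le> c" "0 \<le> d" "a + \<beta> + 2 * d = (cosh (T - s))\<^sup>2"
    using adm unfolding admissible_def by auto
  define M where "M = (\<lambda>n. mode_form (T - s) a \<beta> c d n (f n s) (f1 n s))"
  have M0: "0 \<le> M n" for n unfolding M_def by (rule mode_form_nonneg[OF adm]) (use s in simp)
  have split: "(cmod (f n T))\<^sup>2 = a * (cmod (f n s))\<^sup>2 + \<beta> * (of_int n * (cmod (f n s))\<^sup>2) + c * (2 * Re (cnj (f n s) * f1 n s))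
      + 2 * d * (of_int n * Re (g n s * cnj (f n s))) + M n" for n
  proof -
    have "Re (g n s * cnj (f n s)) = Re (cnj (f n s) * f1 n s) + real_of_int \<bar>n\<bar> * Re (cnj (f n s) * f n s)"
      unfolding g_def by (simp add: algebra_simps)
    then have g: "Re (g n s * cnj (f n s)) = Re (cnj (f n s) * f1 n s) + real_of_int \<bar>n\<bar> * (cmod (f n s))\<^sup>2"
      unfolding Re_cnj_mult .
    show ?thesis unfolding M_def mode_form_def Let_def f_shift[OF sb Tb, of n, symmetric] g
      by (simp only: algebra_simps)
  qed
  have ub: "a * (\<Sum>n\<in>{-int N..int N}. (cmod (f n s))\<^sup>2) + \<beta> * (\<Sum>n\<in>{-int N..int N}. of_int n * (cmod (f n s))\<^sup>2)
      + c * (\<Sum>n\<in>{-int N..int N}. 2 * Re (cnj (f n s) * f1 n s)) + 2 * d * (1 - e) + M k \<le> U T"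
    if N: "N \<ge> max N0 (nat \<bar>k\<bar>)" for N
  proof -
    have k: "k \<in> {-int N..int N}" using N by auto
    have "M k \<le> (\<Sum>n\<in>{-int N..int N}. M n)"
      by (rule member_le_sum[OF k]) (use M0 in auto)
    moreover have "2 * d * (1 - e) \<le> 2 * d * X N s" using e(4) N adm' by (intro mult_left_mono) auto
    moreover have "(\<Sum>n\<in>{-int N..int N}. (cmod (f n T))\<^sup>2) \<le> U T"
      unfolding f_def U_def by (rule bessel[OF slice(1)[OF Tb]]) simp
    moreover have "(\<Sum>n\<in>{-int N..int N}. (cmod (f n T))\<^sup>2) = a * (\<Sum>n\<in>{-int N..int N}. (cmod (f n s))\<^sup>2) + \<beta> * (\<Sum>n\<in>{-int N..int N}. of_int n * (cmod (f n s))\<^sup>2)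
      + c * (\<Sum>n\<in>{-int N..int N}. 2 * Re (cnj (f n s) * f1 n s)) + 2 * d * X N s + (\<Sum>n\<in>{-int N..int N}. M n)"
      unfolding split sum.distrib X_def sum_distrib_left ..
    ultimately show ?thesis by linarith
  qed
  have "(\<lambda>N. a * (\<Sum>n\<in>{-int N..int N}. (cmod (f n s))\<^sup>2) + \<beta> * (\<Sum>n\<in>{-int N..int N}. of_int n * (cmod (f n s))\<^sup>2)
      + c * (\<Sum>n\<in>{-int N..int N}. 2 * Re (cnj (f n s) * f1 n s)) + 2 * d * (1 - e) + M k)
      \<longlonglongrightarrow> a * U s + \<beta> * A s + c * U1 s + 2 * d * (1 - e) + M k"
    by (intro tendsto_intros parseval_U parseval_A parseval_U1 sb)
  from LIMSEQ_le_const2[OF this, of "U T"] ub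
  have main: "a * U s + \<beta> * A s + c * U1 s + 2 * d * (1 - e) + M k \<le> U T" by blast
  have "a - \<bar>a\<bar> * e \<le> a * U s"
  proof -
    have "\<bar>a * (U s - 1)\<bar> \<le> \<bar>a\<bar> * e" unfolding abs_mult using U_ge1[OF sb] e by (intro mult_left_mono) auto
    then show ?thesis by (simp add: algebra_simps abs_le_iff)
  qed
  moreover have "\<beta> * (1 - e) \<le> \<beta> * A s" using adm' e by (intro mult_left_mono) auto
  moreover have "0 \<le> c * U1 s" using adm' U1_nonneg[OF sb] by simp
  moreover have "(cosh (T - s))\<^sup>2 - e * (\<bar>a\<bar> + \<beta> + 2 * d) = (a - \<bar>a\<bar> * e) + \<beta> * (1 - e) + 2 * d * (1 - e)"
    unfolding adm'(4)[symmetric] by (simp add: algebra_simps)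
  ultimately show ?thesis using main unfolding M_def by linarith
qed

text \<open>The formula of \<open>f_shift\<close> expresses each mode on the whole interval by its
  data at T, so it extends continuously to t = 0, together with its derivative, although H itself
  need not.\<close>

lemma f_limits:
  assumes T: "0 < T" "T < b"
  obtains p q where "((\<lambda>s. f n s) \<longlongrightarrow> p) (at_right 0)" "((\<lambda>s. f1 n s) \<longlongrightarrow> q) (at_right 0)"
    "\<And>t. 0 < t \<Longrightarrow> t < b \<Longrightarrow> f n t = p * of_real (cosh (real_of_int \<bar>n\<bar> * t)) + q * of_real (hs (real_of_int \<bar>n\<bar>) t)"
proof -
  define m where "m = real_of_int \<bar>n\<bar>"
  define P where "P = (\<lambda>t. f n T * of_real (cosh (m * (t - T))) + f1 n T * of_real (hs m (t - T)))"
  define Q where "Q = (\<lambda>t. of_real (exp (- m * (T - t))) * (f1 n T + of_real m * f n T) - of_real m * P t)"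
  have hc: "isCont (hs m) x" for x using hs_deriv DERIV_isCont by blast
  have Pc: "isCont P t" for t unfolding P_def by (intro continuous_intros isCont_o2[OF _ hc])
  have Qc: "isCont Q t" for t unfolding Q_def by (intro continuous_intros Pc)
  have fP: "f n t = P t" if "0 < t" "t < b" for t
    using f_shift[OF T that, of n] unfolding P_def m_def .
  have fQ: "f1 n t = Q t" if "0 < t" "t < b" for t
    using f1_shift[OF that T, of n] unfolding Q_def fP[OF that, symmetric] m_def by (simp add: algebra_simps)
  have ev: "\<forall>\<^sub>F s in at_right 0. 0 < s \<and> s < b"
    using b_pos eventually_at_right_real by (force elim: eventually_mono)
  have P0: "(P \<longlongrightarrow> P 0) (at_right 0)" "(Q \<longlongrightarrow> Q 0) (at_right 0)"
    using Pc[of 0] Qc[of 0] by (auto simp: isCont_def intro: tendsto_mono[OF at_le])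
  have f0: "((\<lambda>s. f n s) \<longlongrightarrow> P 0) (at_right 0)"
    by (rule Lim_transform_eventually[OF P0(1)]) (use ev in \<open>eventually_elim, simp add: fP\<close>)
  have f10: "((\<lambda>s. f1 n s) \<longlongrightarrow> Q 0) (at_right 0)"
    by (rule Lim_transform_eventually[OF P0(2)]) (use ev in \<open>eventually_elim, simp add: fQ\<close>)
  show thesis
  proof (rule that[OF f0 f10])
    fix t assume t: "0 < t" "t < b"
    have c: "((\<lambda>s. complex_of_real (cosh (m * (t - s)))) \<longlongrightarrow> of_real (cosh (m * (t - 0)))) (at_right 0)"
      by (intro tendsto_intros)
    have h: "((\<lambda>s. complex_of_real (hs m (t - s))) \<longlongrightarrow> of_real (hs m (t - 0))) (at_right 0)"
      by (intro tendsto_of_real isCont_tendsto_compose[OF hc] tendsto_intros)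
    have "((\<lambda>s. f n s * of_real (cosh (m * (t - s))) + f1 n s * of_real (hs m (t - s))) \<longlongrightarrow>
       P 0 * of_real (cosh (m * (t - 0))) + Q 0 * of_real (hs m (t - 0))) (at_right 0)"
      by (intro tendsto_add tendsto_mult f0 f10 c h)
    moreover have "((\<lambda>s. f n s * of_real (cosh (m * (t - s))) + f1 n s * of_real (hs m (t - s))) \<longlongrightarrow> f n t) (at_right 0)"
    proof (rule tendsto_eventually)
      show "\<forall>\<^sub>F s in at_right 0. f n s * of_real (cosh (m * (t - s))) + f1 n s * of_real (hs m (t - s)) = f n t"
        using ev
      proof eventually_elim
        case (elim s)
        then show ?case using f_shift[of s t n] t unfolding m_def by simp
      qed
    qed
    ultimately show "f n t = P 0 * of_real (cosh (real_of_int \<bar>n\<bar> * t)) + Q 0 * of_real (hs (real_of_int \<bar>n\<bar>) t)"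
      using tendsto_unique trivial_limit_at_right_real unfolding m_def by fastforce
  qed
qed

lemma tendsto_mode_form:
  assumes "(L \<longlongrightarrow> L0) F" "(a \<longlongrightarrow> a0) F" "(\<beta> \<longlongrightarrow> \<beta>0) F" "(c \<longlongrightarrow> c0) F" "(d \<longlongrightarrow> d0) F" "(p \<longlongrightarrow> p0) F" "(q \<longlongrightarrow> q0) F"
  shows "((\<lambda>s. mode_form (L s) (a s) (\<beta> s) (c s) (d s) n (p s) (q s)) \<longlongrightarrow> mode_form L0 a0 \<beta>0 c0 d0 n p0 q0) F"
proof -
  have hc: "isCont (hs m) x" for x m using hs_deriv DERIV_isCont by blast
  show ?thesis unfolding mode_form_def Let_def
    by (intro tendsto_intros assms isCont_tendsto_compose[OF hc])
qed

text \<open>For T > 1 the certificate is used only with 1 \<le> L, that is for s close to 0.\<close>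

definition ca where "ca T L = (if T \<le> 1 then 1 - (sinh L)\<^sup>2 else (cosh L)\<^sup>2 - 2 * (cosh L * sinh L - 1))" for T L :: real
definition cb where "cb T L = (if T \<le> 1 then 2 * (sinh L)\<^sup>2 else 0)" for T L :: real
definition cc where "cc T L = (if T \<le> 1 then cosh L * sinh L else 1)" for T L :: real
definition cd where "cd T L = (if T \<le> 1 then 0 else cosh L * sinh L - 1)" for T L :: real

lemma c_admissible: "0 < L \<Longrightarrow> L \<le> T \<Longrightarrow> (1 < T \<Longrightarrow> 1 \<le> L) \<Longrightarrow> admissible L (ca T L) (cb T L) (cc T L) (cd T L)"
  unfolding ca_def cb_def cc_def cd_def using admissible_small[of L] admissible_large[of L] by auto

text \<open>Controls the factor of e in the error of \<open>U_ge_modes\<close>; its value is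
  immaterial as long as it does not depend on s.\<close>

lemma c_bound:
  assumes "0 < L" "L \<le> T" "1 < T \<Longrightarrow> 1 \<le> L"
  shows "\<bar>ca T L\<bar> + cb T L + 2 * cd T L \<le> 1 + 5 * (cosh T)\<^sup>2"
proof -
  have C: "cosh L \<le> cosh T" using assms by (intro cosh_real_nonneg_le_iff[THEN iffD2]) auto
  then have C2: "(cosh L)\<^sup>2 \<le> (cosh T)\<^sup>2" by (intro power_mono) auto
  have S2: "(sinh L)\<^sup>2 \<le> (cosh L)\<^sup>2" "0 \<le> (sinh L)\<^sup>2" by (auto simp: cosh_square_eq)
  show ?thesis
  proof (cases "T \<le> 1")
    case True
    have "\<bar>1 - (sinh L)\<^sup>2\<bar> \<le> 1 + (sinh L)\<^sup>2" using S2 by linarith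
    then show ?thesis using S2 C2 unfolding ca_def cb_def cd_def if_P[OF True] by linarith
  next
    case False
    then have k: "1 \<le> cosh L * sinh L" using cosh_sinh_large(1)[of L] assms by auto
    have "cosh L * sinh L \<le> (cosh L)\<^sup>2"
      unfolding power2_eq_square by (intro mult_left_mono sinh_le_cosh_real) auto
    moreover have "\<bar>u - 2 * (k - 1)\<bar> + 0 + 2 * (k - 1) \<le> 1 + 5 * v" if "k \<le> u" "1 \<le> k" "u \<le> v" for u v k :: real
      using that by (simp add: abs_if)
    ultimately show ?thesis using k C2 unfolding ca_def cb_def cd_def if_not_P[OF False] by blast
  qed
qed

text \<open>s tends to 0 for fixed e, and then e tends to 0. The retained mode passes to the limit
  because f_n and f_n' converge, so the inequality still contains the defect of an arbitrary
  mode.\<close>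

lemma U_ge_cosh_mode:
  assumes T: "0 < T" "T < b" and pq: "((\<lambda>s. f n s) \<longlongrightarrow> p) (at_right 0)" "((\<lambda>s. f1 n s) \<longlongrightarrow> q) (at_right 0)"
  shows "(cosh T)\<^sup>2 + mode_form T (ca T T) (cb T T) (cc T T) (cd T T) n p q \<le> U T"
proof -
  define B where "B = 1 + 5 * (cosh T)\<^sup>2"
  have B: "B > 0" by (simp add: B_def add_pos_nonneg)
  define M where "M = (\<lambda>s. mode_form (T - s) (ca T (T - s)) (cb T (T - s)) (cc T (T - s)) (cd T (T - s)) n (f n s) (f1 n s))"
  define T1 where "T1 = (if 1 < T then T - 1 else T)"
  have T1: "0 < T1" "T1 \<le> T" using T by (auto simp: T1_def)
  have ineq: "(cosh T)\<^sup>2 + mode_form T (ca T T) (cb T T) (cc T T) (cd T T) n p q \<le> U T + e * B" if e: "e > 0" for e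
  proof -
    obtain d1 where d1: "d1 > 0" "\<And>s. 0 < s \<Longrightarrow> s < d1 \<Longrightarrow> s < b \<Longrightarrow> U s \<le> 1 + e" using U_lim[OF e] by blast
    obtain d2 where d2: "d2 > 0" "\<And>s. 0 < s \<Longrightarrow> s < d2 \<Longrightarrow> s < b \<Longrightarrow> 1 - e \<le> A s" using A_lower[OF e] by blast
    obtain d3 where d3: "d3 > 0" "\<And>s. 0 < s \<Longrightarrow> s < d3 \<Longrightarrow> s < b \<Longrightarrow> \<exists>N0. \<forall>N\<ge>N0. X N s \<ge> 1 - e" using X_lower[OF e] by blast
    define d where "d = min (min d1 d2) (min d3 T1)"
    have d: "d > 0" using d1 d2 d3 T1 by (simp add: d_def)
    have ev: "\<forall>\<^sub>F s in at_right 0. s \<in> {0<..<d}" using eventually_at_right_real[OF d] .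
    then have ev2: "\<forall>\<^sub>F s in at_right 0. (cosh (T - s))\<^sup>2 + M s \<le> U T + e * B"
    proof eventually_elim
      case (elim s)
      then have s: "0 < s" "s < d1" "s < d2" "s < d3" "s < T1" by (auto simp: d_def)
      have sT: "s < T" "s < b" using s T1 T by auto
      have L: "0 < T - s" "T - s \<le> T" "1 < T \<Longrightarrow> 1 \<le> T - s" using s T1 sT by (auto simp: T1_def)
      obtain N0 where N0: "\<And>N. N \<ge> N0 \<Longrightarrow> X N s \<ge> 1 - e" using d3(2)[OF s(1,4) sT(2)] by blast
      have "(cosh (T - s))\<^sup>2 - e * (\<bar>ca T (T - s)\<bar> + cb T (T - s) + 2 * cd T (T - s)) + M s \<le> U T"
        unfolding M_def
        by (rule U_ge_modes[OF s(1) sT(1) T(2) c_admissible[OF L] less_imp_le[OF e] d1(2)[OF s(1,2) sT(2)] d2(2)[OF s(1,3) sT(2)] N0])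
      moreover have "e * (\<bar>ca T (T - s)\<bar> + cb T (T - s) + 2 * cd T (T - s)) \<le> e * B"
        unfolding B_def using e by (intro mult_left_mono c_bound[OF L]) auto
      ultimately show ?case by linarith
    qed
    have lim: "((\<lambda>s. T - s) \<longlongrightarrow> T - 0) (at_right 0)" by (intro tendsto_intros)
    have cl: "((\<lambda>s. ca T (T - s)) \<longlongrightarrow> ca T (T - 0)) (at_right 0)" "((\<lambda>s. cb T (T - s)) \<longlongrightarrow> cb T (T - 0)) (at_right 0)"
      "((\<lambda>s. cc T (T - s)) \<longlongrightarrow> cc T (T - 0)) (at_right 0)" "((\<lambda>s. cd T (T - s)) \<longlongrightarrow> cd T (T - 0)) (at_right 0)"
      unfolding ca_def cb_def cc_def cd_def by (cases "T \<le> 1"; simp only: if_True if_False; intro tendsto_intros)+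
    have "((\<lambda>s. (cosh (T - s))\<^sup>2 + M s) \<longlongrightarrow> (cosh (T - 0))\<^sup>2 + mode_form (T - 0) (ca T (T - 0)) (cb T (T - 0)) (cc T (T - 0)) (cd T (T - 0)) n p q) (at_right 0)"
      unfolding M_def by (intro tendsto_add tendsto_power tendsto_cosh lim tendsto_mode_form cl pq)
    from tendsto_upperbound[OF this ev2] show ?thesis by simp
  qed
  show ?thesis
  proof (rule field_le_epsilon)
    fix e :: real assume "e > 0"
    then have "e / B > 0" using B by simp
    from ineq[OF this] show "(cosh T)\<^sup>2 + mode_form T (ca T T) (cb T T) (cc T T) (cd T T) n p q \<le> U T + e" using B by simp
  qed
qed

theorem U_lower_bound:
  assumes T: "0 < T" "T < b"
  shows "(cosh T)\<^sup>2 \<le> U T"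
proof -
  obtain p q where pq: "((\<lambda>s. f 0 s) \<longlongrightarrow> p) (at_right 0)" "((\<lambda>s. f1 0 s) \<longlongrightarrow> q) (at_right 0)"
    using f_limits[OF T, of 0] by metis
  have "0 \<le> mode_form T (ca T T) (cb T T) (cc T T) (cd T T) 0 p q"
    by (rule mode_form_nonneg[OF c_admissible]) (use T in auto)
  then show ?thesis using U_ge_cosh_mode[OF T pq] by simp
qed

theorem U_equality:
  assumes T: "0 < T" "T < b" and eq: "U T = (cosh T)\<^sup>2"
  obtains p where "cmod p = 1" "\<And>t x. 0 < t \<Longrightarrow> t < b \<Longrightarrow> H t x = p * of_real (cosh t) * cis x"
proof -
  have adm: "admissible T (ca T T) (cb T T) (cc T T) (cd T T)" by (rule c_admissible) (use T in auto)
  have fn: "f n t = 0" if n: "n \<noteq> 1" and t: "0 < t" "t < b" for n t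
  proof -
    obtain p q where pq: "((\<lambda>s. f n s) \<longlongrightarrow> p) (at_right 0)" "((\<lambda>s. f1 n s) \<longlongrightarrow> q) (at_right 0)"
      and fp: "\<And>t. 0 < t \<Longrightarrow> t < b \<Longrightarrow> f n t = p * of_real (cosh (real_of_int \<bar>n\<bar> * t)) + q * of_real (hs (real_of_int \<bar>n\<bar>) t)"
      using f_limits[OF T, of n] by blast
    have mi: "mode_ineq T (ca T T) (cb T T) (cc T T) (cd T T) n" using adm n unfolding admissible_def by blast
    have "mode_form T (ca T T) (cb T T) (cc T T) (cd T T) n p q \<le> 0" using U_ge_cosh_mode[OF T pq] eq by simp
    then have "p = 0 \<and> q = 0" by (rule mode_form_pos(2)[OF mi T(1)])
    then show ?thesis using fp[OF t] by simp
  qed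
  obtain p q where pq: "((\<lambda>s. f 1 s) \<longlongrightarrow> p) (at_right 0)" "((\<lambda>s. f1 1 s) \<longlongrightarrow> q) (at_right 0)"
    and fp: "\<And>t. 0 < t \<Longrightarrow> t < b \<Longrightarrow> f 1 t = p * of_real (cosh (real_of_int \<bar>1\<bar> * t)) + q * of_real (hs (real_of_int \<bar>1\<bar>) t)"
    using f_limits[OF T, of 1] by blast
  \<comment> \<open>The form of mode 1 does not see p; it yields q = 0, hence f_1 = p cosh, and |p|
    = 1 comes afterwards from the value of U(T).\<close>
  have "mode_form T (ca T T) (cb T T) (cc T T) (cd T T) 1 p q = (sinh T * cmod q)\<^sup>2"
    by (rule mode_form_1) (use adm in \<open>auto simp: admissible_def\<close>)
  then have "(sinh T * cmod q)\<^sup>2 \<le> 0" using U_ge_cosh_mode[OF T pq] eq by simp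
  then have "q = 0" using T by simp
  then have f1p: "f 1 t = p * of_real (cosh t)" if "0 < t" "t < b" for t using fp[OF that] by simp
  have Hp: "H t x = p * of_real (cosh t) * cis x" if t: "0 < t" "t < b" for t x
  proof -
    define v where "v = (\<lambda>x. p * of_real (cosh t) * cis (of_int 1 * x))"
    have v: "continuous_on UNIV v" unfolding v_def by (intro continuous_intros)
    have "H t x - v x = 0"
    proof (rule fcoef_zero_imp[of "\<lambda>x. H t x - v x"])
      show "continuous_on UNIV (\<lambda>x. H t x - v x)" by (intro continuous_intros slice t v)
      show "H t (x + 2 * pi) - v (x + 2 * pi) = H t x - v x" for x
        using per(1)[OF t, of x] by (simp add: v_def cis_mult[symmetric])
      show "fcoef (\<lambda>x. H t x - v x) n = 0" for n
        unfolding fcoef_diff[OF slice(1)[OF t] v] f_def[symmetric] unfolding v_def fcoef_cis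
        using fn[OF _ t, of n] f1p[OF t] by auto
    qed
    then show ?thesis by (simp add: v_def)
  qed
  have "(cmod (H T x))\<^sup>2 = (cmod p)\<^sup>2 * (cosh T)\<^sup>2" for x
    unfolding Hp[OF T] by (simp add: norm_mult power_mult_distrib)
  then have "U T = (cmod p)\<^sup>2 * (cosh T)\<^sup>2" by (simp add: U_def)
  then have "(cmod p)\<^sup>2 = 1" using eq cosh_pos_real[of T] by simp
  then have "cmod p = 1" using norm_ge_zero[of p] by (simp add: power2_eq_1_iff)
  then show thesis using Hp that by blast
qed

end

section \<open>From the annulus to the strip\<close>

text \<open>\<open>dx\<close> and \<open>dy\<close> are defined as derivatives along lines; under
  real differentiability they are the values of the total derivative at 1 and \<i>, which makes the
  chain rule available.\<close>

lemma has_derivative_dx_dy: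
  assumes "f differentiable (at z)"
  shows "(f has_derivative (\<lambda>w. of_real (Re w) * dx f z + of_real (Im w) * dy f z)) (at z)"
proof -
  obtain D where D: "(f has_derivative D) (at z)" using assms unfolding differentiable_def by blast
  then have lin: "linear D" by (simp add: has_derivative_linear)
  have curve: "((\<lambda>t. f (z + v * of_real t)) has_vector_derivative D v) (at 0)" for v
  proof -
    have "((\<lambda>t. z + v * complex_of_real t) has_vector_derivative v) (at 0)"
      by (auto intro!: derivative_eq_intros has_vector_derivative_real_field)
    then have "((\<lambda>t. z + v * complex_of_real t) has_derivative (\<lambda>t. t *\<^sub>R v)) (at 0)"
      by (simp add: has_vector_derivative_def)
    moreover have "(f has_derivative D) (at (z + v * complex_of_real 0))" using D by simp
    ultimately have "((\<lambda>t. f (z + v * complex_of_real t)) has_derivative (\<lambda>t. D (t *\<^sub>R v))) (at 0)"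
      by (rule has_derivative_compose)
    then show ?thesis by (simp add: has_vector_derivative_def linear_scale[OF lin])
  qed
  have 1: "dx f z = D 1" using curve[of 1] unfolding dx_def by (intro vector_derivative_at) simp
  have 2: "dy f z = D \<i>" using curve[of \<i>] unfolding dy_def by (intro vector_derivative_at) simp
  have "D w = of_real (Re w) * dx f z + of_real (Im w) * dy f z" for w
  proof -
    have "D w = D (Re w *\<^sub>R 1 + Im w *\<^sub>R \<i>)" by (rule arg_cong[where f = D]) (simp add: complex_eq_iff)
    also have "\<dots> = Re w *\<^sub>R D 1 + Im w *\<^sub>R D \<i>" by (simp only: linear_add[OF lin] linear_scale[OF lin])
    finally show ?thesis by (simp add: 1 2 scaleR_conv_of_real)
  qed
  then have "D = (\<lambda>w. of_real (Re w) * dx f z + of_real (Im w) * dy f z)" by auto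
  with D show ?thesis by simp
qed

lemma has_vector_derivative_dx_dy:
  assumes "f differentiable (at (\<gamma> t))" "(\<gamma> has_vector_derivative w) (at t)"
  shows "((\<lambda>t. f (\<gamma> t)) has_vector_derivative of_real (Re w) * dx f (\<gamma> t) + of_real (Im w) * dy f (\<gamma> t)) (at t)"
proof -
  have "((\<lambda>t. f (\<gamma> t)) has_derivative (\<lambda>h. of_real (Re (h *\<^sub>R w)) * dx f (\<gamma> t) + of_real (Im (h *\<^sub>R w)) * dy f (\<gamma> t))) (at t)"
    using has_derivative_compose[OF assms(2)[unfolded has_vector_derivative_def] has_derivative_dx_dy[OF assms(1)]] .
  then show ?thesis unfolding has_vector_derivative_def by (simp add: scaleR_conv_of_real algebra_simps)
qed

definition polar :: "real \<Rightarrow> real \<Rightarrow> real \<Rightarrow> complex" where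
  "polar r t x = of_real (r * exp t) * cis x"

lemma norm_polar: "r > 0 \<Longrightarrow> cmod (polar r t x) = r * exp t"
  by (simp add: polar_def norm_mult)

lemma polar_annulus:
  assumes "0 < r" "0 < t" "t < ln (R / r)" "r < R"
  shows "polar r t x \<in> annulus r R"
proof -
  have "exp t < exp (ln (R / r))" using assms(3) by (simp only: exp_less_cancel_iff)
  also have "\<dots> = R / r" using assms by (intro exp_ln) simp
  finally have "exp t < R / r" .
  then show ?thesis using assms by (simp add: annulus_def norm_polar field_simps)
qed

lemma polar_deriv_t: "((\<lambda>t. polar r t x) has_vector_derivative polar r t x) (at t)"
proof -
  have "((\<lambda>t. complex_of_real (r * exp t)) has_vector_derivative of_real (r * exp t)) (at t)"
    by (rule has_vector_derivative_of_real) (auto intro!: derivative_eq_intros)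
  then show ?thesis unfolding polar_def by (rule bounded_linear.has_vector_derivative[OF bounded_linear_mult_left])
qed

lemma polar_deriv_x: "((\<lambda>x. polar r t x) has_vector_derivative \<i> * polar r t x) (at x)"
proof -
  have "(cis has_vector_derivative \<i> * cis x) (at x)" using has_vector_derivative_cis[of 1 x UNIV] by simp
  from bounded_linear.has_vector_derivative[OF bounded_linear_mult_right[of "of_real (r * exp t)"] this]
  show ?thesis unfolding polar_def by (simp add: mult_ac)
qed

lemma polar_Re_Im_deriv:
  "((\<lambda>t. complex_of_real (Re (polar r t x))) has_vector_derivative of_real (Re (polar r t x))) (at t)"
  "((\<lambda>t. complex_of_real (Im (polar r t x))) has_vector_derivative of_real (Im (polar r t x))) (at t)"
  "((\<lambda>x. complex_of_real (Re (polar r t x))) has_vector_derivative of_real (- Im (polar r t x))) (at x)"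
  "((\<lambda>x. complex_of_real (Im (polar r t x))) has_vector_derivative of_real (Re (polar r t x))) (at x)"
  using bounded_linear.has_vector_derivative[OF bounded_linear_compose[OF bounded_linear_of_real bounded_linear_Re] polar_deriv_t[of r x t]]
    bounded_linear.has_vector_derivative[OF bounded_linear_compose[OF bounded_linear_of_real bounded_linear_Im] polar_deriv_t[of r x t]]
    bounded_linear.has_vector_derivative[OF bounded_linear_compose[OF bounded_linear_of_real bounded_linear_Re] polar_deriv_x[of r t x]]
    bounded_linear.has_vector_derivative[OF bounded_linear_compose[OF bounded_linear_of_real bounded_linear_Im] polar_deriv_x[of r t x]]
  by simp_all

lemma strip_cont_polar:
  assumes "continuous_on (annulus r R) F" "0 < r" "r < R"
  shows "strip_cont (ln (R / r)) (\<lambda>t x. F (polar r t x))"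
  unfolding strip_cont_def
proof (rule continuous_on_compose2[OF assms(1)])
  show "continuous_on ({0<..<ln (R / r)} \<times> UNIV) (\<lambda>p. polar r (fst p) (snd p))"
    unfolding polar_def by (intro continuous_intros)
  show "(\<lambda>p. polar r (fst p) (snd p)) ` ({0<..<ln (R / r)} \<times> UNIV) \<subseteq> annulus r R"
    using polar_annulus[OF assms(2) _ _ assms(3)] by auto
qed

text \<open>The mean of u' / u is \<i> times the winding number about 0 of the closed curve u,
  reparametrised to [0, 1]; for a simple closed curve avoiding 0 this number is -1, 0 or 1.\<close>

lemma mean_log_deriv_winding:
  fixes u u' :: "real \<Rightarrow> complex"
  assumes d: "\<And>x. (u has_vector_derivative u' x) (at x)" and c: "continuous_on UNIV u'"
    and nz: "\<And>x. u x \<noteq> 0" and per: "u (2 * pi) = u 0"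
    and inj: "\<And>x y. x \<in> {0..2*pi} \<Longrightarrow> y \<in> {0..2*pi} \<Longrightarrow> u x = u y \<Longrightarrow> x = y \<or> x = 0 \<and> y = 2*pi \<or> x = 2*pi \<and> y = 0"
  shows "\<exists>N\<in>{-1, 0, 1 :: real}. cmean (\<lambda>x. u' x / u x) = \<i> * of_real N"
proof -
  define \<gamma> where "\<gamma> = (\<lambda>y. u (2 * pi * y))"
  have uc: "continuous_on UNIV u"
    using d has_vector_derivative_continuous continuous_at_imp_continuous_on by blast
  have dg: "(\<gamma> has_vector_derivative (2 * pi) *\<^sub>R u' (2 * pi * y)) (at y)" for y
  proof -
    have "((\<lambda>y. 2 * pi * y) has_vector_derivative 2 * pi) (at y)"
      by (auto intro!: derivative_eq_intros)
    from vector_diff_chain_at[OF this d] show ?thesis by (simp add: \<gamma>_def o_def)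
  qed
  have cg: "continuous_on S (\<lambda>y. (2 * pi) *\<^sub>R u' (2 * pi * y))" for S
    by (intro continuous_intros continuous_on_compose2[OF c]) auto
  have "\<gamma> C1_differentiable_on {0..1}"
    unfolding C1_differentiable_on_def
    by (intro exI[of _ "\<lambda>y. (2 * pi) *\<^sub>R u' (2 * pi * y)"] conjI ballI dg cg)
  then have vp: "valid_path \<gamma>" by (simp add: valid_path_def C1_differentiable_imp_piecewise)
  have "simple_path \<gamma>"
    unfolding simple_path_def loop_free_def
  proof (intro conjI ballI impI)
    show "path \<gamma>" using vp by (rule valid_path_imp_path)
    fix x y :: real assume xy: "x \<in> {0..1}" "y \<in> {0..1}" "\<gamma> x = \<gamma> y"
    have "2 * pi * x \<in> {0..2*pi}" "2 * pi * y \<in> {0..2*pi}" using xy by auto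
    from inj[OF this] xy(3) show "x = y \<or> x = 0 \<and> y = 1 \<or> x = 1 \<and> y = 0" by (auto simp: \<gamma>_def)
  qed
  moreover have "pathfinish \<gamma> = pathstart \<gamma>" using per by (simp add: pathfinish_def pathstart_def \<gamma>_def)
  moreover have np: "0 \<notin> path_image \<gamma>" using nz by (auto simp: path_image_def \<gamma>_def image_def)
  ultimately have W: "winding_number \<gamma> 0 \<in> {-1, 0, 1}" by (rule simple_closed_path_winding_number_cases)
  have "contour_integral \<gamma> (\<lambda>w. 1 / (w - 0)) = integral {0..1} (\<lambda>y. 1 / \<gamma> y * vector_derivative \<gamma> (at y))"
    by (simp add: contour_integral_integral)
  also have "\<dots> = integral {0..1} (\<lambda>y. (2 * pi) *\<^sub>R (u' (2 * pi * y) / u (2 * pi * y)))"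
    by (rule integral_cong) (simp add: vector_derivative_at[OF dg], simp add: \<gamma>_def scaleR_conv_of_real)
  also have "\<dots> = (2 * pi) *\<^sub>R integral {0..1} (\<lambda>y. u' (2 * pi * y) / u (2 * pi * y))"
    by (rule integral_cmul)
  also have "integral {0..1} (\<lambda>y. u' (2 * pi * y) / u (2 * pi * y)) = cmean (\<lambda>x. u' x / u x)"
  proof -
    have "continuous_on {0..2*pi} (\<lambda>x. u' x / u x)"
      by (intro continuous_intros continuous_on_subset[OF c] continuous_on_subset[OF uc]) (use nz in auto)
    then have "((\<lambda>x. u' x / u x) has_integral integral {0..2*pi} (\<lambda>x. u' x / u x)) (cbox 0 (2*pi))"
      by (simp add: integrable_integral integrable_continuous_real)
    from has_integral_affinity[OF this, of "2*pi" 0]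
    have "((\<lambda>y. u' (2 * pi * y) / u (2 * pi * y)) has_integral (1 / (2*pi)) *\<^sub>R integral {0..2*pi} (\<lambda>x. u' x / u x)) ((\<lambda>x. (1 / (2*pi)) * x) ` {0..2*pi})"
      by simp
    moreover have "(\<lambda>x. (1 / (2*pi)) * x) ` {0..2*pi} = {0..1}"
      by (subst image_mult_atLeastAtMost) auto
    ultimately show ?thesis by (simp add: cmean_def integral_unique inverse_eq_divide)
  qed
  finally have "winding_number \<gamma> 0 = 1 / (complex_of_real (2 * pi) * \<i>) * ((2 * pi) *\<^sub>R cmean (\<lambda>x. u' x / u x))"
    using winding_number_valid_path[OF vp np] by simp
  also have "\<dots> = cmean (\<lambda>x. u' x / u x) / \<i>" by (simp add: scaleR_conv_of_real)
  finally have "cmean (\<lambda>x. u' x / u x) = \<i> * winding_number \<gamma> 0" by simp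
  then show ?thesis using W by auto
qed

text \<open>Conformal invariance of the Laplacian under z = r exp(t + \<i> x): in H_tt + H_xx the
  first-order terms and the mixed second derivatives cancel in pairs, leaving |z|^2 times the
  Laplacian of h, divided by rs.\<close>

lemma harmonic_strip_polar:
  fixes h :: "complex \<Rightarrow> complex" and r R rs :: real
  assumes r: "0 < r" "r < R" and rs: "0 < rs" and harm: "harmonic_on (annulus r R) h"
  defines "Z \<equiv> polar r"
  defines "H \<equiv> \<lambda>t x. h (Z t x) / of_real rs"
    and "Ht \<equiv> \<lambda>t x. (of_real (Re (Z t x)) * dx h (Z t x) + of_real (Im (Z t x)) * dy h (Z t x)) / of_real rs"
    and "Hx \<equiv> \<lambda>t x. (of_real (- Im (Z t x)) * dx h (Z t x) + of_real (Re (Z t x)) * dy h (Z t x)) / of_real rs"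
  obtains Htt Htx Hxx where "harmonic_strip H Ht Hx Htt Htx Hxx (ln (R / r))"
proof -
  define b where "b = ln (R / r)"
  have b: "b > 0" using r by (simp add: b_def)
  have Zin: "Z t x \<in> annulus r R" if "0 < t" "t < b" for t x
    using polar_annulus[of r t R x] that r by (simp add: Z_def b_def)
  have diff: "h differentiable (at z)" "dx h differentiable (at z)" "dy h differentiable (at z)" if "z \<in> annulus r R" for z
    using harm that unfolding harmonic_on_def by auto
  have cont: "continuous_on (annulus r R) h" "continuous_on (annulus r R) (dx h)" "continuous_on (annulus r R) (dy h)"
    by (rule continuous_at_imp_continuous_on, rule ballI, rule differentiable_imp_continuous_within, rule diff, assumption)+
  have cont2: "continuous_on (annulus r R) (dx (dx h))" "continuous_on (annulus r R) (dx (dy h))"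
     "continuous_on (annulus r R) (dy (dx h))" "continuous_on (annulus r R) (dy (dy h))"
    using harm unfolding harmonic_on_def by auto
  have lap: "dx (dx h) z + dy (dy h) z = 0" if "z \<in> annulus r R" for z
    using harm that unfolding harmonic_on_def by auto
  define \<rho> where "\<rho> = complex_of_real rs"
  have \<rho>: "\<rho> \<noteq> 0" using rs by (simp add: \<rho>_def)
  have dt: "((\<lambda>t. F (Z t x)) has_vector_derivative of_real (Re (Z t x)) * dx F (Z t x) + of_real (Im (Z t x)) * dy F (Z t x)) (at t)"
    if "F differentiable (at (Z t x))" for F t x
    using has_vector_derivative_dx_dy[of F "\<lambda>t. Z t x" t, OF that] polar_deriv_t[of r x t] unfolding Z_def by blast
  have dxx: "((\<lambda>x. F (Z t x)) has_vector_derivative of_real (- Im (Z t x)) * dx F (Z t x) + of_real (Re (Z t x)) * dy F (Z t x)) (at x)"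
    if "F differentiable (at (Z t x))" for F t x
    using has_vector_derivative_dx_dy[of F "\<lambda>x. Z t x" x, OF that] polar_deriv_x[of r t x] unfolding Z_def by force
  note ri = polar_Re_Im_deriv[of r, folded Z_def]
  define Htt where "Htt = (\<lambda>t x. ((of_real (Re (Z t x)) * (of_real (Re (Z t x)) * dx (dx h) (Z t x) + of_real (Im (Z t x)) * dy (dx h) (Z t x)) + of_real (Re (Z t x)) * dx h (Z t x))
    + (of_real (Im (Z t x)) * (of_real (Re (Z t x)) * dx (dy h) (Z t x) + of_real (Im (Z t x)) * dy (dy h) (Z t x)) + of_real (Im (Z t x)) * dy h (Z t x))) / \<rho>)"
  define Htx where "Htx = (\<lambda>t x. ((of_real (- Im (Z t x)) * (of_real (Re (Z t x)) * dx (dx h) (Z t x) + of_real (Im (Z t x)) * dy (dx h) (Z t x)) + of_real (- Im (Z t x)) * dx h (Z t x))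
    + (of_real (Re (Z t x)) * (of_real (Re (Z t x)) * dx (dy h) (Z t x) + of_real (Im (Z t x)) * dy (dy h) (Z t x)) + of_real (Re (Z t x)) * dy h (Z t x))) / \<rho>)"
  define Hxx where "Hxx = (\<lambda>t x. ((of_real (- Im (Z t x)) * (of_real (- Im (Z t x)) * dx (dx h) (Z t x) + of_real (Re (Z t x)) * dy (dx h) (Z t x)) + of_real (- Re (Z t x)) * dx h (Z t x))
    + (of_real (Re (Z t x)) * (of_real (- Im (Z t x)) * dx (dy h) (Z t x) + of_real (Re (Z t x)) * dy (dy h) (Z t x)) + of_real (- Im (Z t x)) * dy h (Z t x))) / \<rho>)"
  have mi: "((\<lambda>t. complex_of_real (- Im (Z t x))) has_vector_derivative of_real (- Im (Z t x))) (at t)" for t x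
    using has_vector_derivative_minus[OF ri(2)[of x t]] by simp
  have mi': "((\<lambda>x. complex_of_real (- Im (Z t x))) has_vector_derivative of_real (- Re (Z t x))) (at x)" for t x
    using has_vector_derivative_minus[OF ri(4)[of t x]] by simp
  note dv = bounded_linear.has_vector_derivative[OF bounded_linear_divide[of \<rho>]]
  have fc: "strip_cont b (\<lambda>t x. F (Z t x))" if "continuous_on (annulus r R) F" for F :: "complex \<Rightarrow> complex"
    using strip_cont_polar[OF that r] unfolding Z_def b_def .
  have zc: "strip_cont b (\<lambda>t x. complex_of_real (Re (Z t x)))" "strip_cont b (\<lambda>t x. complex_of_real (Im (Z t x)))"
    "strip_cont b (\<lambda>t x. complex_of_real (- Im (Z t x)))" "strip_cont b (\<lambda>t x. complex_of_real (- Re (Z t x)))"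
    by (rule fc, intro continuous_intros)+
  have divc: "strip_cont b (\<lambda>t x. F t x / \<rho>)" if "strip_cont b F" for F
    using strip_cont_mult[OF that strip_cont_const[of b "inverse \<rho>"]] by (simp add: divide_inverse)
  have Zper: "Z t (x + 2 * pi) = Z t x" for t x
    by (simp add: Z_def polar_def cis_mult[symmetric])
  have "harmonic_strip H Ht Hx Htt Htx Hxx b"
  proof
    show "0 < b" by (rule b)
    fix t x assume t: "0 < t" "t < b"
    note dd = diff[OF Zin[OF t]]
    show "((\<lambda>t. H t x) has_vector_derivative Ht t x) (at t)"
      unfolding H_def Ht_def \<rho>_def[symmetric] by (rule dv[OF dt[OF dd(1)]])
    show "((\<lambda>x. H t x) has_vector_derivative Hx t x) (at x)"
      unfolding H_def Hx_def \<rho>_def[symmetric] by (rule dv[OF dxx[OF dd(1)]])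
    show "((\<lambda>t. Ht t x) has_vector_derivative Htt t x) (at t)"
      unfolding Ht_def Htt_def \<rho>_def[symmetric]
      by (rule dv[OF has_vector_derivative_add[OF has_vector_derivative_mult[OF ri(1) dt[OF dd(2)]] has_vector_derivative_mult[OF ri(2) dt[OF dd(3)]]]])
    show "((\<lambda>t. Hx t x) has_vector_derivative Htx t x) (at t)"
      unfolding Hx_def Htx_def \<rho>_def[symmetric]
      by (rule dv[OF has_vector_derivative_add[OF has_vector_derivative_mult[OF mi dt[OF dd(2)]] has_vector_derivative_mult[OF ri(1) dt[OF dd(3)]]]])
    show "((\<lambda>x. Hx t x) has_vector_derivative Hxx t x) (at x)"
      unfolding Hx_def Hxx_def \<rho>_def[symmetric]
      by (rule dv[OF has_vector_derivative_add[OF has_vector_derivative_mult[OF mi' dxx[OF dd(2)]] has_vector_derivative_mult[OF ri(3) dxx[OF dd(3)]]]])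
    show "H t (x + 2 * pi) = H t x" "Ht t (x + 2 * pi) = Ht t x" "Hx t (x + 2 * pi) = Hx t x"
      unfolding H_def Ht_def Hx_def Zper by auto
    show "Htt t x + Hxx t x = 0"
    proof -
      have "Htt t x + Hxx t x = (of_real (Re (Z t x)) ^ 2 + of_real (Im (Z t x)) ^ 2) * (dx (dx h) (Z t x) + dy (dy h) (Z t x)) / \<rho>"
        unfolding Htt_def Hxx_def add_divide_distrib[symmetric] by (simp add: algebra_simps power2_eq_square)
      then show ?thesis using lap[OF Zin[OF t]] by simp
    qed
  next
    show "strip_cont b H" unfolding H_def \<rho>_def[symmetric] by (intro divc fc cont)
    show "strip_cont b Ht" unfolding Ht_def \<rho>_def[symmetric] by (intro divc strip_cont_add strip_cont_mult fc cont zc)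
    show "strip_cont b Hx" unfolding Hx_def \<rho>_def[symmetric] by (intro divc strip_cont_add strip_cont_mult fc cont zc)
    show "strip_cont b Htt" unfolding Htt_def by (intro divc strip_cont_add strip_cont_mult fc cont cont2 zc)
    show "strip_cont b Htx" unfolding Htx_def by (intro divc strip_cont_add strip_cont_mult fc cont cont2 zc)
    show "strip_cont b Hxx" unfolding Hxx_def by (intro divc strip_cont_add strip_cont_mult fc cont cont2 zc)
  qed
  then show thesis unfolding b_def by (rule that)
qed

theorem theorem1p5:
  fixes r R rs :: real and Astar :: "complex set" and h :: "complex \<Rightarrow> complex"
  assumes "0 < r" "r < R" "0 < rs"
    and "dc_domain_inner_circle Astar rs"
    and "harmonic_on (annulus r R) h"
    and "sense_preserving_on (annulus r R) h"
    and "\<exists>g. homeomorphism (annulus r R) Astar h g"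
    and inner: "\<forall>\<epsilon>>0. \<exists>\<delta>>0. \<forall>z\<in>annulus r R. cmod z < r + \<delta> \<longrightarrow> \<bar>cmod (h z) - rs\<bar> < \<epsilon>"
  shows "(\<forall>\<sigma>. r < \<sigma> \<and> \<sigma> < R \<longrightarrow> circ_mean2 h \<sigma> \<ge> (\<sigma> / r + r / \<sigma>) / 2 * rs)
    \<and> ((\<exists>\<sigma>. r < \<sigma> \<and> \<sigma> < R \<and> circ_mean2 h \<sigma> = (\<sigma> / r + r / \<sigma>) / 2 * rs) \<longrightarrow>
        (\<forall>\<sigma>. r < \<sigma> \<and> \<sigma> < R \<longrightarrow> circ_mean2 h \<sigma> = (\<sigma> / r + r / \<sigma>) / 2 * rs) \<and>
        (\<exists>\<alpha>. 0 \<le> \<alpha> \<and> \<alpha> < 2 * pi \<and>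
           (\<forall>z\<in>annulus r R. h z = (z / of_real r + of_real r / cnj z) / 2 * of_real rs * exp (\<i> * of_real \<alpha>))))"
proof -
  note r = assms(1,2) and rs = assms(3)
  define b where "b = ln (R / r)"
  define H where "H = (\<lambda>t x. h (polar r t x) / of_real rs)"
  define Ht where "Ht = (\<lambda>t x. (of_real (Re (polar r t x)) * dx h (polar r t x) + of_real (Im (polar r t x)) * dy h (polar r t x)) / of_real rs)"
  define Hx where "Hx = (\<lambda>t x. (of_real (- Im (polar r t x)) * dx h (polar r t x) + of_real (Re (polar r t x)) * dy h (polar r t x)) / of_real rs)"
  have "\<exists>Htt Htx Hxx. harmonic_strip H Ht Hx Htt Htx Hxx b"
    unfolding H_def Ht_def Hx_def b_def
    by (rule harmonic_strip_polar[OF r rs assms(5)]) (intro exI, assumption)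
  then obtain Htt Htx Hxx where "harmonic_strip H Ht Hx Htt Htx Hxx b" by blast
  then interpret harmonic_strip H Ht Hx Htt Htx Hxx b .
  have pin: "polar r t x \<in> annulus r R" if "0 < t" "t < b" for t x
    using polar_annulus[of r t R x] that r by (simp add: b_def)
  obtain g where hg: "homeomorphism (annulus r R) Astar h g" using assms(7) by blast
  have himg: "cmod (h z) > rs" if "z \<in> annulus r R" for z
  proof -
    have "h z \<in> Astar" using hg that unfolding homeomorphism_def by auto
    moreover have "cball 0 rs \<subseteq> - Astar"
      using assms(4) in_components_subset unfolding dc_domain_inner_circle_def by blast
    ultimately have "h z \<notin> cball 0 rs" by blast
    then show ?thesis by simp
  qed
  have hinj: "inj_on h (annulus r R)" using hg unfolding homeomorphism_def by (metis inj_onI)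
  interpret nitsche_strip H Ht Hx Htt Htx Hxx b
  proof
    show "1 < cmod (H t x)" if "0 < t" "t < b" for t x
      using himg[OF pin[OF that, of x]] rs by (simp add: H_def norm_divide)
    show "\<exists>d>0. \<forall>t x. 0 < t \<longrightarrow> t < d \<longrightarrow> t < b \<longrightarrow> cmod (H t x) < 1 + e" if e: "e > 0" for e
    proof -
      have "e * rs > 0" using e rs by simp
      then obtain \<delta> where \<delta>: "\<delta> > 0" "\<And>z. z \<in> annulus r R \<Longrightarrow> cmod z < r + \<delta> \<Longrightarrow> \<bar>cmod (h z) - rs\<bar> < e * rs"
        using inner by blast
      define d where "d = ln (1 + \<delta> / r)"
      have d: "d > 0" unfolding d_def by (rule ln_gt_zero) (use \<delta>(1) r in simp)
      have "cmod (H t x) < 1 + e" if t: "0 < t" "t < d" "t < b" for t x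
      proof -
        have "exp t < exp d" using t by simp
        also have "\<dots> = 1 + \<delta> / r" using \<delta>(1) r by (simp add: d_def add_pos_pos)
        finally have "r * exp t < r + \<delta>" using r by (simp add: field_simps)
        then have "\<bar>cmod (h (polar r t x)) - rs\<bar> < e * rs"
          using \<delta>(2)[OF pin[OF t(1,3)]] r by (simp add: norm_polar)
        then have "cmod (h (polar r t x)) < (1 + e) * rs" by (simp add: algebra_simps abs_less_iff)
        then show ?thesis using rs by (simp add: H_def norm_divide pos_divide_less_eq)
      qed
      then show ?thesis using d by blast
    qed
    show "0 < J t x" if t: "0 < t" "t < b" for t x
    proof -
      define X Y p q where "X = Re (polar r t x)" and "Y = Im (polar r t x)" and "p = dx h (polar r t x)" and "q = dy h (polar r t x)"
      have "jacobian_det h (polar r t x) > 0" using assms(6) pin[OF t] unfolding sense_preserving_on_def by blast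
      then have "Re p * Im q - Im p * Re q > 0" unfolding jacobian_det_def p_def q_def .
      moreover have "X\<^sup>2 + Y\<^sup>2 > 0"
      proof -
        have "X\<^sup>2 + Y\<^sup>2 = (cmod (polar r t x))\<^sup>2" by (simp add: X_def Y_def cmod_power2)
        then show ?thesis using norm_polar[OF r(1), of t x] r by simp
      qed
      \<comment> \<open>X^2 + Y^2 = |z|^2 is the Jacobian of the logarithmic polar coordinates, and
        1 / rs^2 that of the rescaling of the target.\<close>
      moreover have "J t x = (X\<^sup>2 + Y\<^sup>2) * (Re p * Im q - Im p * Re q) / rs\<^sup>2"
      proof -
        have e: "Ht t x = (of_real X * p + of_real Y * q) / of_real rs" "Hx t x = (of_real (- Y) * p + of_real X * q) / of_real rs"
          by (simp_all add: Ht_def Hx_def X_def Y_def p_def q_def)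
        show ?thesis unfolding J_def e using rs by (simp add: field_simps power2_eq_square)
      qed
      ultimately show ?thesis using rs by simp
    qed
    show "\<exists>N\<in>{-1, 0, 1}. cmean (\<lambda>x. Hx t x / H t x) = \<i> * complex_of_real N" if t: "0 < t" "t < b" for t
    proof (rule mean_log_deriv_winding[OF dHx[OF t] slice(3)[OF t] _ per0(1)[OF t]])
      show "H t x \<noteq> 0" for x using himg[OF pin[OF t, of x]] rs by (auto simp: H_def)
      fix x y assume xy: "x \<in> {0..2*pi}" "y \<in> {0..2*pi}" "H t x = H t y"
      then have "h (polar r t x) = h (polar r t y)" using rs by (simp add: H_def)
      then have "polar r t x = polar r t y" using hinj pin[OF t] unfolding inj_on_def by blast
      then have "cis x = cis y" using r by (simp add: polar_def)
      then have "cos x = cos y" "sin x = sin y" by (auto simp: complex_eq_iff)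
      then obtain k :: int where k: "x = y + 2 * pi * of_int k" by (metis sin_cos_eq_iff mult.commute)
      have "2 * pi * \<bar>of_int k\<bar> = \<bar>x - y\<bar>" using k by (simp add: abs_mult)
      also have "\<dots> \<le> 2 * pi * 1" using xy by auto
      finally have "\<bar>real_of_int k\<bar> \<le> 1" by simp
      then have "\<bar>k\<bar> \<le> 1" by linarith
      then have "k = -1 \<or> k = 0 \<or> k = 1" by arith
      then show "x = y \<or> x = 0 \<and> y = 2*pi \<or> x = 2*pi \<and> y = 0" using k xy by auto
    qed
  qed
  have mean: "circ_mean2 h \<sigma> = rs * sqrt (U (ln (\<sigma> / r)))" and ch: "cosh (ln (\<sigma> / r)) = (\<sigma> / r + r / \<sigma>) / 2"
    and T: "0 < ln (\<sigma> / r)" "ln (\<sigma> / r) < b" if \<sigma>: "r < \<sigma>" "\<sigma> < R" for \<sigma>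
  proof -
    have s: "\<sigma> > 0" using r \<sigma> by simp
    show "0 < ln (\<sigma> / r)" using r \<sigma> by simp
    show "ln (\<sigma> / r) < b" using r \<sigma> s by (simp add: b_def divide_strict_right_mono)
    show "cosh (ln (\<sigma> / r)) = (\<sigma> / r + r / \<sigma>) / 2" using r s by (simp add: cosh_ln_real)
    have pol: "polar r (ln (\<sigma> / r)) x = of_real \<sigma> * cis x" for x using r s by (simp add: polar_def)
    have ptw: "(cmod (h (of_real \<sigma> * cis x)))\<^sup>2 * \<sigma> = (\<sigma> * rs\<^sup>2) * (cmod (H (ln (\<sigma> / r)) x))\<^sup>2" for x
      using rs by (simp add: H_def pol norm_divide power_divide)
    have "integral {0..2*pi} (\<lambda>x. (cmod (h (of_real \<sigma> * cis x)))\<^sup>2 * \<sigma>) = (\<sigma> * rs\<^sup>2) * integral {0..2*pi} (\<lambda>x. (cmod (H (ln (\<sigma> / r)) x))\<^sup>2)"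
      unfolding ptw by (rule integral_mult_right)
    then have "circ_mean2 h \<sigma> = sqrt (rs\<^sup>2 * U (ln (\<sigma> / r)))"
      using s unfolding circ_mean2_def U_def cmean_def by (simp add: field_simps)
    then show "circ_mean2 h \<sigma> = rs * sqrt (U (ln (\<sigma> / r)))" using rs by (simp add: real_sqrt_mult)
  qed
  have part1: "circ_mean2 h \<sigma> \<ge> (\<sigma> / r + r / \<sigma>) / 2 * rs" if \<sigma>: "r < \<sigma>" "\<sigma> < R" for \<sigma>
  proof -
    have "cosh (ln (\<sigma> / r)) \<le> sqrt (U (ln (\<sigma> / r)))" by (rule real_le_rsqrt[OF U_lower_bound[OF T[OF \<sigma>]]])
    then show ?thesis unfolding mean[OF \<sigma>] ch[OF \<sigma>] using rs by (simp add: mult.commute)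
  qed
  have part2: "(\<forall>\<sigma>. r < \<sigma> \<and> \<sigma> < R \<longrightarrow> circ_mean2 h \<sigma> = (\<sigma> / r + r / \<sigma>) / 2 * rs) \<and>
        (\<exists>\<alpha>. 0 \<le> \<alpha> \<and> \<alpha> < 2 * pi \<and>
           (\<forall>z\<in>annulus r R. h z = (z / of_real r + of_real r / cnj z) / 2 * of_real rs * exp (\<i> * of_real \<alpha>)))"
    if \<sigma>: "r < \<sigma>" "\<sigma> < R" and eq: "circ_mean2 h \<sigma> = (\<sigma> / r + r / \<sigma>) / 2 * rs" for \<sigma>
  proof -
    have "sqrt (U (ln (\<sigma> / r))) = cosh (ln (\<sigma> / r))" using eq rs unfolding mean[OF \<sigma>] ch[OF \<sigma>] by simp
    then have "(sqrt (U (ln (\<sigma> / r))))\<^sup>2 = (cosh (ln (\<sigma> / r)))\<^sup>2" by simp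
    then have "U (ln (\<sigma> / r)) = (cosh (ln (\<sigma> / r)))\<^sup>2" using U_nonneg[OF T[OF \<sigma>]] by simp
    from U_equality[OF T[OF \<sigma>] this]
    obtain p where p: "cmod p = 1" "\<And>t x. 0 < t \<Longrightarrow> t < b \<Longrightarrow> H t x = p * of_real (cosh t) * cis x" by blast
    have "circ_mean2 h \<sigma>' = (\<sigma>' / r + r / \<sigma>') / 2 * rs" if \<sigma>': "r < \<sigma>'" "\<sigma>' < R" for \<sigma>'
    proof -
      have "(cmod (H (ln (\<sigma>' / r)) x))\<^sup>2 = (cosh (ln (\<sigma>' / r)))\<^sup>2" for x
        unfolding p(2)[OF T[OF \<sigma>']] by (simp add: norm_mult p(1))
      then have "U (ln (\<sigma>' / r)) = (cosh (ln (\<sigma>' / r)))\<^sup>2" by (simp add: U_def)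
      then show ?thesis unfolding mean[OF \<sigma>'] ch[OF \<sigma>', symmetric] by (simp add: mult.commute)
    qed
    moreover have "h z = (z / of_real r + of_real r / cnj z) / 2 * of_real rs * exp (\<i> * of_real (Arg2pi p))" if z: "z \<in> annulus r R" for z
    proof -
      define t x where "t = ln (cmod z / r)" and "x = Arg z"
      have zz: "r < cmod z" "cmod z < R" using z by (auto simp: annulus_def)
      have tt: "0 < t" "t < b" using T[OF zz] by (auto simp: t_def)
      have z0: "z \<noteq> 0" using zz r by auto
      have et: "exp t = cmod z / r" using r z0 by (simp add: t_def)
      have zp: "z = polar r t x"
        unfolding polar_def et x_def using r cis_Arg[OF z0] z0 by (simp add: sgn_eq)
      \<comment> \<open>|p| = 1 makes p a pure phase, and \<open>Arg2pi\<close> supplies the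
        representative \<alpha> in [0, 2 pi).\<close>
      have pe: "p = exp (\<i> * of_real (Arg2pi p))" using Arg2pi_eq[of p] p(1) by simp
      have "h z = H t x * of_real rs" using rs by (simp add: H_def zp)
      also have "\<dots> = p * (of_real (cosh t) * cis x) * of_real rs" unfolding p(2)[OF tt] by simp
      also have "of_real (cosh t) * cis x = (z / of_real r + of_real r / cnj z) / 2"
      proof -
        have "z / of_real r = of_real (exp t) * cis x" unfolding zp polar_def using r by simp
        moreover have "of_real r / cnj z = of_real (exp (- t)) * cis x"
        proof -
          have "cis x * cnj (cis x) = 1" by (simp add: cis_cnj cis_mult)
          then have "of_real (exp (- t)) * cis x * cnj z = of_real (exp (- t) * (r * exp t))"
            unfolding zp polar_def by (simp add: mult_ac)
          also have "exp (- t) * (r * exp t) = r" by (simp add: exp_minus)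
          finally show ?thesis using z0 by (simp add: divide_eq_eq)
        qed
        ultimately show ?thesis by (simp add: cosh_field_def algebra_simps add_divide_distrib)
      qed
      finally show ?thesis using pe by (simp add: mult_ac)
    qed
    ultimately show ?thesis using Arg2pi_ge_0[of p] Arg2pi_lt_2pi[of p] by blast
  qed
  show ?thesis using part1 part2 by blast
qed

end
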